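(* Consider the optimal rescaling $\mathcal{F}$ of the "Figure Eight", and let $F(\mathcal{F})=\int_{\mathcal{F}}(k^2+1)\,\mathrm{d}s$ be its penalized elastic energy. Then $F(\mathcal{F})\approx 21.2075$.
   Context: For a regular planar curve $\gamma$ of class $H^2$, with scalar curvature $k$ and arclength parameter $s$, put $E(\gamma)=\int_\gamma k^2\,\mathrm{d}s$ (elastic energy), $L(\gamma)=\int_\gamma 1\,\mathrm{d}s$ (length), and $F(\gamma)=E(\gamma)+L(\gamma)$. A closed elastica is a closed regular planar curve that is a critical point of $E$ under a length constraint; its scalar curvature satisfies $2\partial_s^2k+k^3-\delta k=0$ for some constant $\delta$. By a theorem of Langer and Singer, the only closed planar elasticae are the circle, the "Figure Eight", and the multiple covers of these two. The "Figure Eight" is thus the unique (up to multiple coverings, isometries and dilations of $\mathbb{R}^2$) closed planar elastica with a self-intersection; it is here traversed exactly once. Its optimal rescaling $\mathcal{F}$ is the dilated copy $\lambda\gamma$ of a Figure Eight $\gamma$ for which $F(\lambda\gamma)=\lambda^{-1}E(\gamma)+\lambda L(\gamma)$ is minimal among all $\lambda>0$. The symbol $\approx$ denotes a numerical approximation, obtained by computer-assisted computation. *)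

theory Defs
  imports "HOL-Analysis.Analysis"
begin

text \<open>
  The Euclidean plane is identified with \<^typ>\<open>complex\<close>. A closed curve is a 1-periodic map on the
  real line, so that its derivatives match up at the endpoints of a period as well.
\<close>

abbreviation velocity :: "(real \<Rightarrow> complex) \<Rightarrow> real \<Rightarrow> complex" where
  "velocity \<gamma> t \<equiv> vector_derivative \<gamma> (at t)"

abbreviation acceleration :: "(real \<Rightarrow> complex) \<Rightarrow> real \<Rightarrow> complex" where
  "acceleration \<gamma> t \<equiv> vector_derivative (velocity \<gamma>) (at t)"

text \<open>
  Class \<open>H\<^sup>2\<close> (locally, in one variable): the first derivative exists everywhere and is absolutely
  continuous, i.e. it is differentiable almost everywhere and is an indefinite integral of its
  derivative; and this second derivative is locally square integrable.
\<close>

definition class_H2 :: "(real \<Rightarrow> complex) \<Rightarrow> bool" where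
  "class_H2 \<gamma> \<longleftrightarrow>
     (\<forall>t. \<gamma> differentiable (at t)) \<and>
     negligible {t. \<not> velocity \<gamma> differentiable (at t)} \<and>
     (\<forall>a b. a \<le> b \<longrightarrow>
        acceleration \<gamma> absolutely_integrable_on {a..b} \<and>
        (acceleration \<gamma> has_integral (velocity \<gamma> b - velocity \<gamma> a)) {a..b} \<and>
        (\<lambda>t. (norm (acceleration \<gamma> t))\<^sup>2) integrable_on {a..b})"

definition closed_H2 :: "(real \<Rightarrow> complex) \<Rightarrow> bool" where
  "closed_H2 \<gamma> \<longleftrightarrow> class_H2 \<gamma> \<and> (\<forall>t. \<gamma> (t + 1) = \<gamma> t)"

definition closed_regular_curve :: "(real \<Rightarrow> complex) \<Rightarrow> bool" where
  "closed_regular_curve \<gamma> \<longleftrightarrow> closed_H2 \<gamma> \<and> (\<forall>t. velocity \<gamma> t \<noteq> 0)"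

text \<open>\<open>Im (cnj v * w)\<close> is the determinant of the plane vectors \<open>v\<close> and \<open>w\<close>.\<close>

definition curvature :: "(real \<Rightarrow> complex) \<Rightarrow> real \<Rightarrow> real" where
  "curvature \<gamma> t = Im (cnj (velocity \<gamma> t) * acceleration \<gamma> t) / norm (velocity \<gamma> t) ^ 3"

text \<open>The arclength element is \<open>ds = norm (velocity \<gamma> t) dt\<close>.\<close>

definition elastic_energy :: "(real \<Rightarrow> complex) \<Rightarrow> real" where
  "elastic_energy \<gamma> = integral {0..1} (\<lambda>t. (curvature \<gamma> t)\<^sup>2 * norm (velocity \<gamma> t))"

definition curve_length :: "(real \<Rightarrow> complex) \<Rightarrow> real" where
  "curve_length \<gamma> = integral {0..1} (\<lambda>t. norm (velocity \<gamma> t))"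

definition penalized_energy :: "(real \<Rightarrow> complex) \<Rightarrow> real" where
  "penalized_energy \<gamma> = elastic_energy \<gamma> + curve_length \<gamma>"

definition perturb :: "(real \<Rightarrow> complex) \<Rightarrow> (real \<Rightarrow> complex) \<Rightarrow> real \<Rightarrow> real \<Rightarrow> complex" where
  "perturb \<gamma> \<phi> \<epsilon> t = \<gamma> t + \<epsilon> *\<^sub>R \<phi> t"

text \<open>
  Critical point of the energy under a length constraint: the first variation of the energy
  vanishes on every direction tangent to the level set of the length, i.e. on the kernel of the
  first variation of the length. (The length has no critical points among closed regular curves,
  since dilating a curve changes its length to first order.)
\<close>

definition closed_elastica :: "(real \<Rightarrow> complex) \<Rightarrow> bool" where
  "closed_elastica \<gamma> \<longleftrightarrow>
     closed_regular_curve \<gamma> \<and>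
     (\<forall>\<phi>. closed_H2 \<phi> \<longrightarrow>
        ((\<lambda>\<epsilon>. curve_length (perturb \<gamma> \<phi> \<epsilon>)) has_real_derivative 0) (at 0) \<longrightarrow>
        ((\<lambda>\<epsilon>. elastic_energy (perturb \<gamma> \<phi> \<epsilon>)) has_real_derivative 0) (at 0))"

definition self_intersecting :: "(real \<Rightarrow> complex) \<Rightarrow> bool" where
  "self_intersecting \<gamma> \<longleftrightarrow> (\<exists>s\<in>{0..<1}. \<exists>t\<in>{0..<1}. s \<noteq> t \<and> \<gamma> s = \<gamma> t)"

text \<open>
  \<open>\<gamma>\<close> runs at least twice through some closed curve \<open>\<beta>\<close>, up to a change of parameter \<open>\<phi>\<close>
  (\<open>\<gamma>\<close> need not have constant speed).
\<close>

definition multiple_cover :: "(real \<Rightarrow> complex) \<Rightarrow> bool" where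
  "multiple_cover \<gamma> \<longleftrightarrow>
     (\<exists>\<beta> \<phi> m. closed_regular_curve \<beta> \<and> (m::nat) \<ge> 2 \<and>
        continuous_on UNIV \<phi> \<and> strict_mono \<phi> \<and>
        (\<forall>t. \<phi> (t + 1) = \<phi> t + real m) \<and> (\<forall>t. \<gamma> t = \<beta> (\<phi> t)))"

text \<open>
  A multiply covered circle also meets itself in the sense of \<^const>\<open>self_intersecting\<close>; it is
  excluded by the last condition.
\<close>

definition figure_eight :: "(real \<Rightarrow> complex) \<Rightarrow> bool" where
  "figure_eight \<gamma> \<longleftrightarrow> closed_elastica \<gamma> \<and> self_intersecting \<gamma> \<and> \<not> multiple_cover \<gamma>"

definition dilate :: "real \<Rightarrow> (real \<Rightarrow> complex) \<Rightarrow> real \<Rightarrow> complex" where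
  "dilate c \<gamma> t = c *\<^sub>R \<gamma> t"

definition optimal_rescaling :: "(real \<Rightarrow> complex) \<Rightarrow> (real \<Rightarrow> complex) \<Rightarrow> bool" where
  "optimal_rescaling \<gamma> \<Gamma> \<longleftrightarrow>
     (\<exists>c>0. \<Gamma> = dilate c \<gamma> \<and>
        (\<forall>d>0. penalized_energy (dilate c \<gamma>) \<le> penalized_energy (dilate d \<gamma>)))"

end

theory Submission
  imports Defs
begin

text \<open>
  Let \<open>\<tau>\<close> be the unit tangent, \<open>\<kappa>\<close> the curvature and \<open>s\<close> the arclength of a closed elastica, and identify
  the plane with the complex numbers, so that \<open>d\<tau>/ds = \<i>\<kappa>\<tau>\<close>. A variation is determined by the
  derivative \<open>W\<close> of the displacement, which is subject only to being periodic with mean zero.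
  The first variations of length and energy are \<open>\<integral>\<langle>\<tau>,W\<rangle> ds\<close> and \<open>\<integral>(2\<kappa>\<langle>\<i>\<tau>,W'\<rangle> - 3\<kappa>\<^sup>2\<langle>\<tau>,W\<rangle>) ds\<close>
  (\<open>first_variation\<close>), and testing with the dilation of the curve itself shows that the Lagrange
  multiplier is \<open>\<Lambda> = E/L\<close>. The lemma of du Bois-Reymond turns criticality into regularity of
  \<open>\<kappa>\<close> and into a conservation law: the vector \<open>c = (\<kappa>\<^sup>2 - \<Lambda>)\<tau> + 2 (d\<kappa>/ds) \<i>\<tau>\<close> is constant
  (\<open>elastica_equations\<close>). In other words the tangent angle moves like a pendulum.

  If \<open>\<kappa>\<close> has no zero, then integrating the Riccati equation of \<open>\<kappa>'/\<kappa>\<close> over a period, where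
  \<open>\<kappa>\<^sup>2 - \<Lambda>\<close> has mean zero, forces \<open>\<kappa>\<close> to be constant. The curve is then a circle, which either
  has no self-intersection or is a multiple cover (\<open>circle\<close>).

  If \<open>\<kappa>\<close> has a zero, then \<open>\<Lambda> < |c|\<close>, since at the separatrix \<open>\<Lambda> = |c|\<close> the curvature would vanish
  identically. The pendulum oscillates, and \<open>\<kappa> = M sin \<Phi>\<close> for a phase \<open>\<Phi>\<close> with
  \<open>d\<Phi>/ds = w \<surd>(1 - x cos\<^sup>2 \<Phi>)\<close>. The curve is a function of its phase alone and this function is
  periodic, so that \<open>\<Phi>\<close> increases by exactly \<open>2\<pi>\<close> unless the curve is a multiple cover. Integrating
  with respect to the phase expresses everything by the elliptic integrals \<open>K\<close> and \<open>E\<close> over a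
  full period \<open>2\<pi>\<close>, with parameter \<open>x\<close> under the root: the mean value zero of \<open>\<kappa>\<^sup>2 - \<Lambda>\<close>
  becomes \<open>2 E(x) = K(x)\<close>, and the product of energy and length
  becomes \<open>2 (2x - 1) K(x)\<^sup>2\<close> (\<open>wavelike\<close>).

  By the inequality of arithmetic and geometric means, the optimally rescaled curve has penalized
  energy \<open>2 \<surd>(energy \<sqdot> length)\<close>. It remains to enclose the root of \<open>2 E - K\<close>. This function decreases
  and \<open>(2x - 1) K\<^sup>2\<close> increases, hence it suffices to evaluate both on either side of the root. With
  \<open>x = 2r/(1+r)\<close> the integrands are powers of \<open>1 - r cos 2\<theta>\<close>, whose binomial series converges like
  \<open>r\<^sup>2\<^sup>n\<close> after integration (\<open>wavelike_value\<close>).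

  All differential equations are written in the given parameter, with the speed \<open>\<rho>\<close> as a factor.
  The parameter of a curve of class \<open>H\<^sup>2\<close> may be no smoother than the curve itself, but \<open>\<tau>\<close>, \<open>\<kappa>\<close> and
  \<open>\<Phi>\<close> turn out to be continuously differentiable in it, because \<open>\<rho>\<close> is continuous.
\<close>

section \<open>Indefinite integrals and integrals depending on a parameter\<close>

text \<open>
  If \<open>H\<close> is increasing and the derivative of \<open>D\<close> with respect to \<open>H\<close> vanishes everywhere, then the
  increments of \<open>D\<close> are at most \<open>e\<close> times those of \<open>H\<close> on short intervals, and these bounds add up
  (Bolzano's bisection).
\<close>

lemma constant_if_derivative_zero_wrt:
  fixes D :: "real \<Rightarrow> 'b::real_normed_vector" and H :: "real \<Rightarrow> real"
  assumes "a \<le> b"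
    and mono: "\<And>x y. a \<le> x \<Longrightarrow> x \<le> y \<Longrightarrow> y \<le> b \<Longrightarrow> H x \<le> H y"
    and loc: "\<And>x e. x \<in> {a..b} \<Longrightarrow> e > 0 \<Longrightarrow>
      \<exists>d>0. \<forall>y\<in>{a..b}. \<bar>y - x\<bar> < d \<longrightarrow> norm (D y - D x) \<le> e * \<bar>H y - H x\<bar>"
  shows "D b = D a"
proof -
  have main: "norm (D b - D a) \<le> e * (H b - H a)" if "e > 0" for e
  proof -
    define P where "P x y \<longleftrightarrow> (a \<le> x \<longrightarrow> y \<le> b \<longrightarrow> norm (D y - D x) \<le> e * (H y - H x))" for x y
    have "P a b"
    proof (rule Bolzano)
      show "a \<le> b" by fact
    next
      fix x y z assume *: "P x y" "P y z" "x \<le> y" "y \<le> z"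
      show "P x z" unfolding P_def
      proof (intro impI)
        assume "a \<le> x" "z \<le> b"
        then have "norm (D y - D x) \<le> e * (H y - H x)" "norm (D z - D y) \<le> e * (H z - H y)"
          using * by (auto simp: P_def)
        moreover have "norm (D z - D x) \<le> norm (D z - D y) + norm (D y - D x)"
          using norm_triangle_ineq[of "D z - D y" "D y - D x"] by simp
        ultimately show "norm (D z - D x) \<le> e * (H z - H x)" by (simp add: algebra_simps)
      qed
    next
      fix x assume x: "a \<le> x" "x \<le> b"
      then obtain d where d: "d > 0"
        "\<And>y. y\<in>{a..b} \<Longrightarrow> \<bar>y - x\<bar> < d \<Longrightarrow> norm (D y - D x) \<le> e * \<bar>H y - H x\<bar>"
        using loc[of x e] \<open>e > 0\<close> by auto
      show "\<exists>d>0. \<forall>y z. y \<le> x \<and> x \<le> z \<and> z - y < d \<longrightarrow> P y z"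
      proof (intro exI[of _ d] conjI allI impI)
        fix y z assume yz: "y \<le> x \<and> x \<le> z \<and> z - y < d"
        show "P y z" unfolding P_def
        proof (intro impI)
          assume ab: "a \<le> y" "z \<le> b"
          have "norm (D y - D x) \<le> e * \<bar>H y - H x\<bar>" "norm (D z - D x) \<le> e * \<bar>H z - H x\<bar>"
            using d(2)[of y] d(2)[of z] yz ab x by auto
          moreover have "H y \<le> H x" "H x \<le> H z" using mono[of y x] mono[of x z] yz ab x by auto
          moreover have "norm (D z - D y) \<le> norm (D z - D x) + norm (D y - D x)"
            using norm_triangle_ineq4[of "D z - D x" "D y - D x"] by simp
          ultimately show "norm (D z - D y) \<le> e * (H z - H y)" by (simp add: algebra_simps)
        qed
      qed (fact d)
    qed
    then show ?thesis by (simp add: P_def)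
  qed
  have "norm (D b - D a) \<le> 0 + e" if "e > 0" for e
  proof -
    have H: "H b - H a \<ge> 0" using mono[of a b] \<open>a \<le> b\<close> by simp
    have "norm (D b - D a) \<le> (e / (H b - H a + 1)) * (H b - H a)"
      using H that by (intro main) simp
    also have "\<dots> \<le> e" using H that by (simp add: field_simps)
    finally show ?thesis by simp
  qed
  then have "norm (D b - D a) \<le> 0" by (rule field_le_epsilon)
  then show ?thesis by simp
qed

lemma absolutely_integrable_continuous_mult:
  fixes h :: "real \<Rightarrow> real" and p :: "real \<Rightarrow> 'b::euclidean_space"
  assumes h: "h absolutely_integrable_on {a..b}" and p: "continuous_on {a..b} p"
  shows "(\<lambda>t. h t *\<^sub>R p t) absolutely_integrable_on {a..b}"
proof -
  have "bounded_bilinear (\<lambda>(x::'b) (c::real). c *\<^sub>R x)"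
    by (rule bounded_bilinear.flip[OF bounded_bilinear_scaleR])
  moreover have "p \<in> borel_measurable (lebesgue_on {a..b})"
    using p continuous_imp_measurable_on_sets_lebesgue by fastforce
  moreover have "bounded (p ` {a..b})"
    using p compact_continuous_image compact_imp_bounded by blast
  ultimately show ?thesis
    using absolutely_integrable_bounded_measurable_product[of "\<lambda>x c. c *\<^sub>R x" p "{a..b}" h] h
    by (auto simp: bilinear_conv_bounded_bilinear)
qed

lemma absolutely_integrable_Re_Im:
  fixes a :: "real \<Rightarrow> complex"
  assumes "a absolutely_integrable_on S"
  shows "(\<lambda>t. Re (a t)) absolutely_integrable_on S" "(\<lambda>t. Im (a t)) absolutely_integrable_on S"
  using absolutely_integrable_linear[OF assms bounded_linear_Re]
    absolutely_integrable_linear[OF assms bounded_linear_Im] by (simp_all add: o_def)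

text \<open>
  The chain rule and the fundamental theorem for a smooth function of an absolutely continuous
  curve \<open>v\<close>, given as an indefinite integral of \<open>a\<close>. The two sides, as functions of the upper
  limit, have the same derivative with respect to \<open>\<integral>(1 + |a|)\<close> at every point, although neither need be
  differentiable with respect to \<open>t\<close>. The function \<open>F\<close> may also depend on \<open>t\<close>, which makes products
  of \<open>v\<close> with a smooth function a special case.
\<close>

lemma FTC_along_indefinite_integral:
  fixes F :: "real \<times> complex \<Rightarrow> 'b::euclidean_space" and v a :: "real \<Rightarrow> complex"
  assumes "l \<le> u"
    and a: "a absolutely_integrable_on {l..u}"
    and v: "\<And>x y. l \<le> x \<Longrightarrow> x \<le> y \<Longrightarrow> y \<le> u \<Longrightarrow> (a has_integral (v y - v x)) {x..y}"
    and der: "\<And>t. t \<in> {l..u} \<Longrightarrow>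
      (F has_derivative (\<lambda>(h, z). h *\<^sub>R r t + Re z *\<^sub>R p t + Im z *\<^sub>R q t)) (at (t, v t))"
    and cont: "continuous_on {l..u} r" "continuous_on {l..u} p" "continuous_on {l..u} q"
  shows "((\<lambda>t. r t + Re (a t) *\<^sub>R p t + Im (a t) *\<^sub>R q t) has_integral (F (u, v u) - F (l, v l))) {l..u}"
proof -
  define g where "g t = r t + Re (a t) *\<^sub>R p t + Im (a t) *\<^sub>R q t" for t
  define A where "A x t = r x + Re (a t) *\<^sub>R p x + Im (a t) *\<^sub>R q x" for x t
  define L where "L x h z = h *\<^sub>R r x + Re z *\<^sub>R p x + Im z *\<^sub>R q x" for x h z
  define D where "D t = F (t, v t) - integral {l..t} g" for t
  define H where "H t = integral {l..t} (\<lambda>t. 1 + norm (a t))" for t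
  have na: "(\<lambda>t. 1 + norm (a t)) integrable_on {l..u}"
    by (intro integrable_add integrable_const_ivl) (use a absolutely_integrable_on_def in blast)
  have ga: "g absolutely_integrable_on {l..u}"
    unfolding g_def
    by (intro set_integral_add absolutely_integrable_continuous_mult absolutely_integrable_Re_Im(1)[OF a]
        absolutely_integrable_Re_Im(2)[OF a] absolutely_integrable_continuous_real cont)
  then have gi: "g integrable_on {l..u}" using set_lebesgue_integral_eq_integral(1) by blast
  have Hdiff: "H y - H x = integral {x..y} (\<lambda>t. 1 + norm (a t))" if "l \<le> x" "x \<le> y" "y \<le> u" for x y
  proof -
    have "(\<lambda>t. 1 + norm (a t)) integrable_on {l..y}"
      by (rule integrable_on_subinterval[OF na]) (use that in auto)
    from Henstock_Kurzweil_Integration.integral_combine[OF that(1,2) this] show ?thesis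
      by (simp add: H_def)
  qed
  have Ddiff: "D y - D x = F (y, v y) - F (x, v x) - integral {x..y} g"
    if "l \<le> x" "x \<le> y" "y \<le> u" for x y
  proof -
    have "g integrable_on {l..y}"
      by (rule integrable_on_subinterval[OF gi]) (use that in auto)
    from Henstock_Kurzweil_Integration.integral_combine[OF that(1,2) this] show ?thesis
      by (simp add: D_def algebra_simps)
  qed
  have nsub: "(\<lambda>t. 1 + norm (a t)) integrable_on {x..y}" if "l \<le> x" "y \<le> u" for x y
    by (rule integrable_on_subinterval[OF na]) (use that in auto)
  have asub: "a absolutely_integrable_on {x..y}" if "l \<le> x" "y \<le> u" for x y
    by (rule absolutely_integrable_on_subinterval[OF a]) (use that in auto)
  have vbound: "norm (v y - v x) \<le> H y - H x" "y - x \<le> H y - H x" if "l \<le> x" "x \<le> y" "y \<le> u" for x y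
  proof -
    have "norm (integral {x..y} a) \<le> integral {x..y} (\<lambda>t. 1 + norm (a t))"
      using asub[of x y] nsub[of x y] that
      by (intro integral_norm_bound_integral) (auto simp: absolutely_integrable_on_def)
    then show "norm (v y - v x) \<le> H y - H x" using v[OF that] Hdiff[OF that] by (simp add: integral_unique)
    have "integral {x..y} (\<lambda>t. 1::real) \<le> integral {x..y} (\<lambda>t. 1 + norm (a t))"
      using nsub[of x y] that by (intro integral_le) auto
    then show "y - x \<le> H y - H x" using Hdiff[OF that] that by simp
  qed
  have mono: "H x \<le> H y" if "l \<le> x" "x \<le> y" "y \<le> u" for x y
    using vbound(2)[OF that] that by simp
  have Lint: "((\<lambda>t. A z t) has_integral L z (y - x) (v y - v x)) {x..y}"
    if "l \<le> x" "x \<le> y" "y \<le> u" for x y z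
  proof -
    have "((\<lambda>t. Re (a t)) has_integral Re (v y - v x)) {x..y}"
      "((\<lambda>t. Im (a t)) has_integral Im (v y - v x)) {x..y}"
      using has_integral_linear[OF v[OF that] bounded_linear_Re]
        has_integral_linear[OF v[OF that] bounded_linear_Im] by (simp_all add: o_def)
    then show ?thesis unfolding A_def L_def using that
      by (intro has_integral_add has_integral_scaleR_left)
         (use has_integral_const_real[of "r z" x y] in auto)
  qed
  have "D u = D l"
  proof (rule constant_if_derivative_zero_wrt[of l u H])
    fix x e :: real assume x: "x \<in> {l..u}" and e: "e > 0"
    define e' where "e' = e / 5"
    have e': "e' > 0" using e by (simp add: e'_def)
    have vcont: "continuous_on {l..u} v"
    proof -
      have "continuous_on {l..u} (\<lambda>y. integral {l..y} a + v l)"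
        using a by (intro continuous_intros indefinite_integral_continuous_1)
          (simp add: absolutely_integrable_on_def)
      then show ?thesis
        by (rule continuous_on_eq) (use integral_unique[OF v[of l]] in auto)
    qed
    obtain d1 where d1: "d1 > 0" "\<And>z. norm (z - (x, v x)) < d1 \<Longrightarrow>
      norm (F z - F (x, v x) - L x (fst (z - (x, v x))) (snd (z - (x, v x)))) \<le> e' * norm (z - (x, v x))"
      using der[OF x] e' unfolding has_derivative_at_alt L_def by (auto simp: case_prod_beta)
    have "continuous_on {l..u} (\<lambda>y. (y, v y))" using vcont by (intro continuous_intros)
    then obtain d2 where d2: "d2 > 0"
      "\<And>y. y \<in> {l..u} \<Longrightarrow> \<bar>y - x\<bar> < d2 \<Longrightarrow> norm ((y, v y) - (x, v x)) < d1"
      using x d1(1) unfolding continuous_on_iff dist_norm by (metis real_norm_def)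
    obtain d3 where d3: "d3 > 0" "\<And>y. y \<in> {l..u} \<Longrightarrow> \<bar>y - x\<bar> < d3 \<Longrightarrow> norm (r y - r x) < e'"
      using x e' cont(1) unfolding continuous_on_iff dist_norm by (metis real_norm_def)
    obtain d4 where d4: "d4 > 0" "\<And>y. y \<in> {l..u} \<Longrightarrow> \<bar>y - x\<bar> < d4 \<Longrightarrow> norm (p y - p x) < e'"
      using x e' cont(2) unfolding continuous_on_iff dist_norm by (metis real_norm_def)
    obtain d5 where d5: "d5 > 0" "\<And>y. y \<in> {l..u} \<Longrightarrow> \<bar>y - x\<bar> < d5 \<Longrightarrow> norm (q y - q x) < e'"
      using x e' cont(3) unfolding continuous_on_iff dist_norm by (metis real_norm_def)
    define d where "d = Min {d2, d3, d4, d5}"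
    have d: "d > 0" "d \<le> d2" "d \<le> d3" "d \<le> d4" "d \<le> d5"
      using d2(1) d3(1) d4(1) d5(1) by (auto simp: d_def)
    have Abd: "norm (A x t - g t) \<le> 2 * e' * (1 + norm (a t))" if "t \<in> {l..u}" "\<bar>t - x\<bar> < d" for t
    proof -
      have "norm (r x - r t) \<le> e'" "norm (p x - p t) \<le> e'" "norm (q x - q t) \<le> e'"
        using d3(2)[OF that(1)] d4(2)[OF that(1)] d5(2)[OF that(1)] that(2) d
        by (auto simp: norm_minus_commute)
      then have 1: "norm (r x - r t) + norm (Re (a t) *\<^sub>R (p x - p t)) + norm (Im (a t) *\<^sub>R (q x - q t))
          \<le> e' + norm (a t) * e' + norm (a t) * e'"
        unfolding norm_scaleR real_norm_def
        by (intro add_mono mult_mono) (auto simp: abs_Re_le_cmod abs_Im_le_cmod)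
      have 2: "A x t - g t = (r x - r t) + Re (a t) *\<^sub>R (p x - p t) + Im (a t) *\<^sub>R (q x - q t)"
        by (simp add: A_def g_def algebra_simps)
      have 3: "norm ((r x - r t) + Re (a t) *\<^sub>R (p x - p t) + Im (a t) *\<^sub>R (q x - q t))
        \<le> norm (r x - r t) + norm (Re (a t) *\<^sub>R (p x - p t)) + norm (Im (a t) *\<^sub>R (q x - q t))"
        by (intro norm_triangle_le add_mono order_refl)
      have "e' + norm (a t) * e' + norm (a t) * e' \<le> 2 * e' * (1 + norm (a t))"
        using e' by (simp add: algebra_simps)
      then show ?thesis unfolding 2 using order_trans[OF 3 1] by (rule order_trans[rotated])
    qed
    \<comment> \<open>The base point of the expansion is the fixed point \<open>x\<close>, which may be either endpoint.\<close>
    have key: "norm (D hi - D lo) \<le> e * (H hi - H lo)"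
      if lh: "l \<le> lo" "lo \<le> hi" "hi \<le> u" and near: "\<And>t. t \<in> {lo..hi} \<Longrightarrow> \<bar>t - x\<bar> < d"
        and x': "x = lo \<or> x = hi" for lo hi
    proof -
      define y where "y = (if x = lo then hi else lo)"
      have y: "y \<in> {l..u}" "\<bar>y - x\<bar> < d" using lh near by (auto simp: y_def)
      let ?w = "(y, v y) - (x, v x)"
      have 1: "norm (F (y, v y) - F (x, v x) - L x (y - x) (v y - v x)) \<le> e' * norm ?w"
        using d1(2)[of "(y, v y)"] d2(2)[OF y(1)] y(2) d by simp
      have "norm ?w \<le> norm (y - x) + norm (v y - v x)"
        using norm_Pair_le[of "y - x" "v y - v x"] by simp
      also have "\<dots> \<le> 2 * (H hi - H lo)"
        using vbound[OF lh] x' lh by (auto simp: y_def norm_minus_commute)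
      finally have 2: "norm ?w \<le> 2 * (H hi - H lo)" .
      have 12: "norm (F (y, v y) - F (x, v x) - L x (y - x) (v y - v x)) \<le> e' * (2 * (H hi - H lo))"
        using order_trans[OF 1 mult_left_mono[OF 2]] e' by simp
      have 3: "norm (F (hi, v hi) - F (lo, v lo) - L x (hi - lo) (v hi - v lo)) \<le> e' * (2 * (H hi - H lo))"
      proof (cases "x = lo")
        case True
        then show ?thesis using 12 by (simp add: y_def)
      next
        case False
        then have "F (hi, v hi) - F (lo, v lo) - L x (hi - lo) (v hi - v lo)
           = - (F (y, v y) - F (x, v x) - L x (y - x) (v y - v x))"
          using x' by (simp add: y_def L_def algebra_simps)
        then show ?thesis using 12 by (metis norm_minus_cancel)
      qed
      have "((\<lambda>t. A x t - g t) has_integral (L x (hi - lo) (v hi - v lo) - integral {lo..hi} g)) {lo..hi}"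
        by (intro has_integral_diff Lint[OF lh] integrable_integral integrable_on_subinterval[OF gi])
           (use lh in auto)
      moreover have "norm (integral {lo..hi} (\<lambda>t. A x t - g t)) \<le> integral {lo..hi} (\<lambda>t. 2 * e' * (1 + norm (a t)))"
        using calculation nsub[of lo hi] lh near
        by (intro integral_norm_bound_integral Abd integrable_on_mult_right) auto
      ultimately have 4: "norm (L x (hi - lo) (v hi - v lo) - integral {lo..hi} g) \<le> 2 * e' * (H hi - H lo)"
        using Hdiff[OF lh] by (simp add: integral_unique)
      have "D hi - D lo = (F (hi, v hi) - F (lo, v lo) - L x (hi - lo) (v hi - v lo))
          + (L x (hi - lo) (v hi - v lo) - integral {lo..hi} g)"
        using Ddiff[OF lh] by simp
      then have "norm (D hi - D lo) \<le> e' * (2 * (H hi - H lo)) + 2 * e' * (H hi - H lo)"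
        using 3 4 norm_triangle_mono by metis
      also have "\<dots> \<le> e * (H hi - H lo)"
        using mono[OF lh] e by (simp add: e'_def field_simps)
      finally show ?thesis .
    qed
    show "\<exists>d>0. \<forall>y\<in>{l..u}. \<bar>y - x\<bar> < d \<longrightarrow> norm (D y - D x) \<le> e * \<bar>H y - H x\<bar>"
    proof (intro exI[of _ d] conjI ballI impI)
      fix y assume y: "y \<in> {l..u}" "\<bar>y - x\<bar> < d"
      show "norm (D y - D x) \<le> e * \<bar>H y - H x\<bar>"
      proof (cases "x \<le> y")
        case True
        then show ?thesis using key[of x y] mono[of x y] x y by auto
      next
        case False
        then show ?thesis using key[of y x] mono[of y x] x y by (auto simp: norm_minus_commute)
      qed
    qed (fact d)
  qed (use \<open>l \<le> u\<close> mono in auto)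
  then have "integral {l..u} g = F (u, v u) - F (l, v l)" by (simp add: D_def algebra_simps)
  then show ?thesis using gi unfolding g_def[symmetric] by (metis integrable_integral)
qed

text \<open>
  Differentiation under the integral sign for an integrand with a merely integrable weight. It is
  applied with the weights \<open>\<rho>\<close>, \<open>\<rho>k\<close> and \<open>\<rho>k\<^sup>2\<close>, which need not be bounded; the other factor is smooth
  in the parameter, uniformly in \<open>t\<close>, by compactness.
\<close>

lemma has_real_derivative_weighted_integral:
  fixes h :: "real \<Rightarrow> real" and A A' :: "real \<Rightarrow> real \<Rightarrow> real"
  assumes h: "h absolutely_integrable_on {0..1}" and "e0 > 0"
    and der: "\<And>e t. \<bar>e\<bar> \<le> e0 \<Longrightarrow> t \<in> {0..1} \<Longrightarrow> ((\<lambda>e. A e t) has_real_derivative A' e t) (at e)"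
    and contA: "\<And>e. \<bar>e\<bar> \<le> e0 \<Longrightarrow> continuous_on {0..1} (A e)"
    and cont: "continuous_on ({-e0..e0} \<times> {0..1}) (\<lambda>(e, t). A' e t)"
  shows "((\<lambda>e. integral {0..1} (\<lambda>t. h t * A e t)) has_real_derivative
           integral {0..1} (\<lambda>t. h t * A' 0 t)) (at 0)"
proof -
  let ?I = "\<lambda>e. integral {0..1} (\<lambda>t. h t * A e t)"
  let ?D = "integral {0..1} (\<lambda>t. h t * A' 0 t)"
  have prod: "(\<lambda>t. h t * p t) integrable_on {0..1}" if "continuous_on {0..1} p" for p :: "real \<Rightarrow> real"
    using absolutely_integrable_continuous_mult[OF h that]
    by (simp add: absolutely_integrable_on_def)
  have contA0: "continuous_on {0..1} (A' 0)"
  proof -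
    have "continuous_on {0..1} (\<lambda>t::real. (0::real, t))" by (intro continuous_intros)
    then have "continuous_on {0..1} (\<lambda>t. case (0, t) of (e, t) \<Rightarrow> A' e t)"
      by (rule continuous_on_compose2[OF cont]) (use \<open>e0 > 0\<close> in auto)
    then show ?thesis by simp
  qed
  define N where "N = integral {0..1} (\<lambda>t. \<bar>h t\<bar>) + 1"
  have hn: "(\<lambda>t. \<bar>h t\<bar>) integrable_on {0..1}"
    using h by (simp add: absolutely_integrable_on_def)
  then have N: "N > 0" unfolding N_def using integral_nonneg[OF hn] by simp
  show ?thesis unfolding has_field_derivative_def has_derivative_at_alt
  proof (intro conjI allI impI)
    fix \<eta> :: real assume "\<eta> > 0"
    define \<eta>' where "\<eta>' = \<eta> / N"
    have \<eta>': "\<eta>' > 0" using \<open>\<eta> > 0\<close> N by (simp add: \<eta>'_def)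
    have "uniformly_continuous_on ({-e0..e0} \<times> {0..1}) (\<lambda>(e, t). A' e t)"
      by (rule compact_uniformly_continuous[OF cont]) (intro compact_Times compact_Icc)
    then obtain d where d: "d > 0" "\<And>z z'. z \<in> {-e0..e0} \<times> {0..1} \<Longrightarrow> z' \<in> {-e0..e0} \<times> {0..1} \<Longrightarrow>
      dist z' z < d \<Longrightarrow> dist (case z' of (e, t) \<Rightarrow> A' e t) (case z of (e, t) \<Rightarrow> A' e t) < \<eta>'"
      unfolding uniformly_continuous_on_def using \<eta>' by metis
    have close: "\<bar>A' e t - A' 0 t\<bar> \<le> \<eta>'" if "\<bar>e\<bar> < d" "\<bar>e\<bar> \<le> e0" "t \<in> {0..1}" for e t
    proof -
      have "dist (e, t) (0, t) < d" using that by (simp add: dist_Pair_Pair)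
      then show ?thesis using d(2)[of "(0, t)" "(e, t)"] that \<open>e0 > 0\<close>
        by (auto simp: dist_real_def abs_le_iff intro: less_imp_le)
    qed
    show "\<exists>d>0. \<forall>y. norm (y - 0) < d \<longrightarrow> norm (?I y - ?I 0 - ?D * (y - 0)) \<le> \<eta> * norm (y - 0)"
    proof (intro exI[of _ "min d e0"] conjI allI impI)
      fix e :: real assume "norm (e - 0) < min d e0"
      then have e: "\<bar>e\<bar> < d" "\<bar>e\<bar> < e0" by auto
      have rem: "\<bar>A e t - A 0 t - A' 0 t * e\<bar> \<le> \<eta>' * \<bar>e\<bar>" if t: "t \<in> {0..1}" for t
      proof -
        have "norm ((A e t - A' 0 t * e) - (A 0 t - A' 0 t * 0)) \<le> \<eta>' * norm (e - 0)"
        proof (rule field_differentiable_bound[where S = "{-\<bar>e\<bar>..\<bar>e\<bar>}" and f' = "\<lambda>x. A' x t - A' 0 t"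
               and f = "\<lambda>x. A x t - A' 0 t * x"])
          fix z assume z: "z \<in> {-\<bar>e\<bar>..\<bar>e\<bar>}"
          show "((\<lambda>x. A x t - A' 0 t * x) has_field_derivative A' z t - A' 0 t) (at z within {-\<bar>e\<bar>..\<bar>e\<bar>})"
            by (rule has_field_derivative_at_within)
               (use z e t in \<open>auto intro!: derivative_eq_intros der\<close>)
          show "norm (A' z t - A' 0 t) \<le> \<eta>'" using close[of z t] z e t by auto
        qed auto
        then show ?thesis by (simp add: algebra_simps)
      qed
      have i: "(\<lambda>t. h t * A e t) integrable_on {0..1}" "(\<lambda>t. h t * A 0 t) integrable_on {0..1}"
        "(\<lambda>t. h t * A' 0 t) integrable_on {0..1}"
        using e \<open>e0 > 0\<close> by (auto intro!: prod contA contA0)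
      have "?I e - ?I 0 - ?D * e = integral {0..1} (\<lambda>t. h t * A e t - h t * A 0 t - h t * A' 0 t * e)"
        using i by (simp add: integral_diff integrable_diff integrable_on_mult_left)
      also have "norm \<dots> \<le> integral {0..1} (\<lambda>t. \<bar>h t\<bar> * (\<eta>' * \<bar>e\<bar>))"
      proof (rule integral_norm_bound_integral)
        fix t :: real assume t: "t \<in> {0..1}"
        have "h t * A e t - h t * A 0 t - h t * A' 0 t * e = h t * (A e t - A 0 t - A' 0 t * e)"
          by (simp add: algebra_simps)
        then show "norm (h t * A e t - h t * A 0 t - h t * A' 0 t * e) \<le> \<bar>h t\<bar> * (\<eta>' * \<bar>e\<bar>)"
          using rem[OF t] by (simp add: abs_mult mult_left_mono)
      qed (use i hn in \<open>auto intro!: integrable_diff integrable_on_mult_left\<close>)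
      also have "\<dots> = (N - 1) * (\<eta>' * \<bar>e\<bar>)" by (simp add: N_def)
      also have "\<dots> \<le> \<eta> * \<bar>e\<bar>" using N \<open>\<eta> > 0\<close> by (simp add: \<eta>'_def field_simps mult_right_mono)
      finally show "norm (?I e - ?I 0 - ?D * (e - 0)) \<le> \<eta> * norm (e - 0)" by simp
    qed (use d \<open>e0 > 0\<close> in auto)
  qed (rule bounded_linear_mult_right)
qed

text \<open>
  With \<open>d = 0\<close> this extends a function periodically. With \<open>d = m\<close> it extends a change of parameter
  to one of degree \<open>m\<close>.
\<close>

lemma continuous_on_extension_by_translation:
  fixes f :: "real \<Rightarrow> 'a::real_normed_vector"
  assumes f: "continuous_on {0..1} f" and f1: "f 1 = f 0 + d"
  shows "continuous_on UNIV (\<lambda>t. f (frac t) + of_int \<lfloor>t\<rfloor> *\<^sub>R d)"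
proof -
  let ?F = "\<lambda>t. f (frac t) + of_int \<lfloor>t\<rfloor> *\<^sub>R d"
  have piece: "continuous_on {of_int n..of_int n + 1} ?F" for n :: int
  proof (rule continuous_on_eq)
    show "continuous_on {of_int n..of_int n + 1} (\<lambda>t. f (t - of_int n) + of_int n *\<^sub>R d)"
      by (intro continuous_intros continuous_on_compose2[OF f]) auto
    fix t :: real assume t: "t \<in> {of_int n..of_int n + 1}"
    show "f (t - of_int n) + of_int n *\<^sub>R d = ?F t"
    proof (cases "t = of_int n + 1")
      case True
      then have "\<lfloor>t\<rfloor> = n + 1" "frac t = 0" by (auto simp: frac_def)
      then show ?thesis using True f1 by (simp add: algebra_simps)
    next
      case False
      then have "\<lfloor>t\<rfloor> = n" using t by (auto simp: floor_eq_iff)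
      then show ?thesis by (simp add: frac_def)
    qed
  qed
  have "isCont ?F x" for x
  proof -
    define n where "n = \<lfloor>x\<rfloor>"
    have x: "of_int n \<le> x" "x < of_int n + 1" unfolding n_def by linarith+
    have "continuous_on ({of_int (n - 1)..of_int (n - 1) + 1} \<union> {of_int n..of_int n + 1}) ?F"
      by (intro continuous_on_closed_Un piece closed_atLeastAtMost)
    moreover have "{of_int (n - 1)..of_int (n - 1) + 1} \<union> {of_int n..of_int n + 1} = {of_int n - 1..of_int n + 1 :: real}"
      by auto
    ultimately have "continuous_on {of_int n - 1..of_int n + 1} ?F" by simp
    then show ?thesis
      by (rule continuous_on_interior) (use x in auto)
  qed
  then show ?thesis by (simp add: continuous_on_eq_continuous_at)
qed

lemma antiderivative_exists:
  fixes f :: "real \<Rightarrow> 'a::euclidean_space"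
  assumes "continuous_on UNIV f"
  obtains F where "\<And>t. (F has_vector_derivative f t) (at t)"
  using einterval_antiderivative[of "-\<infinity>" "\<infinity>" f] assms
  by (auto simp: continuous_on_eq_continuous_at)

lemma periodic_antiderivative_exists:
  fixes f :: "real \<Rightarrow> 'a::euclidean_space"
  assumes cont: "continuous_on UNIV f" and per: "\<And>t. f (t + 1) = f t" and int0: "integral {0..1} f = 0"
  obtains F where "\<And>t. (F has_vector_derivative f t) (at t)" "\<And>t. F (t + 1) = F t"
proof -
  obtain F where F: "\<And>t. (F has_vector_derivative f t) (at t)"
    using antiderivative_exists[OF cont] by blast
  have d: "((\<lambda>t. F (t + 1) - F t) has_vector_derivative 0) (at t)" for t
  proof -
    have "((\<lambda>t. t + 1) has_vector_derivative 1) (at t)"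
      by (auto intro!: derivative_eq_intros)
    from vector_diff_chain_at[OF this] F[of "t + 1"]
    have "((\<lambda>t. F (t + 1)) has_vector_derivative f t) (at t)" by (simp add: o_def per)
    from has_vector_derivative_diff[OF this F[of t]] show ?thesis by simp
  qed
  have "(f has_integral (F 1 - F 0)) {0..1}"
    by (rule fundamental_theorem_of_calculus) (auto intro: has_vector_derivative_at_within[OF F])
  then have 1: "F 1 = F 0" using int0 by (simp add: integral_unique)
  obtain c where c: "\<And>t. F (t + 1) - F t = c"
    using has_vector_derivative_zero_constant[of UNIV "\<lambda>t. F (t + 1) - F t"] d by auto
  have "F (t + 1) = F t" for t using c[of t] c[of 0] 1 by simp
  with F that show ?thesis by blast
qed

lemma absolutely_integrable_times_continuous:
  fixes h p :: "real \<Rightarrow> real"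
  assumes "h absolutely_integrable_on {x..y}" "continuous_on {x..y} p"
  shows "(\<lambda>t. h t * p t) absolutely_integrable_on {x..y}"
  using absolutely_integrable_continuous_mult[OF assms] by simp

lemma absolutely_integrable_if_square_le:
  fixes f :: "real \<Rightarrow> 'a::euclidean_space"
  assumes "f \<in> borel_measurable (lebesgue_on {x..y})" "g integrable_on {x..y}"
    "\<And>t. t \<in> {x..y} \<Longrightarrow> norm (f t) \<le> g t"
  shows "f absolutely_integrable_on {x..y}"
  using measurable_bounded_by_integrable_imp_absolutely_integrable[OF assms(1) _ assms(2,3)] by auto

lemma derivative_of_indefinite_integral:
  fixes F f :: "real \<Rightarrow> 'a::euclidean_space"
  assumes F: "\<And>t. t \<in> {0..1} \<Longrightarrow> F t = z + integral {0..t} f" and f: "continuous_on {0..1} f"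
    and t: "t \<in> {0..1}"
  shows "(F has_vector_derivative f t) (at t within {0..1})"
proof -
  have "((\<lambda>t. z + integral {0..t} f) has_vector_derivative (0 + f t)) (at t within {0..1})"
    by (intro has_vector_derivative_add has_vector_derivative_const integral_has_vector_derivative f t)
  then show ?thesis
    by (rule has_vector_derivative_transform[rotated -1, OF _ t F, THEN has_vector_derivative_eq_rhs]) auto
qed

lemma constant_on_unit_interval:
  fixes f :: "real \<Rightarrow> 'a::real_normed_vector"
  assumes "\<And>t. t \<in> {0..1} \<Longrightarrow> (f has_vector_derivative 0) (at t within {0..1})" "t \<in> {0..1}"
  shows "f t = f 0"
  using has_vector_derivative_zero_constant[of "{0..1}" f] assms by (metis atLeastAtMost_iff
      convex_closed_interval order_refl zero_le_one cbox_interval convex_box(1))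

lemma strict_mono_on_if_derivative_pos:
  fixes f :: "real \<Rightarrow> real"
  assumes "\<And>t. t \<in> {0..1} \<Longrightarrow> (f has_real_derivative f' t) (at t within {0..1})"
    "\<And>t. t \<in> {0..1} \<Longrightarrow> f' t > 0"
  shows "strict_mono_on {0..1} f"
proof (rule strict_mono_onI)
  fix x y :: real assume xy: "x \<in> {0..1}" "y \<in> {0..1}" "x < y"
  show "f x < f y"
  proof (rule DERIV_pos_imp_increasing_open[OF xy(3)])
    fix t assume t: "x < t" "t < y"
    then have "(f has_real_derivative f' t) (at t)"
      using assms(1)[of t] xy by (simp add: at_within_Icc_at)
    then show "\<exists>d. (f has_real_derivative d) (at t) \<and> d > 0" using assms(2)[of t] t xy by auto
  next
    show "continuous_on {x..y} f"
      by (rule continuous_on_subset[OF DERIV_continuous_on[OF assms(1)]]) (use xy in auto)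
  qed
qed

text \<open>
  No boundary term appears at \<open>x\<close> because \<open>G\<close> vanishes there.
\<close>

lemma integration_by_parts_indefinite:
  fixes g G W W' :: "real \<Rightarrow> complex"
  assumes "x \<le> y" and g: "g absolutely_integrable_on {x..y}"
    and G: "\<And>t. t \<in> {x..y} \<Longrightarrow> G t = integral {x..t} g"
    and W: "\<And>t. (W has_vector_derivative W' t) (at t)" and W': "continuous_on UNIV W'"
  shows "((\<lambda>t. G t \<bullet> W' t + g t \<bullet> W t) has_integral (G y \<bullet> W y)) {x..y}"
proof -
  have Wc: "continuous_on S W" for S
    using W by (meson continuous_at_imp_continuous_on has_vector_derivative_continuous)
  have gi: "g integrable_on {x..y}" using g by (simp add: absolutely_integrable_on_def)
  have Gint: "(g has_integral (G t - G s)) {s..t}" if "x \<le> s" "s \<le> t" "t \<le> y" for s t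
  proof -
    have i: "g integrable_on {x..t}" "g integrable_on {s..t}"
      using that by (auto intro: integrable_on_subinterval[OF gi])
    from Henstock_Kurzweil_Integration.integral_combine[OF that(1,2) i(1)]
    have "G t - G s = integral {s..t} g" using that by (simp add: G algebra_simps)
    then show ?thesis using i(2) by (simp add: has_integral_integral)
  qed
  have Gc: "continuous_on {x..y} G"
    by (rule continuous_on_eq[OF indefinite_integral_continuous_1[OF gi]]) (simp add: G)
  have "((\<lambda>t. G t \<bullet> W' t + Re (g t) *\<^sub>R Re (W t) + Im (g t) *\<^sub>R Im (W t)) has_integral
     ((\<lambda>w. snd w \<bullet> W (fst w)) (y, G y) - (\<lambda>w. snd w \<bullet> W (fst w)) (x, G x))) {x..y}"
  proof (rule FTC_along_indefinite_integral[where F = "\<lambda>w. snd w \<bullet> W (fst w)" and a = g and v = G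
        and r = "\<lambda>t. G t \<bullet> W' t" and p = "\<lambda>t. Re (W t)" and q = "\<lambda>t. Im (W t)", OF \<open>x \<le> y\<close> g Gint])
    fix t
    have 1: "((\<lambda>w. W (fst w)) has_derivative (\<lambda>h. fst h *\<^sub>R W' t)) (at (t, G t))"
      using has_derivative_compose[OF bounded_linear_imp_has_derivative[OF bounded_linear_fst], of W _ "(t, G t)"]
        W[of t] by (simp add: has_vector_derivative_def)
    have "((\<lambda>w. snd w \<bullet> W (fst w)) has_derivative (\<lambda>h. G t \<bullet> (fst h *\<^sub>R W' t) + snd h \<bullet> W t)) (at (t, G t))"
      using has_derivative_inner[OF bounded_linear_imp_has_derivative[OF bounded_linear_snd] 1] by simp
    then show "((\<lambda>w. snd w \<bullet> W (fst w)) has_derivative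
      (\<lambda>(h, z). h *\<^sub>R (G t \<bullet> W' t) + Re z *\<^sub>R Re (W t) + Im z *\<^sub>R Im (W t))) (at (t, G t))"
      by (rule has_derivative_eq_rhs) (auto simp: fun_eq_iff inner_complex_def algebra_simps)
  qed (auto intro!: continuous_intros Gc Wc continuous_on_subset[OF W'])
  moreover have "(\<lambda>t. G t \<bullet> W' t + Re (g t) *\<^sub>R Re (W t) + Im (g t) *\<^sub>R Im (W t)) = (\<lambda>t. G t \<bullet> W' t + g t \<bullet> W t)"
    by (simp add: inner_complex_def add.assoc)
  ultimately show ?thesis using G[of x] \<open>x \<le> y\<close> by simp
qed

lemma continuous_on_snd_comp:
  "continuous_on B f \<Longrightarrow> continuous_on (A \<times> B) (\<lambda>z. f (snd z))"
  by (rule continuous_on_compose2[of B f]) (auto intro: continuous_intros)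

lemma continuous_on_slice:
  fixes f :: "real \<times> real \<Rightarrow> real"
  assumes "continuous_on ({-e0..e0} \<times> {0..1}) f" "\<bar>e\<bar> \<le> e0"
  shows "continuous_on {0..1} (\<lambda>t. f (e, t))"
proof -
  have "continuous_on {0..1} (\<lambda>t::real. (e, t))" by (intro continuous_intros)
  then show ?thesis by (rule continuous_on_compose2[OF assms(1)]) (use assms(2) in auto)
qed

text \<open>
  The form of the elastic energy of a perturbed curve: \<open>n\<close> is the squared speed relative to the
  unperturbed one, hence 1 at \<open>e = 0\<close>, and squared curvature times speed has the fifth power of the
  speed in its denominator.
\<close>

lemma has_derivative_integral_over_fifth_power:
  fixes h :: "real \<Rightarrow> real" and P P' n n' :: "real \<times> real \<Rightarrow> real"
  assumes h: "h absolutely_integrable_on {0..1}" and "e0 > 0"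
    and P: "\<And>e t. ((\<lambda>e. P (e, t)) has_real_derivative P' (e, t)) (at e)"
    and n: "\<And>e t. ((\<lambda>e. n (e, t)) has_real_derivative n' (e, t)) (at e)"
    and pos: "\<And>e t. \<bar>e\<bar> \<le> e0 \<Longrightarrow> t \<in> {0..1} \<Longrightarrow> n (e, t) > 0"
    and n0: "\<And>t. t \<in> {0..1} \<Longrightarrow> n (0, t) = 1"
    and cont: "continuous_on ({-e0..e0} \<times> {0..1}) P" "continuous_on ({-e0..e0} \<times> {0..1}) P'"
      "continuous_on ({-e0..e0} \<times> {0..1}) n" "continuous_on ({-e0..e0} \<times> {0..1}) n'"
  shows "((\<lambda>e. integral {0..1} (\<lambda>t. h t * (P (e, t) / sqrt (n (e, t)) ^ 5))) has_real_derivative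
           integral {0..1} (\<lambda>t. h t * (P' (0, t) - 5 / 2 * P (0, t) * n' (0, t)))) (at 0)"
proof -
  define A' where "A' e t = P' (e, t) / sqrt (n (e, t)) ^ 5 - 5 / 2 * P (e, t) * n' (e, t) / sqrt (n (e, t)) ^ 7" for e t
  have "((\<lambda>e. integral {0..1} (\<lambda>t. h t * (P (e, t) / sqrt (n (e, t)) ^ 5))) has_real_derivative
           integral {0..1} (\<lambda>t. h t * A' 0 t)) (at 0)"
  proof (rule has_real_derivative_weighted_integral[OF h \<open>e0 > 0\<close>])
    fix e t :: real assume e: "\<bar>e\<bar> \<le> e0" and t: "t \<in> {0..1}"
    note ps = pos[OF e t]
    define s where "s = sqrt (n (e, t))"
    have s: "s > 0" using ps by (simp add: s_def)
    have "((\<lambda>e. P (e, t) / sqrt (n (e, t)) ^ 5) has_real_derivative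
      (P' (e, t) * s ^ 5 - P (e, t) * (5 * s ^ 4 * (n' (e, t) * inverse s / 2))) / (s ^ 5 * s ^ 5)) (at e)"
      unfolding s_def
      using ps by (auto intro!: derivative_eq_intros P n DERIV_real_sqrt simp: field_simps)
    also have "(P' (e, t) * s ^ 5 - P (e, t) * (5 * s ^ 4 * (n' (e, t) * inverse s / 2))) / (s ^ 5 * s ^ 5) = A' e t"
      unfolding A'_def s_def[symmetric] using s by (simp add: field_simps power_eq_if)
    finally show "((\<lambda>e. P (e, t) / sqrt (n (e, t)) ^ 5) has_real_derivative A' e t) (at e)" .
  next
    fix e :: real assume e: "\<bar>e\<bar> \<le> e0"
    show "continuous_on {0..1} (\<lambda>t. P (e, t) / sqrt (n (e, t)) ^ 5)"
      by (intro continuous_intros continuous_on_slice[OF _ e] cont) (use pos[OF e] in force)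
  next
    show "continuous_on ({-e0..e0} \<times> {0..1}) (\<lambda>(e, t). A' e t)"
      unfolding A'_def case_prod_unfold prod.collapse
      by (intro continuous_intros cont) (use pos in \<open>force simp: abs_le_iff\<close>)+
  qed
  also have "integral {0..1} (\<lambda>t. h t * A' 0 t)
    = integral {0..1} (\<lambda>t. h t * (P' (0, t) - 5 / 2 * P (0, t) * n' (0, t)))"
    by (intro integral_cong) (simp add: A'_def n0)
  finally show ?thesis .
qed

lemma has_derivative_integral_sqrt:
  fixes h :: "real \<Rightarrow> real" and n n' :: "real \<times> real \<Rightarrow> real"
  assumes h: "h absolutely_integrable_on {0..1}" and "e0 > 0"
    and n: "\<And>e t. ((\<lambda>e. n (e, t)) has_real_derivative n' (e, t)) (at e)"
    and pos: "\<And>e t. \<bar>e\<bar> \<le> e0 \<Longrightarrow> t \<in> {0..1} \<Longrightarrow> n (e, t) > 0"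
    and n0: "\<And>t. t \<in> {0..1} \<Longrightarrow> n (0, t) = 1"
    and cont: "continuous_on ({-e0..e0} \<times> {0..1}) n" "continuous_on ({-e0..e0} \<times> {0..1}) n'"
  shows "((\<lambda>e. integral {0..1} (\<lambda>t. h t * sqrt (n (e, t)))) has_real_derivative
           integral {0..1} (\<lambda>t. h t * (n' (0, t) / 2))) (at 0)"
proof -
  define A' where "A' e t = n' (e, t) / (2 * sqrt (n (e, t)))" for e t
  have "((\<lambda>e. integral {0..1} (\<lambda>t. h t * sqrt (n (e, t)))) has_real_derivative
           integral {0..1} (\<lambda>t. h t * A' 0 t)) (at 0)"
  proof (rule has_real_derivative_weighted_integral[OF h \<open>e0 > 0\<close>])
    fix e t :: real assume e: "\<bar>e\<bar> \<le> e0" and t: "t \<in> {0..1}"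
    show "((\<lambda>e. sqrt (n (e, t))) has_real_derivative A' e t) (at e)"
      unfolding A'_def using pos[OF e t]
      by (auto intro!: derivative_eq_intros n DERIV_real_sqrt simp: field_simps)
  next
    fix e :: real assume e: "\<bar>e\<bar> \<le> e0"
    show "continuous_on {0..1} (\<lambda>t. sqrt (n (e, t)))"
      by (intro continuous_intros continuous_on_slice[OF _ e] cont)
  next
    show "continuous_on ({-e0..e0} \<times> {0..1}) (\<lambda>(e, t). A' e t)"
      unfolding A'_def case_prod_unfold prod.collapse
      by (intro continuous_intros cont) (use pos in \<open>force simp: abs_le_iff\<close>)+
  qed
  also have "integral {0..1} (\<lambda>t. h t * A' 0 t) = integral {0..1} (\<lambda>t. h t * (n' (0, t) / 2))"
    by (intro integral_cong) (simp add: A'_def n0)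
  finally show ?thesis .
qed

section \<open>Closed curves of class H2\<close>

text \<open>
  The second derivative only has to be known almost everywhere, whereas \<^const>\<open>acceleration\<close> has some
  unspecified value at the remaining points.
\<close>

lemma closed_H2I:
  assumes w: "\<And>t. (\<phi> has_vector_derivative w t) (at t)"
    and N: "negligible N" "\<And>t. t \<notin> N \<Longrightarrow> (w has_vector_derivative a t) (at t)"
    and a: "\<And>x y. x \<le> y \<Longrightarrow> a absolutely_integrable_on {x..y}"
      "\<And>x y. x \<le> y \<Longrightarrow> (a has_integral (w y - w x)) {x..y}"
      "\<And>x y. x \<le> y \<Longrightarrow> (\<lambda>t. (norm (a t))\<^sup>2) integrable_on {x..y}"
    and per: "\<And>t. \<phi> (t + 1) = \<phi> t"
  shows "closed_H2 \<phi>"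
proof -
  have vel: "velocity \<phi> = w" using w vector_derivative_at by blast
  have acc: "acceleration \<phi> t = a t" if "t \<notin> N" for t
    unfolding vel using N(2)[OF that] by (rule vector_derivative_at)
  have "{t. \<not> w differentiable (at t)} \<subseteq> N"
    using N(2) by (auto intro: differentiableI_vector)
  then have 1: "negligible {t. \<not> velocity \<phi> differentiable (at t)}"
    unfolding vel using N(1) negligible_subset by blast
  have 2: "acceleration \<phi> absolutely_integrable_on {x..y}" if "x \<le> y" for x y
    by (rule absolutely_integrable_spike[OF a(1)[OF that] N(1)]) (simp add: acc)
  have 3: "(acceleration \<phi> has_integral (w y - w x)) {x..y}" if "x \<le> y" for x y
    by (rule has_integral_spike[OF N(1) _ a(2)[OF that]]) (simp add: acc)
  have 4: "(\<lambda>t. (norm (acceleration \<phi> t))\<^sup>2) integrable_on {x..y}" if "x \<le> y" for x y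
    by (rule integrable_spike[OF a(3)[OF that] N(1)]) (simp add: acc)
  have "class_H2 \<phi>" unfolding class_H2_def
  proof (intro conjI allI impI 1)
    show "\<phi> differentiable (at t)" for t using w by (rule differentiableI_vector)
    fix x y :: real assume "x \<le> y"
    then show "acceleration \<phi> absolutely_integrable_on {x..y}"
      "(\<lambda>t. (norm (acceleration \<phi> t))\<^sup>2) integrable_on {x..y}" by (rule 2 4)+
    show "(acceleration \<phi> has_integral (velocity \<phi> y - velocity \<phi> x)) {x..y}"
      using 3[OF \<open>x \<le> y\<close>] by (simp only: vector_derivative_at[OF w])
  qed
  then show ?thesis using per by (simp add: closed_H2_def)
qed

lemma closed_regular_curve_if_C2:
  assumes w: "\<And>t. (\<beta> has_vector_derivative w t) (at t)" "\<And>t. w t \<noteq> 0"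
    and a: "\<And>t. (w has_vector_derivative a t) (at t)" "continuous_on UNIV a"
    and per: "\<And>t. \<beta> (t + 1) = \<beta> t"
  shows "closed_regular_curve \<beta>"
proof -
  have ac: "continuous_on S a" for S using a(2) continuous_on_subset by blast
  have "closed_H2 \<beta>"
  proof (rule closed_H2I[OF w(1) _ a(1) _ _ _ per])
    fix x y :: real assume "x \<le> y"
    show "a absolutely_integrable_on {x..y}" by (intro absolutely_integrable_continuous_real ac)
    show "(a has_integral w y - w x) {x..y}"
      using \<open>x \<le> y\<close> by (intro fundamental_theorem_of_calculus) (auto intro: has_vector_derivative_at_within a(1))
    show "(\<lambda>t. (norm (a t))\<^sup>2) integrable_on {x..y}"
      by (intro integrable_continuous_real continuous_intros ac)
  qed (rule negligible_empty)
  then show ?thesis unfolding closed_regular_curve_def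
    using w(2) by (simp add: vector_derivative_at[OF w(1)])
qed

lemma periodic_int_shift:
  assumes "\<And>t::real. g (t + 1) = g t"
  shows "g (t + of_int n) = g t"
proof (induction n rule: int_induct[where k = 0])
  case (step1 i)
  then show ?case using assms[of "t + of_int i"] by (simp add: add.assoc)
next
  case (step2 i)
  then show ?case using assms[of "t + of_int (i - 1)"] by (simp add: add.assoc)
qed simp

text \<open>
  A change of parameter on one period suffices, since it extends to the real line.
\<close>

lemma multiple_coverI:
  fixes \<gamma> :: "real \<Rightarrow> complex" and m :: nat
  assumes \<beta>: "closed_regular_curve \<beta>" and m: "m \<ge> 2"
    and f: "continuous_on {0..1} f" "strict_mono_on {0..1} f" "f 1 = f 0 + real m"
    and \<gamma>: "\<And>t. t \<in> {0..1} \<Longrightarrow> \<gamma> t = \<beta> (f t)" "\<And>t. \<gamma> (t + 1) = \<gamma> t"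
  shows "multiple_cover \<gamma>"
proof -
  define \<phi> where "\<phi> t = f (frac t) + of_int \<lfloor>t\<rfloor> *\<^sub>R real m" for t
  have per\<beta>: "\<beta> (t + 1) = \<beta> t" for t using \<beta> by (simp add: closed_regular_curve_def closed_H2_def)
  have "strict_mono \<phi>"
  proof (rule strict_monoI)
    fix x y :: real assume "x < y"
    have f_le: "f s \<le> f t" if "s \<in> {0..1}" "t \<in> {0..1}" "s \<le> t" for s t
      using strict_mono_onD[OF f(2), of s t] that by (cases "s = t") auto
    show "\<phi> x < \<phi> y"
    proof (cases "\<lfloor>x\<rfloor> = \<lfloor>y\<rfloor>")
      case True
      then have "frac x < frac y" using \<open>x < y\<close> by (simp add: frac_def)
      then have "f (frac x) < f (frac y)"
        using frac_ge_0[of x] frac_lt_1[of y] frac_lt_1[of x] frac_ge_0[of y]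
        by (intro strict_mono_onD[OF f(2)]) auto
      then show ?thesis by (simp add: \<phi>_def True)
    next
      case False
      then have "\<lfloor>x\<rfloor> + 1 \<le> \<lfloor>y\<rfloor>" using floor_mono[of x y] \<open>x < y\<close> by linarith
      then have "real_of_int \<lfloor>x\<rfloor> + 1 \<le> of_int \<lfloor>y\<rfloor>" by linarith
      then have "(real_of_int \<lfloor>x\<rfloor> + 1) * real m \<le> of_int \<lfloor>y\<rfloor> * real m" by (intro mult_right_mono) auto
      moreover have "f (frac x) < f 1" "f 0 \<le> f (frac y)"
        using frac_lt_1[of x] frac_ge_0[of x] frac_lt_1[of y] frac_ge_0[of y]
        by (auto intro!: strict_mono_onD[OF f(2)] f_le)
      ultimately show ?thesis using f(3) by (simp add: \<phi>_def algebra_simps)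
    qed
  qed
  moreover have "continuous_on UNIV \<phi>"
    unfolding \<phi>_def by (rule continuous_on_extension_by_translation) (use f in auto)
  moreover have "\<phi> (t + 1) = \<phi> t + real m" for t by (simp add: \<phi>_def frac_1_eq distrib_right)
  moreover have "\<gamma> t = \<beta> (\<phi> t)" for t
  proof -
    have "\<gamma> t = \<gamma> (frac t)"
      using periodic_int_shift[of \<gamma> "frac t" "\<lfloor>t\<rfloor>", OF \<gamma>(2)] by (simp add: frac_def)
    also have "\<dots> = \<beta> (f (frac t))"
      using frac_lt_1[of t] frac_ge_0[of t] by (intro \<gamma>(1)) auto
    also have "\<dots> = \<beta> (f (frac t) + of_int (\<lfloor>t\<rfloor> * int m))"
      by (rule periodic_int_shift[symmetric, of \<beta>, OF per\<beta>])
    finally show ?thesis by (simp add: \<phi>_def)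
  qed
  ultimately show ?thesis unfolding multiple_cover_def using \<beta> m by blast
qed

lemma has_vector_derivative_cis:
  assumes "(f has_real_derivative f') (at t within S)"
  shows "((\<lambda>t. cis (f t)) has_vector_derivative f' *\<^sub>R (\<i> * cis (f t))) (at t within S)"
  using has_derivative_cis[OF assms[unfolded has_field_derivative_def]]
  by (simp add: has_vector_derivative_def mult.commute)

lemma has_derivative_sgn_complex:
  fixes z :: complex
  assumes "z \<noteq> 0"
  shows "((\<lambda>z. z / of_real (norm z)) has_derivative
    (\<lambda>h. h / of_real (norm z) - z * of_real (Re z * Re h + Im z * Im h) / of_real (norm z ^ 3))) (at z)"
proof -
  have "(norm has_derivative (\<lambda>h. h \<bullet> sgn z)) (at z)"
    using has_derivative_norm[OF assms] by simp
  then have "((\<lambda>z. z / of_real (norm z)) has_derivative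
    (\<lambda>h. - z * (inverse (of_real (norm z)) * of_real (h \<bullet> sgn z) * inverse (of_real (norm z))) + h / of_real (norm z))) (at z)"
    using assms
    by (intro has_derivative_divide has_derivative_ident has_derivative_of_real) auto
  then show ?thesis
    by (rule has_derivative_eq_rhs)
      (use assms in \<open>auto simp: fun_eq_iff sgn_eq inner_complex_def field_simps power_eq_if scaleR_conv_of_real\<close>)
qed

text \<open>
  Inside the locale, \<open>\<rho>\<close> is the speed, \<open>\<tau>\<close> the unit tangent and \<open>\<rho>d\<close> the almost everywhere defined
  derivative of \<open>\<rho>\<close>. Outside the negligible set \<open>rough\<close> the velocity is differentiable.
\<close>

locale regular_curve =
  fixes \<gamma> :: "real \<Rightarrow> complex"
  assumes closed_regular: "closed_regular_curve \<gamma>"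
begin

definition v :: "real \<Rightarrow> complex" where "v = velocity \<gamma>"
definition a :: "real \<Rightarrow> complex" where "a = acceleration \<gamma>"
definition rough :: "real set" where "rough = {t. \<not> v differentiable (at t)}"
definition \<rho> :: "real \<Rightarrow> real" where "\<rho> t = norm (v t)"
definition \<tau> :: "real \<Rightarrow> complex" where "\<tau> t = v t / of_real (\<rho> t)"
definition \<rho>d :: "real \<Rightarrow> real" where "\<rho>d t = Re (cnj (\<tau> t) * a t)"
definition k :: "real \<Rightarrow> real" where "k = curvature \<gamma>"
definition len :: real where "len = curve_length \<gamma>"

lemma class_H2: "class_H2 \<gamma>" and periodic: "\<gamma> (t + 1) = \<gamma> t" and v_nonzero: "v t \<noteq> 0"
  using closed_regular by (auto simp: closed_regular_curve_def closed_H2_def v_def)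

lemma v_deriv: "(\<gamma> has_vector_derivative v t) (at t)"
  using class_H2 by (simp add: class_H2_def v_def vector_derivative_works)

lemma negligible_rough: "negligible rough"
  using class_H2 by (simp add: class_H2_def rough_def v_def)

lemma a_deriv: "t \<notin> rough \<Longrightarrow> (v has_vector_derivative a t) (at t)"
  by (simp add: rough_def a_def vector_derivative_works) (simp add: v_def)

lemma
  assumes "x \<le> y"
  shows a_integrable: "a absolutely_integrable_on {x..y}"
    and a_integral: "(a has_integral (v y - v x)) {x..y}"
    and a_square_integrable: "(\<lambda>t. (norm (a t))\<^sup>2) integrable_on {x..y}"
  using class_H2 assms by (auto simp: class_H2_def a_def v_def)

lemma v_periodic: "v (t + 1) = v t"
proof -
  have "((\<lambda>t. t + 1) has_vector_derivative 1) (at t)"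
    by (auto intro!: derivative_eq_intros)
  from vector_diff_chain_at[OF this] v_deriv[of "t + 1"]
  have "((\<lambda>t. \<gamma> (t + 1)) has_vector_derivative v (t + 1)) (at t)" by (simp add: o_def)
  then have "(\<gamma> has_vector_derivative v (t + 1)) (at t)" by (simp add: periodic)
  then show ?thesis using v_deriv vector_derivative_unique_at by blast
qed

lemma v_continuous: "continuous_on S v"
proof -
  have "isCont v x" for x
  proof (rule continuous_on_interior)
    have "a integrable_on {x - 1..x + 1}"
      using a_integrable[of "x - 1" "x + 1"] by (simp add: absolutely_integrable_on_def)
    then have "continuous_on {x - 1..x + 1} (\<lambda>y. v (x - 1) + integral {x - 1..y} a)"
      by (intro continuous_intros indefinite_integral_continuous_1)
    then show "continuous_on {x - 1..x + 1} v"
      by (rule continuous_on_eq) (use integral_unique[OF a_integral] in auto)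
  qed auto
  then show ?thesis by (simp add: continuous_at_imp_continuous_on)
qed

lemma \<rho>_pos: "\<rho> t > 0" using v_nonzero by (simp add: \<rho>_def)
lemma \<rho>_continuous [continuous_intros]: "continuous_on S \<rho>"
  unfolding \<rho>_def by (intro continuous_intros v_continuous)
lemma \<rho>_periodic: "\<rho> (t + 1) = \<rho> t" by (simp add: \<rho>_def v_periodic)
lemma v_eq: "v t = of_real (\<rho> t) * \<tau> t" using \<rho>_pos[of t] by (simp add: \<tau>_def)
lemma norm_\<tau>: "norm (\<tau> t) = 1" using v_nonzero by (simp add: \<tau>_def \<rho>_def norm_divide)
lemma cnj_\<tau>_\<tau>: "cnj (\<tau> t) * \<tau> t = 1"
  using norm_\<tau>[of t] by (simp add: complex_norm_square[symmetric] mult.commute)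
lemma \<tau>_continuous [continuous_intros]: "continuous_on S \<tau>"
  unfolding \<tau>_def using \<rho>_pos by (intro continuous_intros v_continuous) (metis less_irrefl of_real_eq_0_iff)
lemma \<tau>_periodic: "\<tau> (t + 1) = \<tau> t" by (simp add: \<tau>_def v_periodic \<rho>_periodic)

lemma curvature_times_speed: "\<rho> t ^ 2 * k t = Im (cnj (\<tau> t) * a t)"
proof -
  have "Im (cnj (v t) * a t) = \<rho> t * Im (cnj (\<tau> t) * a t)"
    by (simp add: v_eq algebra_simps)
  moreover have "k t = Im (cnj (v t) * a t) / \<rho> t ^ 3"
    by (simp add: k_def curvature_def v_def a_def \<rho>_def)
  ultimately show ?thesis using \<rho>_pos[of t] by (simp add: power_eq_if)
qed

lemma a_decomposition: "a t = of_real (\<rho>d t) * \<tau> t + of_real (\<rho> t ^ 2 * k t) * (\<i> * \<tau> t)"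
proof -
  have "a t = (cnj (\<tau> t) * a t) * \<tau> t" using cnj_\<tau>_\<tau>[of t] by (simp add: mult.assoc mult.left_commute)
  also have "cnj (\<tau> t) * a t = of_real (\<rho>d t) + \<i> * of_real (\<rho> t ^ 2 * k t)"
    unfolding curvature_times_speed \<rho>d_def by (simp add: complex_eq_iff)
  finally show ?thesis by (simp add: algebra_simps)
qed

lemma speed_curvature_eq: "\<rho> t * k t = Re (a t) * (- Im (\<tau> t) / \<rho> t) + Im (a t) * (Re (\<tau> t) / \<rho> t)"
  using curvature_times_speed[of t] \<rho>_pos[of t] by (simp add: field_simps power2_eq_square)

lemma \<rho>d_eq: "\<rho>d t = Re (a t) * Re (\<tau> t) + Im (a t) * Im (\<tau> t)"
  by (simp add: \<rho>d_def algebra_simps)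

lemma \<rho>k_integrable: "x \<le> y \<Longrightarrow> (\<lambda>t. \<rho> t * k t) absolutely_integrable_on {x..y}"
  unfolding speed_curvature_eq using \<rho>_pos
  by (intro set_integral_add absolutely_integrable_times_continuous absolutely_integrable_Re_Im a_integrable
     continuous_intros) (auto simp: less_imp_neq[symmetric])

lemma \<rho>d_integrable: "x \<le> y \<Longrightarrow> \<rho>d absolutely_integrable_on {x..y}"
  unfolding \<rho>d_eq[abs_def]
  by (intro set_integral_add absolutely_integrable_times_continuous absolutely_integrable_Re_Im a_integrable
     continuous_intros)

lemma \<rho>k2_integrable: assumes "x \<le> y" shows "(\<lambda>t. \<rho> t * (k t)\<^sup>2) absolutely_integrable_on {x..y}"
proof -
  have "(\<lambda>t. (\<rho> t * k t) * \<rho> t) absolutely_integrable_on {x..y}"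
    by (intro absolutely_integrable_times_continuous \<rho>k_integrable assms continuous_intros)
  then have "(\<lambda>t. (\<rho> t * k t) * \<rho> t) \<in> borel_measurable (lebesgue_on {x..y})"
    using integrable_imp_measurable absolutely_integrable_on_def by blast
  then have "(\<lambda>t. ((\<rho> t * k t) * \<rho> t)\<^sup>2) absolutely_integrable_on {x..y}"
  proof (intro absolutely_integrable_if_square_le[OF _ a_square_integrable[OF assms]])
    fix t
    have "\<bar>(\<rho> t * k t) * \<rho> t\<bar> = \<bar>Im (cnj (\<tau> t) * a t)\<bar>"
      unfolding curvature_times_speed[symmetric] by (simp add: power2_eq_square mult_ac)
    also have "\<dots> \<le> norm (cnj (\<tau> t) * a t)" by (rule abs_Im_le_cmod)
    also have "\<dots> = norm (a t)" by (simp add: norm_mult norm_\<tau>)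
    finally have "((\<rho> t * k t) * \<rho> t)\<^sup>2 \<le> (norm (a t))\<^sup>2" by (simp add: abs_le_square_iff[symmetric])
    then show "norm (((\<rho> t * k t) * \<rho> t)\<^sup>2) \<le> (norm (a t))\<^sup>2" by simp
  qed (rule borel_measurable_power)
  then have "(\<lambda>t. ((\<rho> t * k t) * \<rho> t)\<^sup>2 * (1 / \<rho> t ^ 3)) absolutely_integrable_on {x..y}"
    using \<rho>_pos by (intro absolutely_integrable_times_continuous continuous_intros)
      (auto simp: less_imp_neq[symmetric])
  moreover have "((\<rho> t * k t) * \<rho> t)\<^sup>2 * (1 / \<rho> t ^ 3) = \<rho> t * (k t)\<^sup>2" for t
    using \<rho>_pos[of t] by (simp add: field_simps power_eq_if)
  ultimately show ?thesis by simp
qed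

text \<open>
  The velocity is absolutely continuous and bounded away from 0, so its direction is absolutely
  continuous too. The tangential part of the acceleration does not turn the tangent.
\<close>

lemma \<tau>_integral:
  assumes "x \<le> y"
  shows "((\<lambda>t. of_real (\<rho> t * k t) * (\<i> * \<tau> t)) has_integral (\<tau> y - \<tau> x)) {x..y}"
proof -
  define p where "p t = 1 / of_real (\<rho> t) - \<tau> t * of_real (Re (\<tau> t)) / of_real (\<rho> t)" for t
  define q where "q t = \<i> / of_real (\<rho> t) - \<tau> t * of_real (Im (\<tau> t)) / of_real (\<rho> t)" for t
  have "((\<lambda>t. 0 + Re (a t) *\<^sub>R p t + Im (a t) *\<^sub>R q t) has_integral
     (snd (y, v y) / of_real (norm (snd (y, v y))) - snd (x, v x) / of_real (norm (snd (x, v x))))) {x..y}"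
  proof (rule FTC_along_indefinite_integral[where F = "\<lambda>w. snd w / of_real (norm (snd w))" and r = "\<lambda>_. 0"])
    fix t
    have "(snd has_derivative snd) (at (t, v t))"
      by (intro bounded_linear_imp_has_derivative bounded_linear_snd)
    from has_derivative_compose[OF this, of "\<lambda>z. z / of_real (norm z)"] has_derivative_sgn_complex[OF v_nonzero, of t]
    have "((\<lambda>w. snd w / of_real (norm (snd w))) has_derivative
      (\<lambda>h. snd h / of_real (norm (v t)) - v t * of_real (Re (v t) * Re (snd h) + Im (v t) * Im (snd h)) / of_real (norm (v t) ^ 3)))
      (at (t, v t))" by simp
    then show "((\<lambda>w. snd w / of_real (norm (snd w))) has_derivative
        (\<lambda>(h, z). h *\<^sub>R 0 + Re z *\<^sub>R p t + Im z *\<^sub>R q t)) (at (t, v t))"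
    proof (rule has_derivative_eq_rhs, intro ext, clarify)
      fix h and z :: complex
      have r: "of_real (\<rho> t) \<noteq> (0::complex)" using \<rho>_pos[of t] by simp
      have z: "z = of_real (Re z) + \<i> * of_real (Im z)" by (rule complex_eq)
      show "snd (h, z) / of_real (norm (v t)) - v t * of_real (Re (v t) * Re (snd (h, z)) + Im (v t) * Im (snd (h, z))) / of_real (norm (v t) ^ 3)
         = h *\<^sub>R 0 + Re z *\<^sub>R p t + Im z *\<^sub>R q t"
        unfolding \<rho>_def[symmetric] unfolding v_eq p_def q_def using r
        by (subst z) (simp add: scaleR_conv_of_real field_simps power_eq_if)
    qed
  qed (use assms \<rho>_pos in \<open>auto simp: p_def q_def less_imp_neq[symmetric] intro!: a_integrable a_integral continuous_intros\<close>)
  moreover have "0 + Re (a t) *\<^sub>R p t + Im (a t) *\<^sub>R q t = of_real (\<rho> t * k t) * (\<i> * \<tau> t)" for t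
  proof -
    have r: "of_real (\<rho> t) \<noteq> (0::complex)" using \<rho>_pos[of t] by simp
    have "0 + Re (a t) *\<^sub>R p t + Im (a t) *\<^sub>R q t
        = ((of_real (Re (a t)) + \<i> * of_real (Im (a t))) - of_real (\<rho>d t) * \<tau> t) / of_real (\<rho> t)"
      unfolding p_def q_def \<rho>d_eq using r
      by (simp add: scaleR_conv_of_real field_simps)
    also have "\<dots> = (a t - of_real (\<rho>d t) * \<tau> t) / of_real (\<rho> t)"
      by (simp only: complex_eq[symmetric])
    also have "\<dots> = of_real (\<rho> t * k t) * (\<i> * \<tau> t)"
      using r by (subst a_decomposition) (simp add: field_simps power2_eq_square)
    finally show ?thesis .
  qed
  ultimately show ?thesis by (simp add: \<tau>_def \<rho>_def)
qed

lemma \<rho>_deriv: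
  assumes "t \<notin> rough"
  shows "(\<rho> has_vector_derivative \<rho>d t) (at t)"
proof -
  have "((\<lambda>t. norm (v t)) has_derivative (\<lambda>h. (h *\<^sub>R a t) \<bullet> sgn (v t))) (at t)"
    by (rule has_derivative_compose[OF a_deriv[OF assms, unfolded has_vector_derivative_def]
          has_derivative_norm[OF v_nonzero, simplified]])
  moreover have "a t \<bullet> sgn (v t) = \<rho>d t"
    by (simp add: sgn_eq \<rho>_def[symmetric] \<tau>_def[symmetric] \<rho>d_eq inner_complex_def algebra_simps)
  ultimately show ?thesis unfolding has_vector_derivative_def \<rho>_def by simp
qed

lemma \<rho>_times_integral:
  fixes W W' :: "real \<Rightarrow> complex"
  assumes "x \<le> y" and W: "\<And>t. (W has_vector_derivative W' t) (at t)" and W': "continuous_on UNIV W'"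
  shows "((\<lambda>t. of_real (\<rho> t) * W' t + of_real (\<rho>d t) * W t) has_integral
     (of_real (\<rho> y) * W y - of_real (\<rho> x) * W x)) {x..y}"
proof -
  have Wc: "continuous_on S W" for S
    using W by (meson continuous_at_imp_continuous_on has_vector_derivative_continuous)
  have "((\<lambda>t. of_real (\<rho> t) * W' t + Re (a t) *\<^sub>R (of_real (Re (\<tau> t)) * W t) + Im (a t) *\<^sub>R (of_real (Im (\<tau> t)) * W t)) has_integral
     ((\<lambda>w. of_real (norm (snd w)) * W (fst w)) (y, v y) - (\<lambda>w. of_real (norm (snd w)) * W (fst w)) (x, v x))) {x..y}"
  proof (rule FTC_along_indefinite_integral[where F = "\<lambda>w. of_real (norm (snd w)) * W (fst w)"
        and r = "\<lambda>t. of_real (\<rho> t) * W' t" and p = "\<lambda>t. of_real (Re (\<tau> t)) * W t"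
        and q = "\<lambda>t. of_real (Im (\<tau> t)) * W t"])
    fix t
    have 1: "((\<lambda>w. W (fst w)) has_derivative (\<lambda>h. fst h *\<^sub>R W' t)) (at (t, v t))"
      using has_derivative_compose[OF bounded_linear_imp_has_derivative[OF bounded_linear_fst], of W _ "(t, v t)"]
        W[of t] by (simp add: has_vector_derivative_def)
    have "(norm has_derivative (\<lambda>h. h \<bullet> sgn (snd (t, v t)))) (at (snd (t, v t)))"
      using has_derivative_norm[OF v_nonzero] by simp
    from has_derivative_compose[OF bounded_linear_imp_has_derivative[OF bounded_linear_snd] this]
    have 2: "((\<lambda>w. norm (snd w)) has_derivative (\<lambda>h. snd h \<bullet> sgn (v t))) (at (t, v t))" by simp
    have "((\<lambda>w. of_real (norm (snd w)) * W (fst w)) has_derivative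
       (\<lambda>h. of_real (norm (v t)) * (fst h *\<^sub>R W' t) + of_real (snd h \<bullet> sgn (v t)) * W t)) (at (t, v t))"
      using has_derivative_mult[OF has_derivative_of_real[OF 2] 1] by simp
    then show "((\<lambda>w. of_real (norm (snd w)) * W (fst w)) has_derivative
        (\<lambda>(h, z). h *\<^sub>R (of_real (\<rho> t) * W' t) + Re z *\<^sub>R (of_real (Re (\<tau> t)) * W t) + Im z *\<^sub>R (of_real (Im (\<tau> t)) * W t))) (at (t, v t))"
    proof (rule has_derivative_eq_rhs, intro ext, clarify)
      fix h :: real and z :: complex
      have "z \<bullet> sgn (v t) = Re z * Re (\<tau> t) + Im z * Im (\<tau> t)"
        by (simp add: sgn_eq \<rho>_def[symmetric] \<tau>_def[symmetric] inner_complex_def)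
      then show "of_real (norm (v t)) * (fst (h, z) *\<^sub>R W' t) + of_real (snd (h, z) \<bullet> sgn (v t)) * W t
        = h *\<^sub>R (of_real (\<rho> t) * W' t) + Re z *\<^sub>R (of_real (Re (\<tau> t)) * W t) + Im z *\<^sub>R (of_real (Im (\<tau> t)) * W t)"
        by (simp add: \<rho>_def[symmetric] scaleR_conv_of_real algebra_simps)
    qed
  qed (use assms in \<open>auto intro!: a_integrable a_integral continuous_intros Wc continuous_on_subset[OF W']\<close>)
  moreover have "(\<lambda>t. of_real (\<rho> t) * W' t + Re (a t) *\<^sub>R (of_real (Re (\<tau> t)) * W t) + Im (a t) *\<^sub>R (of_real (Im (\<tau> t)) * W t))
     = (\<lambda>t. of_real (\<rho> t) * W' t + of_real (\<rho>d t) * W t)"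
    by (rule ext) (simp add: \<rho>d_eq scaleR_conv_of_real algebra_simps)
  ultimately show ?thesis by (simp only: \<rho>_def fst_conv snd_conv)
qed

text \<open>
  The admissible variations: \<open>W\<close> is the derivative of the displacement with respect to arclength and
  \<open>b\<close> that of \<open>W\<close>. The multiple \<open>\<alpha>\<close> of the velocity is a dilation of the curve, which serves to make
  the length stationary.
\<close>

lemma test_field:
  fixes \<phi> W b :: "real \<Rightarrow> complex"
  assumes \<phi>: "\<And>t. (\<phi> has_vector_derivative (\<rho> t *\<^sub>R W t - \<alpha> *\<^sub>R v t)) (at t)"
    and W: "\<And>t. (W has_vector_derivative (\<rho> t *\<^sub>R b t)) (at t)"
    and b: "continuous_on UNIV b"
    and per: "\<And>t. \<phi> (t + 1) = \<phi> t"
  shows "closed_H2 \<phi>"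
    and "t \<notin> rough \<Longrightarrow> ((\<lambda>t. \<rho> t *\<^sub>R W t - \<alpha> *\<^sub>R v t) has_vector_derivative
           (\<rho>d t *\<^sub>R W t + (\<rho> t)\<^sup>2 *\<^sub>R b t - \<alpha> *\<^sub>R a t)) (at t)"
proof -
  let ?a = "\<lambda>t. \<rho>d t *\<^sub>R W t + (\<rho> t)\<^sup>2 *\<^sub>R b t - \<alpha> *\<^sub>R a t"
  have Wc: "continuous_on S W" for S
    using W by (meson continuous_at_imp_continuous_on has_vector_derivative_continuous)
  have bc: "continuous_on S b" for S using b continuous_on_subset by blast
  show der: "((\<lambda>t. \<rho> t *\<^sub>R W t - \<alpha> *\<^sub>R v t) has_vector_derivative ?a t) (at t)" if "t \<notin> rough" for t
    using \<rho>_deriv[OF that] a_deriv[OF that] W[of t]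
    by (auto intro!: derivative_eq_intros simp: has_real_derivative_iff_has_vector_derivative power2_eq_square)
  have ai: "?a absolutely_integrable_on {x..y}" if "x \<le> y" for x y
    using that by (intro set_integral_add set_integral_diff absolutely_integrable_continuous_mult
        absolutely_integrable_scaleR_left \<rho>d_integrable a_integrable Wc
        absolutely_integrable_continuous_real continuous_intros bc)
  show "closed_H2 \<phi>"
  proof (rule closed_H2I[OF \<phi> negligible_rough der _ _ _ per])
    fix x y :: real assume xy: "x \<le> y"
    show "?a absolutely_integrable_on {x..y}" by (rule ai[OF xy])
    have "continuous_on UNIV (\<lambda>t. \<rho> t *\<^sub>R b t)" by (intro continuous_intros b)
    from has_integral_diff[OF \<rho>_times_integral[OF xy W this] has_integral_cmul[OF a_integral[OF xy], of \<alpha>]]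
    show "(?a has_integral (\<rho> y *\<^sub>R W y - \<alpha> *\<^sub>R v y - (\<rho> x *\<^sub>R W x - \<alpha> *\<^sub>R v x))) {x..y}"
      by (simp add: scaleR_conv_of_real power2_eq_square algebra_simps)
    obtain B where B: "\<And>t. t \<in> {x..y} \<Longrightarrow> norm (W t) \<le> B"
      using compact_imp_bounded[OF compact_continuous_image[OF Wc compact_Icc[of x y]]]
      unfolding bounded_iff by blast
    obtain C where C: "\<And>t. t \<in> {x..y} \<Longrightarrow> norm ((\<rho> t)\<^sup>2 *\<^sub>R b t) \<le> C"
    proof -
      have "continuous_on {x..y} (\<lambda>t. (\<rho> t)\<^sup>2 *\<^sub>R b t)" by (intro continuous_intros bc)
      from compact_imp_bounded[OF compact_continuous_image[OF this compact_Icc]] that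
      show ?thesis unfolding bounded_iff by blast
    qed
    define M where "M = B + \<bar>\<alpha>\<bar>"
    have bd: "norm ((norm (?a t))\<^sup>2) \<le> 2 * M\<^sup>2 * (norm (a t))\<^sup>2 + 2 * C\<^sup>2" if t: "t \<in> {x..y}" for t
    proof -
      have "\<bar>\<rho>d t\<bar> \<le> norm (a t)"
        using abs_Re_le_cmod[of "cnj (\<tau> t) * a t"] by (simp add: \<rho>d_def norm_mult norm_\<tau>)
      then have "norm (\<rho>d t *\<^sub>R W t) \<le> norm (a t) * B"
        using B[OF t] by (auto intro: mult_mono)
      moreover have "norm (?a t) \<le> norm (\<rho>d t *\<^sub>R W t) + norm ((\<rho> t)\<^sup>2 *\<^sub>R b t) + norm (\<alpha> *\<^sub>R a t)"
        by (intro norm_triangle_le_diff norm_triangle_le add_mono order_refl)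
      ultimately have "norm (?a t) \<le> M * norm (a t) + C"
        using C[OF t] by (simp add: M_def algebra_simps)
      then have "(norm (?a t))\<^sup>2 \<le> (M * norm (a t) + C)\<^sup>2" by (intro power_mono) auto
      also have "\<dots> \<le> 2 * M\<^sup>2 * (norm (a t))\<^sup>2 + 2 * C\<^sup>2"
        using sum_squares_bound[of "M * norm (a t)" C] by (simp add: power2_sum power_mult_distrib)
      finally show ?thesis by simp
    qed
    have "?a \<in> borel_measurable (lebesgue_on {x..y})"
      using ai[OF xy] integrable_imp_measurable absolutely_integrable_on_def by blast
    then have "(\<lambda>t. (norm (?a t))\<^sup>2) \<in> borel_measurable (lebesgue_on {x..y})"
      by (intro borel_measurable_power measurable_compose[OF _ borel_measurable_norm])
    then have "(\<lambda>t. (norm (?a t))\<^sup>2) absolutely_integrable_on {x..y}"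
      by (rule absolutely_integrable_if_square_le[OF _ _ bd])
        (intro integrable_add integrable_on_mult_right a_square_integrable[OF xy] integrable_const_ivl)
    then show "(\<lambda>t. (norm (?a t))\<^sup>2) integrable_on {x..y}" by (simp add: absolutely_integrable_on_def)
  qed
qed

section \<open>The first variations of length and elastic energy\<close>

lemma len_eq: "len = integral {0..1} \<rho>"
  unfolding len_def curve_length_def \<rho>_def v_def ..

lemma energy_eq: "elastic_energy \<gamma> = integral {0..1} (\<lambda>t. \<rho> t * (k t)\<^sup>2)"
  unfolding elastic_energy_def \<rho>_def v_def k_def by (simp add: mult.commute)

lemma len_pos: "len > 0"
proof -
  obtain m where m: "m > 0" "\<And>t. t \<in> {0..1} \<Longrightarrow> m \<le> \<rho> t"
  proof -
    obtain t0 where "t0 \<in> {0..1}" "\<And>t. t \<in> {0..1} \<Longrightarrow> \<rho> t0 \<le> \<rho> t"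
      using continuous_attains_inf[OF compact_Icc _ \<rho>_continuous, of 0 1] by auto
    then show ?thesis using that \<rho>_pos by blast
  qed
  have "m = integral {0..1} (\<lambda>t::real. m)" by simp
  also have "\<dots> \<le> integral {0..1} \<rho>"
    using m by (intro integral_le integrable_continuous_real \<rho>_continuous) auto
  finally show ?thesis using m len_eq by simp
qed

text \<open>
  After dividing the velocity by \<open>\<rho>\<close> and splitting off the tangential acceleration \<open>\<rho>d\<close>, which is
  parallel to the perturbed velocity as well, only \<open>k\<close> is left as a factor that need not be
  continuous.
\<close>

lemma perturbed_integrands:
  fixes \<phi> W b :: "real \<Rightarrow> complex"
  assumes \<phi>: "\<And>t. (\<phi> has_vector_derivative (\<rho> t *\<^sub>R W t - \<alpha> *\<^sub>R v t)) (at t)"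
    and W: "\<And>t. (W has_vector_derivative (\<rho> t *\<^sub>R b t)) (at t)"
    and b: "continuous_on UNIV b"
    and per: "\<And>t. \<phi> (t + 1) = \<phi> t"
  defines "Z \<equiv> \<lambda>e t. (1 - e * \<alpha>) *\<^sub>R \<tau> t + e *\<^sub>R W t"
    and "Y \<equiv> \<lambda>e t. ((1 - e * \<alpha>) * k t) *\<^sub>R (\<i> * \<tau> t) + e *\<^sub>R b t"
  shows "norm (velocity (perturb \<gamma> \<phi> e) t) = \<rho> t * norm (Z e t)"
    and "t \<notin> rough \<Longrightarrow> (curvature (perturb \<gamma> \<phi> e) t)\<^sup>2 * norm (velocity (perturb \<gamma> \<phi> e) t)
       = \<rho> t * (Im (cnj (Z e t) * Y e t))\<^sup>2 / norm (Z e t) ^ 5"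
proof -
  have vel: "velocity (perturb \<gamma> \<phi> e) t = \<rho> t *\<^sub>R Z e t" for t
  proof (rule vector_derivative_at)
    have "(perturb \<gamma> \<phi> e has_vector_derivative (v t + e *\<^sub>R (\<rho> t *\<^sub>R W t - \<alpha> *\<^sub>R v t))) (at t)"
      unfolding perturb_def by (intro has_vector_derivative_add v_deriv bounded_linear.has_vector_derivative[OF bounded_linear_scaleR_right] \<phi>)
    then show "(perturb \<gamma> \<phi> e has_vector_derivative \<rho> t *\<^sub>R Z e t) (at t)"
      by (simp add: Z_def v_eq scaleR_conv_of_real algebra_simps)
  qed
  show nv: "norm (velocity (perturb \<gamma> \<phi> e) t) = \<rho> t * norm (Z e t)" for t
    unfolding vel using \<rho>_pos[of t] by simp
  assume t: "t \<notin> rough"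
  have velf: "velocity (perturb \<gamma> \<phi> e) = (\<lambda>t. v t + e *\<^sub>R (\<rho> t *\<^sub>R W t - \<alpha> *\<^sub>R v t))"
    unfolding vel by (auto simp: Z_def v_eq scaleR_conv_of_real algebra_simps)
  have acc: "acceleration (perturb \<gamma> \<phi> e) t = \<rho>d t *\<^sub>R Z e t + (\<rho> t)\<^sup>2 *\<^sub>R Y e t"
  proof (rule vector_derivative_at)
    have "((\<lambda>t. v t + e *\<^sub>R (\<rho> t *\<^sub>R W t - \<alpha> *\<^sub>R v t)) has_vector_derivative
        (a t + e *\<^sub>R (\<rho>d t *\<^sub>R W t + (\<rho> t)\<^sup>2 *\<^sub>R b t - \<alpha> *\<^sub>R a t))) (at t)"
      by (intro has_vector_derivative_add a_deriv t bounded_linear.has_vector_derivative[OF bounded_linear_scaleR_right]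
          test_field(2)[OF \<phi> W b per])
    moreover have "a t + e *\<^sub>R (\<rho>d t *\<^sub>R W t + (\<rho> t)\<^sup>2 *\<^sub>R b t - \<alpha> *\<^sub>R a t) = \<rho>d t *\<^sub>R Z e t + (\<rho> t)\<^sup>2 *\<^sub>R Y e t"
      unfolding Z_def Y_def by (subst (1 2) a_decomposition) (simp add: scaleR_conv_of_real algebra_simps)
    ultimately show "(velocity (perturb \<gamma> \<phi> e) has_vector_derivative \<rho>d t *\<^sub>R Z e t + (\<rho> t)\<^sup>2 *\<^sub>R Y e t) (at t)"
      unfolding velf by simp
  qed
  have "Im (cnj (\<rho> t *\<^sub>R Z e t) * (\<rho>d t *\<^sub>R Z e t + (\<rho> t)\<^sup>2 *\<^sub>R Y e t)) = \<rho> t ^ 3 * Im (cnj (Z e t) * Y e t)"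
    by (simp add: algebra_simps power2_eq_square power3_eq_cube)
  then have "curvature (perturb \<gamma> \<phi> e) t = Im (cnj (Z e t) * Y e t) / norm (Z e t) ^ 3"
    unfolding curvature_def acc unfolding vel using \<rho>_pos[of t] by (simp add: power_mult_distrib)
  moreover have "(I / z ^ 3)\<^sup>2 * (r * z) = r * I\<^sup>2 / z ^ 5" for I z r :: real
    by (cases "z = 0") (simp_all add: field_simps power_eq_if)
  ultimately show "(curvature (perturb \<gamma> \<phi> e) t)\<^sup>2 * norm (velocity (perturb \<gamma> \<phi> e) t)
       = \<rho> t * (Im (cnj (Z e t) * Y e t))\<^sup>2 / norm (Z e t) ^ 5"
    unfolding nv by presburger
qed

text \<open>
  The elastic energy is expanded into three integrals with the weights \<open>\<rho>k\<^sup>2\<close>, \<open>\<rho>k\<close> and \<open>\<rho>\<close>, each of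
  which is differentiated under the integral sign.
\<close>

lemma first_variation:
  fixes \<phi> W b :: "real \<Rightarrow> complex"
  assumes \<phi>: "\<And>t. (\<phi> has_vector_derivative (\<rho> t *\<^sub>R W t - \<alpha> *\<^sub>R v t)) (at t)"
    and W: "\<And>t. (W has_vector_derivative (\<rho> t *\<^sub>R b t)) (at t)"
    and b: "continuous_on UNIV b"
    and per: "\<And>t. \<phi> (t + 1) = \<phi> t"
  defines "X \<equiv> \<lambda>t. Re (cnj (\<tau> t) * W t)"
    and "P \<equiv> \<lambda>t. Im (cnj (\<tau> t) * b t)"
  shows "((\<lambda>e. curve_length (perturb \<gamma> \<phi> e)) has_real_derivative
      integral {0..1} (\<lambda>t. \<rho> t * (X t - \<alpha>))) (at 0)"
    and "((\<lambda>e. elastic_energy (perturb \<gamma> \<phi> e)) has_real_derivative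
      (integral {0..1} (\<lambda>t. \<rho> t * (k t)\<^sup>2 * (\<alpha> - 3 * X t)) + integral {0..1} (\<lambda>t. \<rho> t * k t * (2 * P t)))) (at 0)"
proof -
  have Wc: "continuous_on S W" for S
    using W by (meson continuous_at_imp_continuous_on has_vector_derivative_continuous)
  have bc: "continuous_on S b" for S using b continuous_on_subset by blast
  define Z where "Z e t = (1 - e * \<alpha>) *\<^sub>R \<tau> t + e *\<^sub>R W t" for e t
  define Y where "Y e t = ((1 - e * \<alpha>) * k t) *\<^sub>R (\<i> * \<tau> t) + e *\<^sub>R b t" for e t
  define V where "V t = Im (cnj (W t) * b t)" for t
  define N where "N t = (norm (W t))\<^sup>2" for t
  define n where "n z = (1 - fst z * \<alpha>)\<^sup>2 + 2 * fst z * (1 - fst z * \<alpha>) * X (snd z) + (fst z)\<^sup>2 * N (snd z)" for z :: "real \<times> real"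
  define n' where "n' z = - 2 * \<alpha> * (1 - fst z * \<alpha>) + 2 * (1 - 2 * fst z * \<alpha>) * X (snd z) + 2 * fst z * N (snd z)" for z :: "real \<times> real"
  define A where "A z = (1 - fst z * \<alpha>) * ((1 - fst z * \<alpha>) + fst z * X (snd z))" for z :: "real \<times> real"
  define A' where "A' z = - \<alpha> * ((1 - fst z * \<alpha>) + fst z * X (snd z)) + (1 - fst z * \<alpha>) * (X (snd z) - \<alpha>)" for z :: "real \<times> real"
  define B where "B z = (1 - fst z * \<alpha>) * P (snd z) + fst z * V (snd z)" for z :: "real \<times> real"
  define B' where "B' z = - \<alpha> * P (snd z) + V (snd z)" for z :: "real \<times> real"
  obtain M where M: "\<And>t. t \<in> {0..1} \<Longrightarrow> norm (W t) \<le> M"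
    using compact_imp_bounded[OF compact_continuous_image[OF Wc compact_Icc[of 0 1]]]
    unfolding bounded_iff by blast
  \<comment> \<open>For \<open>|e| \<le> e0\<close> the perturbation changes the velocity by less than its length.\<close>
  define e0 where "e0 = 1 / (2 * (\<bar>\<alpha>\<bar> + \<bar>M\<bar> + 1))"
  have e0: "e0 > 0" by (simp add: e0_def)
  have nZ: "n (e, t) = (norm (Z e t))\<^sup>2" for e t
  proof -
    have "(Re (\<tau> t))\<^sup>2 + (Im (\<tau> t))\<^sup>2 = 1" using norm_\<tau>[of t] by (simp add: cmod_def)
    then show ?thesis
      unfolding n_def Z_def X_def N_def cmod_power2 by (simp add: power2_eq_square) algebra
  qed
  have Zpos: "norm (Z e t) > 0" if "\<bar>e\<bar> \<le> e0" "t \<in> {0..1}" for e t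
  proof -
    have "\<bar>e\<bar> * (\<bar>\<alpha>\<bar> + \<bar>M\<bar>) \<le> e0 * (\<bar>\<alpha>\<bar> + \<bar>M\<bar>)" using that by (intro mult_right_mono) auto
    also have "\<dots> < 1" by (simp add: e0_def field_simps)
    finally have 1: "\<bar>e\<bar> * (\<bar>\<alpha>\<bar> + \<bar>M\<bar>) < 1" .
    have "1 = norm (Z e t + ((e * \<alpha>) *\<^sub>R \<tau> t - e *\<^sub>R W t))"
      unfolding Z_def by (simp add: algebra_simps norm_\<tau>)
    also have "\<dots> \<le> norm (Z e t) + (norm ((e * \<alpha>) *\<^sub>R \<tau> t) + norm (e *\<^sub>R W t))"
      by (intro norm_triangle_le add_mono order_refl norm_triangle_le_diff)
    also have "norm ((e * \<alpha>) *\<^sub>R \<tau> t) + norm (e *\<^sub>R W t) \<le> \<bar>e\<bar> * (\<bar>\<alpha>\<bar> + \<bar>M\<bar>)"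
      using M[OF that(2)] by (simp add: norm_\<tau> abs_mult distrib_left mult_left_mono)
    finally show ?thesis using 1 by linarith
  qed
  have npos: "n (e, t) > 0" if "\<bar>e\<bar> \<le> e0" "t \<in> {0..1}" for e t
    using Zpos[OF that] by (simp add: nZ)
  have n0: "n (0, t) = 1" for t by (simp add: n_def)
  have XPVN: "continuous_on {0..1} X" "continuous_on {0..1} P" "continuous_on {0..1} V" "continuous_on {0..1} N"
    unfolding X_def P_def V_def N_def by (intro continuous_intros Wc bc)+
  note c = XPVN[THEN continuous_on_snd_comp, of "{-e0..e0}"]
  have nc: "continuous_on ({-e0..e0} \<times> {0..1}) n" "continuous_on ({-e0..e0} \<times> {0..1}) n'"
    unfolding n_def n'_def by (intro continuous_intros c)+
  have ABc: "continuous_on ({-e0..e0} \<times> {0..1}) A" "continuous_on ({-e0..e0} \<times> {0..1}) A'"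
    "continuous_on ({-e0..e0} \<times> {0..1}) B" "continuous_on ({-e0..e0} \<times> {0..1}) B'"
    unfolding A_def A'_def B_def B'_def by (intro continuous_intros c)+
  have nd: "((\<lambda>e. n (e, t)) has_real_derivative n' (e, t)) (at e)" for e t
    unfolding n_def n'_def by (auto intro!: derivative_eq_intros simp: algebra_simps power2_eq_square)
  have Ad: "((\<lambda>e. A (e, t)) has_real_derivative A' (e, t)) (at e)" for e t
    unfolding A_def A'_def by (auto intro!: derivative_eq_intros simp: algebra_simps power2_eq_square)
  have Bd: "((\<lambda>e. B (e, t)) has_real_derivative B' (e, t)) (at e)" for e t
    unfolding B_def B'_def by (auto intro!: derivative_eq_intros simp: algebra_simps power2_eq_square)
  have \<rho>i: "\<rho> absolutely_integrable_on {0..1}"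
    by (intro absolutely_integrable_continuous_real \<rho>_continuous)
  have zn: "norm (Z e t) = sqrt (n (e, t))" for e t by (simp add: nZ)
  note integrands = perturbed_integrands[OF \<phi> W b per, folded Z_def Y_def]
  have "curve_length (perturb \<gamma> \<phi> e) = integral {0..1} (\<lambda>t. \<rho> t * sqrt (n (e, t)))" for e
    unfolding curve_length_def integrands(1) zn ..
  moreover have "integral {0..1} (\<lambda>t. \<rho> t * (n' (0, t) / 2)) = integral {0..1} (\<lambda>t. \<rho> t * (X t - \<alpha>))"
    by (intro integral_cong) (simp add: n'_def field_simps)
  ultimately show "((\<lambda>e. curve_length (perturb \<gamma> \<phi> e)) has_real_derivative
      integral {0..1} (\<lambda>t. \<rho> t * (X t - \<alpha>))) (at 0)"
    using has_derivative_integral_sqrt[OF \<rho>i e0 nd npos n0 nc] by simp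
  have ImZY: "Im (cnj (Z e t) * Y e t) = k t * A (e, t) + e * B (e, t)" for e t
  proof -
    have "(Re (\<tau> t))\<^sup>2 + (Im (\<tau> t))\<^sup>2 = 1" using norm_\<tau>[of t] by (simp add: cmod_def)
    then show ?thesis
      unfolding Z_def Y_def A_def B_def X_def P_def V_def by (simp add: power2_eq_square) algebra
  qed
  let ?I = "\<lambda>h Q e. integral {0..1} (\<lambda>t. h t * (Q (e, t) / sqrt (n (e, t)) ^ 5))"
  define Q1 where "Q1 z = (A z)\<^sup>2" for z :: "real \<times> real"
  define Q2 where "Q2 z = 2 * fst z * A z * B z" for z :: "real \<times> real"
  define Q3 where "Q3 z = (fst z * B z)\<^sup>2" for z :: "real \<times> real"
  define Q1' where "Q1' z = 2 * A z * A' z" for z :: "real \<times> real"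
  define Q2' where "Q2' z = 2 * A z * B z + 2 * fst z * (A' z * B z + A z * B' z)" for z :: "real \<times> real"
  define Q3' where "Q3' z = 2 * fst z * B z * (B z + fst z * B' z)" for z :: "real \<times> real"
  have Qd: "((\<lambda>e. Q1 (e, t)) has_real_derivative Q1' (e, t)) (at e)"
    "((\<lambda>e. Q2 (e, t)) has_real_derivative Q2' (e, t)) (at e)"
    "((\<lambda>e. Q3 (e, t)) has_real_derivative Q3' (e, t)) (at e)" for e t
    unfolding Q1_def Q2_def Q3_def Q1'_def Q2'_def Q3'_def
    by (auto intro!: derivative_eq_intros Ad Bd simp: algebra_simps power2_eq_square)
  have Qc: "continuous_on ({-e0..e0} \<times> {0..1}) Q1" "continuous_on ({-e0..e0} \<times> {0..1}) Q1'"
    "continuous_on ({-e0..e0} \<times> {0..1}) Q2" "continuous_on ({-e0..e0} \<times> {0..1}) Q2'"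
    "continuous_on ({-e0..e0} \<times> {0..1}) Q3" "continuous_on ({-e0..e0} \<times> {0..1}) Q3'"
    unfolding Q1_def Q2_def Q3_def Q1'_def Q2'_def Q3'_def by (intro continuous_intros ABc)+
  have k2i: "(\<lambda>t. \<rho> t * (k t)\<^sup>2) absolutely_integrable_on {0..1}"
    and ki: "(\<lambda>t. \<rho> t * k t) absolutely_integrable_on {0..1}"
    by (rule \<rho>k2_integrable \<rho>k_integrable, simp)+
  have c1: "integral {0..1} (\<lambda>t. \<rho> t * (k t)\<^sup>2 * (Q1' (0, t) - 5 / 2 * Q1 (0, t) * n' (0, t)))
      = integral {0..1} (\<lambda>t. \<rho> t * (k t)\<^sup>2 * (\<alpha> - 3 * X t))"
    by (intro integral_cong) (simp add: Q1_def Q1'_def A_def A'_def n'_def field_simps)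
  have c2: "integral {0..1} (\<lambda>t. \<rho> t * k t * (Q2' (0, t) - 5 / 2 * Q2 (0, t) * n' (0, t)))
      = integral {0..1} (\<lambda>t. \<rho> t * k t * (2 * P t))"
    by (intro integral_cong) (simp add: Q2_def Q2'_def A_def B_def)
  have c3: "integral {0..1} (\<lambda>t. \<rho> t * (Q3' (0, t) - 5 / 2 * Q3 (0, t) * n' (0, t))) = 0"
    by (simp add: Q3_def Q3'_def)
  have d1: "(?I (\<lambda>t. \<rho> t * (k t)\<^sup>2) Q1 has_real_derivative integral {0..1} (\<lambda>t. \<rho> t * (k t)\<^sup>2 * (\<alpha> - 3 * X t))) (at 0)"
    using has_derivative_integral_over_fifth_power[OF k2i e0 Qd(1) nd npos n0 Qc(1,2) nc] unfolding c1 by simp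
  have d2: "(?I (\<lambda>t. \<rho> t * k t) Q2 has_real_derivative integral {0..1} (\<lambda>t. \<rho> t * k t * (2 * P t))) (at 0)"
    using has_derivative_integral_over_fifth_power[OF ki e0 Qd(2) nd npos n0 Qc(3,4) nc] unfolding c2 by simp
  have d3: "(?I \<rho> Q3 has_real_derivative 0) (at 0)"
    using has_derivative_integral_over_fifth_power[OF \<rho>i e0 Qd(3) nd npos n0 Qc(5,6) nc] unfolding c3 by simp
  have split: "elastic_energy (perturb \<gamma> \<phi> e) = ?I (\<lambda>t. \<rho> t * (k t)\<^sup>2) Q1 e + ?I (\<lambda>t. \<rho> t * k t) Q2 e + ?I \<rho> Q3 e"
    if e: "\<bar>e\<bar> < e0" for e
  proof -
    have ii: "(\<lambda>t. h t * (Q (e, t) / sqrt (n (e, t)) ^ 5)) integrable_on {0..1}"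
      if "h absolutely_integrable_on {0..1}" "continuous_on ({-e0..e0} \<times> {0..1}) Q"
      for h :: "real \<Rightarrow> real" and Q :: "real \<times> real \<Rightarrow> real"
    proof -
      have "continuous_on {0..1} (\<lambda>t. Q (e, t) / sqrt (n (e, t)) ^ 5)"
        using e npos[of e] by (intro continuous_intros continuous_on_slice[of e0] that(2) nc(1)) force+
      from absolutely_integrable_times_continuous[OF that(1) this]
      show ?thesis by (simp add: absolutely_integrable_on_def)
    qed
    have "elastic_energy (perturb \<gamma> \<phi> e)
        = integral {0..1} (\<lambda>t. \<rho> t * (k t)\<^sup>2 * (Q1 (e, t) / sqrt (n (e, t)) ^ 5)
          + \<rho> t * k t * (Q2 (e, t) / sqrt (n (e, t)) ^ 5) + \<rho> t * (Q3 (e, t) / sqrt (n (e, t)) ^ 5))"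
      unfolding elastic_energy_def
    proof (rule integral_spike[OF negligible_rough])
      fix t assume "t \<in> {0..1} - rough"
      then have t: "t \<notin> rough" by simp
      have "(curvature (perturb \<gamma> \<phi> e) t)\<^sup>2 * norm (velocity (perturb \<gamma> \<phi> e) t)
         = \<rho> t * (k t * A (e, t) + e * B (e, t))\<^sup>2 / sqrt (n (e, t)) ^ 5"
        unfolding integrands(2)[OF t] ImZY zn ..
      also have "\<rho> t * (k t * A (e, t) + e * B (e, t))\<^sup>2
        = \<rho> t * (k t)\<^sup>2 * Q1 (e, t) + \<rho> t * k t * Q2 (e, t) + \<rho> t * Q3 (e, t)"
        by (simp add: Q1_def Q2_def Q3_def power2_eq_square algebra_simps)
      finally show "\<rho> t * (k t)\<^sup>2 * (Q1 (e, t) / sqrt (n (e, t)) ^ 5)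
          + \<rho> t * k t * (Q2 (e, t) / sqrt (n (e, t)) ^ 5) + \<rho> t * (Q3 (e, t) / sqrt (n (e, t)) ^ 5)
          = (curvature (perturb \<gamma> \<phi> e) t)\<^sup>2 * norm (velocity (perturb \<gamma> \<phi> e) t)"
        by (simp add: add_divide_distrib)
    qed
    also have "\<dots> = ?I (\<lambda>t. \<rho> t * (k t)\<^sup>2) Q1 e + ?I (\<lambda>t. \<rho> t * k t) Q2 e + ?I \<rho> Q3 e"
      using ii[OF k2i Qc(1)] ii[OF ki Qc(3)] ii[OF \<rho>i Qc(5)]
      by (simp add: integral_add integrable_add)
    finally show ?thesis .
  qed
  have "((\<lambda>e. ?I (\<lambda>t. \<rho> t * (k t)\<^sup>2) Q1 e + ?I (\<lambda>t. \<rho> t * k t) Q2 e + ?I \<rho> Q3 e) has_real_derivative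
     (integral {0..1} (\<lambda>t. \<rho> t * (k t)\<^sup>2 * (\<alpha> - 3 * X t)) + integral {0..1} (\<lambda>t. \<rho> t * k t * (2 * P t)) + 0)) (at 0)"
    by (intro DERIV_add d1 d2 d3)
  then show "((\<lambda>e. elastic_energy (perturb \<gamma> \<phi> e)) has_real_derivative
      (integral {0..1} (\<lambda>t. \<rho> t * (k t)\<^sup>2 * (\<alpha> - 3 * X t)) + integral {0..1} (\<lambda>t. \<rho> t * k t * (2 * P t)))) (at 0)"
    unfolding add_0_right
    by (rule has_field_derivative_transform_within[OF _ e0]) (use split in \<open>auto simp: dist_real_def\<close>)
qed

section \<open>The Euler-Lagrange equation\<close>

text \<open>The Lagrange multiplier of the length constraint.\<close>

definition \<Lambda> :: real where "\<Lambda> = elastic_energy \<gamma> / len"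

text \<open>
  Every displacement can be corrected by a dilation so that the length becomes stationary. A dilation
  changes the energy at the rate \<open>- E\<close> and the length at the rate \<open>L\<close>, which is why the
  multiplier is \<open>E/L\<close>.
\<close>

lemma weak_Euler_Lagrange:
  assumes elastica: "closed_elastica \<gamma>"
    and W: "\<And>t. (W has_vector_derivative (\<rho> t *\<^sub>R b t)) (at t)"
    and b: "continuous_on UNIV b"
    and per: "\<And>t. W (t + 1) = W t" and mean0: "integral {0..1} (\<lambda>t. \<rho> t *\<^sub>R W t) = 0"
  shows "integral {0..1} (\<lambda>t. \<rho> t * k t * (2 * ((\<i> * \<tau> t) \<bullet> b t)))
    + integral {0..1} (\<lambda>t. \<rho> t * (\<Lambda> - 3 * (k t)\<^sup>2) * (\<tau> t \<bullet> W t)) = 0"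
proof -
  have Wc: "continuous_on S W" for S
    using W by (meson continuous_at_imp_continuous_on has_vector_derivative_continuous)
  define X where "X t = Re (cnj (\<tau> t) * W t)" for t
  define P where "P t = Im (cnj (\<tau> t) * b t)" for t
  have Xc: "continuous_on {0..1} X" unfolding X_def by (intro continuous_intros Wc)
  have XI: "\<tau> t \<bullet> W t = X t" "(\<i> * \<tau> t) \<bullet> b t = P t" for t
    by (simp_all add: X_def P_def inner_complex_def)
  define J where "J = integral {0..1} (\<lambda>t. \<rho> t * X t)"
  define \<alpha> where "\<alpha> = J / len"
  have "(v has_integral (\<gamma> 1 - \<gamma> 0)) {0..1}"
    by (rule fundamental_theorem_of_calculus) (auto intro: has_vector_derivative_at_within[OF v_deriv])
  then have v0: "(v has_integral 0) {0..1}" using periodic[of 0] by simp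
  have Wi: "(\<lambda>t. \<rho> t *\<^sub>R W t) integrable_on {0..1}"
    by (intro integrable_continuous_real continuous_intros Wc)
  obtain \<phi> where \<phi>: "\<And>t. (\<phi> has_vector_derivative (\<rho> t *\<^sub>R W t - \<alpha> *\<^sub>R v t)) (at t)" "\<And>t. \<phi> (t + 1) = \<phi> t"
  proof (rule periodic_antiderivative_exists)
    show "continuous_on UNIV (\<lambda>t. \<rho> t *\<^sub>R W t - \<alpha> *\<^sub>R v t)"
      by (intro continuous_intros Wc v_continuous)
    show "\<rho> (t + 1) *\<^sub>R W (t + 1) - \<alpha> *\<^sub>R v (t + 1) = \<rho> t *\<^sub>R W t - \<alpha> *\<^sub>R v t" for t
      by (simp add: \<rho>_periodic per v_periodic)
    have "((\<lambda>t. \<rho> t *\<^sub>R W t - \<alpha> *\<^sub>R v t) has_integral (0 - \<alpha> *\<^sub>R 0)) {0..1}"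
      using Wi mean0 by (intro has_integral_diff has_integral_cmul v0) (simp add: has_integral_integral)
    then show "integral {0..1} (\<lambda>t. \<rho> t *\<^sub>R W t - \<alpha> *\<^sub>R v t) = 0"
      by (simp add: integral_unique)
  qed auto
  note var = first_variation[OF \<phi>(1) W b \<phi>(2), folded X_def P_def]
  have \<rho>i: "\<rho> integrable_on {0..1}" and \<rho>Xi: "(\<lambda>t. \<rho> t * X t) integrable_on {0..1}"
    by (intro integrable_continuous_real continuous_intros Xc)+
  have "integral {0..1} (\<lambda>t. \<rho> t * (X t - \<alpha>)) = integral {0..1} (\<lambda>t. \<rho> t * X t - \<rho> t * \<alpha>)"
    by (simp add: algebra_simps)
  also have "\<dots> = J - len * \<alpha>"
    using \<rho>i \<rho>Xi by (simp add: integral_diff integrable_on_mult_left J_def len_eq)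
  also have "\<dots> = 0" using len_pos by (simp add: \<alpha>_def)
  finally have "((\<lambda>\<epsilon>. curve_length (perturb \<gamma> \<phi> \<epsilon>)) has_real_derivative 0) (at 0)" using var(1) by simp
  with elastica test_field(1)[OF \<phi>(1) W b \<phi>(2)]
  have "((\<lambda>\<epsilon>. elastic_energy (perturb \<gamma> \<phi> \<epsilon>)) has_real_derivative 0) (at 0)"
    unfolding closed_elastica_def by blast
  from DERIV_unique[OF var(2) this]
  have eq: "integral {0..1} (\<lambda>t. \<rho> t * (k t)\<^sup>2 * (\<alpha> - 3 * X t)) + integral {0..1} (\<lambda>t. \<rho> t * k t * (2 * P t)) = 0" .
  have k2: "(\<lambda>t. \<rho> t * (k t)\<^sup>2) integrable_on {0..1}"
    using \<rho>k2_integrable[of 0 1] by (simp add: absolutely_integrable_on_def)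
  have k2X: "(\<lambda>t. \<rho> t * (k t)\<^sup>2 * X t) integrable_on {0..1}"
    using absolutely_integrable_times_continuous[OF \<rho>k2_integrable Xc] by (simp add: absolutely_integrable_on_def)
  have "integral {0..1} (\<lambda>t. \<rho> t * (k t)\<^sup>2 * (\<alpha> - 3 * X t))
     = integral {0..1} (\<lambda>t. \<rho> t * (k t)\<^sup>2 * \<alpha> - 3 * (\<rho> t * (k t)\<^sup>2 * X t))"
    by (simp add: algebra_simps)
  also have "\<dots> = elastic_energy \<gamma> * \<alpha> - 3 * integral {0..1} (\<lambda>t. \<rho> t * (k t)\<^sup>2 * X t)"
    using k2 k2X by (simp add: integral_diff integrable_on_mult_left integrable_on_mult_right energy_eq)
  also have "elastic_energy \<gamma> * \<alpha> = \<Lambda> * J" by (simp add: \<alpha>_def \<Lambda>_def)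
  also have "\<Lambda> * J - 3 * integral {0..1} (\<lambda>t. \<rho> t * (k t)\<^sup>2 * X t)
     = integral {0..1} (\<lambda>t. \<Lambda> * (\<rho> t * X t) - 3 * (\<rho> t * (k t)\<^sup>2 * X t))"
    using k2X \<rho>Xi by (simp add: integral_diff integrable_on_mult_right J_def)
  also have "\<dots> = integral {0..1} (\<lambda>t. \<rho> t * (\<Lambda> - 3 * (k t)\<^sup>2) * X t)"
    by (simp add: algebra_simps)
  finally show ?thesis using eq by (simp add: XI)
qed

text \<open>
  Antiderivatives with respect to arclength, normalized to have mean zero with respect to arclength
  again, so that the construction can be repeated.
\<close>

lemma weighted_antiderivative:
  fixes g :: "real \<Rightarrow> complex"
  assumes g: "continuous_on UNIV g" "\<And>t. g (t + 1) = g t" "integral {0..1} (\<lambda>t. \<rho> t *\<^sub>R g t) = 0"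
  obtains b where "\<And>t. (b has_vector_derivative (\<rho> t *\<^sub>R g t)) (at t)" "continuous_on UNIV b"
    "\<And>t. b (t + 1) = b t" "integral {0..1} (\<lambda>t. \<rho> t *\<^sub>R b t) = 0"
proof -
  obtain B where B: "\<And>t. (B has_vector_derivative (\<rho> t *\<^sub>R g t)) (at t)" "\<And>t. B (t + 1) = B t"
    by (rule periodic_antiderivative_exists[of "\<lambda>t. \<rho> t *\<^sub>R g t"])
       (use g in \<open>auto intro!: continuous_intros simp: \<rho>_periodic\<close>)
  have Bc: "continuous_on S B" for S
    using B(1) by (meson continuous_at_imp_continuous_on has_vector_derivative_continuous)
  define m where "m = (1 / len) *\<^sub>R integral {0..1} (\<lambda>t. \<rho> t *\<^sub>R B t)"
  show ?thesis
  proof (rule that[of "\<lambda>t. B t - m"])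
    show "((\<lambda>t. B t - m) has_vector_derivative \<rho> t *\<^sub>R g t) (at t)" for t
      using has_vector_derivative_diff[OF B(1) has_vector_derivative_const[of m]] by simp
    have i: "(\<lambda>t. \<rho> t *\<^sub>R B t) integrable_on {0..1}" "\<rho> integrable_on {0..1}"
      by (intro integrable_continuous_real continuous_intros Bc)+
    have "((\<lambda>t. \<rho> t *\<^sub>R B t - \<rho> t *\<^sub>R m) has_integral
       (integral {0..1} (\<lambda>t. \<rho> t *\<^sub>R B t) - len *\<^sub>R m)) {0..1}"
      unfolding len_eq
      by (intro has_integral_diff has_integral_scaleR_left integrable_integral i)
    then show "integral {0..1} (\<lambda>t. \<rho> t *\<^sub>R (B t - m)) = 0"
      using len_pos by (simp add: integral_unique algebra_simps m_def)
  qed (use B in \<open>auto intro!: continuous_intros Bc\<close>)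
qed

lemma \<tau>_deriv_smooth_point:
  assumes "t \<notin> rough"
  shows "(\<tau> has_vector_derivative ((\<rho> t * k t) *\<^sub>R (\<i> * \<tau> t))) (at t)"
proof -
  have r: "\<rho> t \<noteq> 0" using \<rho>_pos[of t] by simp
  have "((\<lambda>s. (1 / \<rho> s) *\<^sub>R v s) has_vector_derivative
     ((1 / \<rho> t) *\<^sub>R a t + (- \<rho>d t / (\<rho> t)\<^sup>2) *\<^sub>R v t)) (at t)"
    using \<rho>_deriv[OF assms] a_deriv[OF assms] r
    by (auto intro!: derivative_eq_intros has_vector_derivative_scaleR
        simp: has_real_derivative_iff_has_vector_derivative[symmetric] power2_eq_square)
  moreover have "(\<lambda>s. (1 / \<rho> s) *\<^sub>R v s) = \<tau>" by (auto simp: \<tau>_def scaleR_conv_of_real)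
  moreover have "(1 / \<rho> t) *\<^sub>R a t + (- \<rho>d t / (\<rho> t)\<^sup>2) *\<^sub>R v t = (\<rho> t * k t) *\<^sub>R (\<i> * \<tau> t)"
    using r by (subst a_decomposition) (simp add: v_eq scaleR_conv_of_real field_simps power2_eq_square)
  ultimately show ?thesis by simp
qed

text \<open>
  The argument of du Bois-Reymond. By integration by parts the weak equation says that
  \<open>p = \<rho>(2k\<i>\<tau> - G - f)\<close> is orthogonal to the second derivatives of all test fields. Here \<open>c\<close> and \<open>f\<close> are
  the constants for which \<open>G\<close> and \<open>F = \<integral>p\<close> are periodic. As \<open>F\<close> is continuous, there is a test field
  whose third derivative with respect to arclength is \<open>F\<close> minus its mean value; pairing with it
  shows that \<open>F\<close> equals its mean value, hence vanishes. Since \<open>\<tau>\<close> is an indefinite integral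
  of \<open>\<rho>k\<i>\<tau>\<close>, it is therefore one of the continuous function \<open>\<rho>(G + f)/2\<close>.
\<close>

lemma Euler_Lagrange_integrated:
  assumes elastica: "closed_elastica \<gamma>"
  obtains c f :: complex and G :: "real \<Rightarrow> complex" where
    "\<And>t. t \<in> {0..1} \<Longrightarrow> G t = integral {0..t} (\<lambda>t. (\<rho> t * (\<Lambda> - 3 * (k t)\<^sup>2)) *\<^sub>R \<tau> t + \<rho> t *\<^sub>R c)"
    "G 1 = 0" "continuous_on {0..1} G"
    "\<And>t. t \<in> {0..1} \<Longrightarrow> \<tau> t - \<tau> 0 = integral {0..t} (\<lambda>t. (\<rho> t / 2) *\<^sub>R (G t + f))"
proof -
  define h where "h t = (\<rho> t * (\<Lambda> - 3 * (k t)\<^sup>2)) *\<^sub>R \<tau> t" for t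
  have k2: "(\<lambda>t. \<rho> t * (k t)\<^sup>2) absolutely_integrable_on {0..1}"
    and ki: "(\<lambda>t. \<rho> t * k t) absolutely_integrable_on {0..1}"
    by (rule \<rho>k2_integrable \<rho>k_integrable, simp)+
  have hi: "h absolutely_integrable_on {0..1}"
  proof -
    have "(\<lambda>t. \<rho> t * \<Lambda> - 3 * (\<rho> t * (k t)\<^sup>2)) absolutely_integrable_on {0..1}"
      by (intro set_integral_diff absolutely_integrable_continuous_real continuous_intros
          set_integrable_mult_right k2)
    then have "(\<lambda>t. \<rho> t * (\<Lambda> - 3 * (k t)\<^sup>2)) absolutely_integrable_on {0..1}"
      by (simp add: algebra_simps)
    from absolutely_integrable_continuous_mult[OF this \<tau>_continuous]
    show ?thesis unfolding h_def .
  qed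
  define c where "c = - (1 / len) *\<^sub>R integral {0..1} h"
  define g where "g t = h t + \<rho> t *\<^sub>R c" for t
  define G where "G t = integral {0..t} g" for t
  have \<rho>i: "\<rho> integrable_on {0..1}" by (intro integrable_continuous_real continuous_intros)
  have gi: "g absolutely_integrable_on {0..1}"
    unfolding g_def by (intro set_integral_add hi absolutely_integrable_continuous_real continuous_intros)
  then have gi': "g integrable_on {0..1}" by (simp add: absolutely_integrable_on_def)
  have \<rho>c: "((\<lambda>t. \<rho> t *\<^sub>R z) has_integral len *\<^sub>R z) {0..1}" for z :: complex
    unfolding len_eq by (intro has_integral_scaleR_left integrable_integral \<rho>i)
  have "(g has_integral (integral {0..1} h + len *\<^sub>R c)) {0..1}"
    unfolding g_def using hi
    by (intro has_integral_add \<rho>c integrable_integral) (simp add: absolutely_integrable_on_def)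
  then have G1: "G 1 = 0"
    using len_pos by (simp add: G_def integral_unique c_def)
  have Gc: "continuous_on {0..1} G"
    unfolding G_def by (intro indefinite_integral_continuous_1 gi')
  define q where "q t = (2 * (\<rho> t * k t)) *\<^sub>R (\<i> * \<tau> t) - \<rho> t *\<^sub>R G t" for t
  have qi: "q absolutely_integrable_on {0..1}"
    unfolding q_def
    by (intro set_integral_diff absolutely_integrable_continuous_mult set_integrable_mult_right ki
        absolutely_integrable_continuous_real continuous_intros Gc)
  define f where "f = (1 / len) *\<^sub>R integral {0..1} q"
  define p where "p t = q t - \<rho> t *\<^sub>R f" for t
  have pi: "p absolutely_integrable_on {0..1}"
    unfolding p_def by (intro set_integral_diff qi absolutely_integrable_continuous_real continuous_intros)
  then have pi': "p integrable_on {0..1}" by (simp add: absolutely_integrable_on_def)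
  define F where "F t = integral {0..t} p" for t
  have "(p has_integral (integral {0..1} q - len *\<^sub>R f)) {0..1}"
    unfolding p_def using qi
    by (intro has_integral_diff \<rho>c integrable_integral) (simp add: absolutely_integrable_on_def)
  then have F1: "F 1 = 0" using len_pos by (simp add: F_def f_def integral_unique)
  have F0: "F 0 = 0" by (simp add: F_def)
  have Fc: "continuous_on {0..1} F"
    unfolding F_def by (intro indefinite_integral_continuous_1 pi')
  define m where "m = (1 / len) *\<^sub>R integral {0..1} (\<lambda>t. \<rho> t *\<^sub>R F t)"
  \<comment> \<open>The periodic extension of \<open>F\<close> minus its mean value \<open>m\<close> with respect to arclength.\<close>
  define w where "w t = F (frac t) - m" for t
  have wF: "w t = F t - m" if "t \<in> {0..1}" for t
  proof (cases "t = 1")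
    case False
    then have "frac t = t" using that by (simp add: frac_eq)
    then show ?thesis by (simp add: w_def)
  qed (simp add: w_def F0 F1)
  have wc: "continuous_on UNIV w"
    using continuous_on_extension_by_translation[OF Fc, of 0] F0 F1
    unfolding w_def by (intro continuous_on_diff continuous_on_const) simp
  have wint: "integral {0..1} (\<lambda>t. \<rho> t *\<^sub>R w t) = 0"
  proof -
    have i: "(\<lambda>t. \<rho> t *\<^sub>R F t) integrable_on {0..1}"
      by (intro integrable_continuous_real continuous_intros Fc)
    have "((\<lambda>t. \<rho> t *\<^sub>R F t - \<rho> t *\<^sub>R m) has_integral (integral {0..1} (\<lambda>t. \<rho> t *\<^sub>R F t) - len *\<^sub>R m)) {0..1}"
      by (intro has_integral_diff integrable_integral i \<rho>c)
    moreover have "integral {0..1} (\<lambda>t. \<rho> t *\<^sub>R w t) = integral {0..1} (\<lambda>t. \<rho> t *\<^sub>R F t - \<rho> t *\<^sub>R m)"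
      by (intro integral_cong) (simp add: wF algebra_simps)
    ultimately show ?thesis using len_pos by (simp add: integral_unique m_def)
  qed
  obtain b where b: "\<And>t. (b has_vector_derivative (\<rho> t *\<^sub>R w t)) (at t)" "continuous_on UNIV b"
    "\<And>t. b (t + 1) = b t" "integral {0..1} (\<lambda>t. \<rho> t *\<^sub>R b t) = 0"
    by (rule weighted_antiderivative[OF wc _ wint]) (auto simp: w_def frac_1_eq)
  obtain W where W: "\<And>t. (W has_vector_derivative (\<rho> t *\<^sub>R b t)) (at t)" "continuous_on UNIV W"
    "\<And>t. W (t + 1) = W t" "integral {0..1} (\<lambda>t. \<rho> t *\<^sub>R W t) = 0"
    by (rule weighted_antiderivative[OF b(2,3,4)]) blast
  have bc: "continuous_on S b" and Wc: "continuous_on S W" for S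
    using b(2) W(2) continuous_on_subset by blast+
  have abs_inner: "(\<lambda>t. u t \<bullet> z t) integrable_on {0..1}"
    if "u absolutely_integrable_on {0..1}" "continuous_on {0..1} z" for u z :: "real \<Rightarrow> complex"
  proof -
    have "(\<lambda>t. Re (u t) * Re (z t) + Im (u t) * Im (z t)) absolutely_integrable_on {0..1}"
      by (intro set_integral_add absolutely_integrable_times_continuous absolutely_integrable_Re_Im that continuous_intros)
    then show ?thesis by (simp add: absolutely_integrable_on_def inner_complex_def)
  qed
  have inner_int: "integral {0..1} (\<lambda>t. z \<bullet> u t) = z \<bullet> integral {0..1} u"
    if "u integrable_on {0..1}" for z :: complex and u :: "real \<Rightarrow> complex"
    using integral_linear[OF that bounded_linear_inner_right[of z]] by (simp add: o_def)
  have \<rho>bi: "(\<lambda>t. \<rho> t *\<^sub>R b t) integrable_on {0..1}" and \<rho>Wi: "(\<lambda>t. \<rho> t *\<^sub>R W t) integrable_on {0..1}"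
    and \<rho>wi: "(\<lambda>t. \<rho> t *\<^sub>R w t) integrable_on {0..1}"
    by (intro integrable_continuous_real continuous_intros bc Wc continuous_on_subset[OF wc] subset_UNIV)+
  have 1: "integral {0..1} (\<lambda>t. p t \<bullet> b t) + integral {0..1} (\<lambda>t. F t \<bullet> (\<rho> t *\<^sub>R w t)) = 0"
  proof -
    have "((\<lambda>t. F t \<bullet> (\<rho> t *\<^sub>R w t) + p t \<bullet> b t) has_integral (F 1 \<bullet> b 1)) {0..1}"
      by (rule integration_by_parts_indefinite[OF _ pi])
         (auto simp: F_def intro!: b continuous_intros wc)
    moreover have "(\<lambda>t. F t \<bullet> (\<rho> t *\<^sub>R w t)) integrable_on {0..1}"
      by (intro integrable_continuous_real continuous_intros Fc continuous_on_subset[OF wc] subset_UNIV)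
    moreover note abs_inner[OF pi bc]
    ultimately have "integral {0..1} (\<lambda>t. F t \<bullet> (\<rho> t *\<^sub>R w t)) + integral {0..1} (\<lambda>t. p t \<bullet> b t) = 0"
      using F1 by (simp add: integral_add[symmetric] integral_unique)
    then show ?thesis by simp
  qed
  have 2: "integral {0..1} (\<lambda>t. g t \<bullet> W t) + integral {0..1} (\<lambda>t. G t \<bullet> (\<rho> t *\<^sub>R b t)) = 0"
  proof -
    have "((\<lambda>t. G t \<bullet> (\<rho> t *\<^sub>R b t) + g t \<bullet> W t) has_integral (G 1 \<bullet> W 1)) {0..1}"
      by (rule integration_by_parts_indefinite[OF _ gi])
         (auto simp: G_def intro!: W continuous_intros b)
    moreover have "(\<lambda>t. G t \<bullet> (\<rho> t *\<^sub>R b t)) integrable_on {0..1}"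
      by (intro integrable_continuous_real continuous_intros Gc bc)
    moreover note abs_inner[OF gi Wc]
    ultimately have "integral {0..1} (\<lambda>t. G t \<bullet> (\<rho> t *\<^sub>R b t)) + integral {0..1} (\<lambda>t. g t \<bullet> W t) = 0"
      using G1 by (simp add: integral_add[symmetric] integral_unique)
    then show ?thesis by simp
  qed
  have ki2: "(\<lambda>t. \<rho> t * k t * (2 * ((\<i> * \<tau> t) \<bullet> b t))) integrable_on {0..1}"
  proof -
    have "continuous_on {0..1} (\<lambda>t. 2 * ((\<i> * \<tau> t) \<bullet> b t))" by (intro continuous_intros bc)
    from absolutely_integrable_times_continuous[OF ki this] show ?thesis by (simp add: absolutely_integrable_on_def)
  qed
  have "integral {0..1} (\<lambda>t. g t \<bullet> W t) = integral {0..1} (\<lambda>t. h t \<bullet> W t + c \<bullet> (\<rho> t *\<^sub>R W t))"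
    by (simp add: g_def inner_add_left)
  also have "\<dots> = integral {0..1} (\<lambda>t. h t \<bullet> W t) + integral {0..1} (\<lambda>t. c \<bullet> (\<rho> t *\<^sub>R W t))"
    by (intro integral_add abs_inner hi Wc integrable_linear[OF \<rho>Wi bounded_linear_inner_right, unfolded o_def])
  also have "\<dots> = integral {0..1} (\<lambda>t. \<rho> t * (\<Lambda> - 3 * (k t)\<^sup>2) * (\<tau> t \<bullet> W t))"
    by (simp only: inner_int[OF \<rho>Wi] W(4)) (simp add: h_def)
  finally have 3: "integral {0..1} (\<lambda>t. g t \<bullet> W t) = \<dots>" .
  have "integral {0..1} (\<lambda>t. p t \<bullet> b t) = integral {0..1}
      (\<lambda>t. \<rho> t * k t * (2 * ((\<i> * \<tau> t) \<bullet> b t)) - G t \<bullet> (\<rho> t *\<^sub>R b t) - f \<bullet> (\<rho> t *\<^sub>R b t))"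
    by (simp add: p_def q_def inner_diff_left algebra_simps)
  also have "\<dots> = integral {0..1} (\<lambda>t. \<rho> t * k t * (2 * ((\<i> * \<tau> t) \<bullet> b t)))
     - integral {0..1} (\<lambda>t. G t \<bullet> (\<rho> t *\<^sub>R b t)) - integral {0..1} (\<lambda>t. f \<bullet> (\<rho> t *\<^sub>R b t))"
  proof -
    have "(\<lambda>t. G t \<bullet> (\<rho> t *\<^sub>R b t)) integrable_on {0..1}"
      by (intro integrable_continuous_real continuous_intros Gc bc)
    moreover have "(\<lambda>t. f \<bullet> (\<rho> t *\<^sub>R b t)) integrable_on {0..1}"
      by (rule integrable_linear[OF \<rho>bi bounded_linear_inner_right, unfolded o_def])
    ultimately show ?thesis using ki2 by (simp only: integral_diff integrable_diff)
  qed
  also have "integral {0..1} (\<lambda>t. f \<bullet> (\<rho> t *\<^sub>R b t)) = 0"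
    by (simp only: inner_int[OF \<rho>bi] b(4)) simp
  finally have "integral {0..1} (\<lambda>t. p t \<bullet> b t) = 0"
    using 2 3 weak_Euler_Lagrange[OF elastica W(1) b(2) W(3,4)] by simp
  with 1 have 4: "integral {0..1} (\<lambda>t. F t \<bullet> (\<rho> t *\<^sub>R w t)) = 0" by simp
  \<comment> \<open>\<open>F\<close> may be replaced by \<open>w = F - m\<close> in the pairing because \<open>w\<close> has mean zero.\<close>
  have sq: "((\<lambda>t. \<rho> t * (w t \<bullet> w t)) has_integral 0) {0..1}"
  proof -
    have "((\<lambda>t. F t \<bullet> (\<rho> t *\<^sub>R w t) - m \<bullet> (\<rho> t *\<^sub>R w t)) has_integral (0 - m \<bullet> 0)) {0..1}"
    proof (rule has_integral_diff)
      have "(\<lambda>t. F t \<bullet> (\<rho> t *\<^sub>R w t)) integrable_on {0..1}"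
        by (intro integrable_continuous_real continuous_intros Fc continuous_on_subset[OF wc] subset_UNIV)
      with 4 show "((\<lambda>t. F t \<bullet> (\<rho> t *\<^sub>R w t)) has_integral 0) {0..1}" by (metis integrable_integral)
      show "((\<lambda>t. m \<bullet> (\<rho> t *\<^sub>R w t)) has_integral m \<bullet> 0) {0..1}"
        using has_integral_linear[OF integrable_integral[OF \<rho>wi] bounded_linear_inner_right[of m]] wint
        by (simp add: o_def)
    qed
    then show ?thesis
      by (rule has_integral_eq[rotated, THEN has_integral_eq_rhs]) (auto simp: wF inner_diff_left inner_diff_right algebra_simps)
  qed
  have w0: "w t = 0" if "t \<in> {0..1}" for t
  proof -
    have "\<rho> t * (w t \<bullet> w t) = 0"
    proof (rule has_integral_0_cbox_imp_0[of 0 1 "\<lambda>t. \<rho> t * (w t \<bullet> w t)"])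
      show "continuous_on (cbox 0 1) (\<lambda>t. \<rho> t * (w t \<bullet> w t))"
        by (intro continuous_intros continuous_on_subset[OF wc] subset_UNIV)
      show "0 \<le> \<rho> x * (w x \<bullet> w x)" for x using \<rho>_pos[of x] by simp
    qed (use sq that in auto)
    then show ?thesis using \<rho>_pos[of t] by simp
  qed
  have F: "F t = 0" if "t \<in> {0..1}" for t
    using w0[OF that] w0[of 0] wF[OF that] wF[of 0] F0 by simp
  show thesis
  proof (rule that[of G c f])
    show "G t = integral {0..t} (\<lambda>t. (\<rho> t * (\<Lambda> - 3 * (k t)\<^sup>2)) *\<^sub>R \<tau> t + \<rho> t *\<^sub>R c)" for t
      by (simp add: G_def g_def[abs_def] h_def)
    fix t :: real assume t: "t \<in> {0..1}"
    have i: "(\<lambda>t. (\<rho> t / 2) *\<^sub>R (G t + f)) integrable_on {0..t}"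
      by (intro integrable_continuous_real continuous_intros continuous_on_subset[OF Gc]) (use t in auto)
    have "((\<lambda>t. of_real (\<rho> t * k t) * (\<i> * \<tau> t) - (\<rho> t / 2) *\<^sub>R (G t + f)) has_integral
       ((\<tau> t - \<tau> 0) - integral {0..t} (\<lambda>t. (\<rho> t / 2) *\<^sub>R (G t + f)))) {0..t}"
      using t by (intro has_integral_diff \<tau>_integral integrable_integral i) simp
    moreover have "((\<lambda>t. (1/2) *\<^sub>R p t) has_integral (1/2) *\<^sub>R F t) {0..t}"
      unfolding F_def using t
      by (intro has_integral_cmul integrable_integral integrable_on_subinterval[OF pi']) auto
    moreover have "(\<lambda>t. (1/2) *\<^sub>R p t) = (\<lambda>t. of_real (\<rho> t * k t) * (\<i> * \<tau> t) - (\<rho> t / 2) *\<^sub>R (G t + f))"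
      by (simp add: fun_eq_iff p_def q_def scaleR_conv_of_real algebra_simps)
    ultimately show "\<tau> t - \<tau> 0 = integral {0..t} (\<lambda>t. (\<rho> t / 2) *\<^sub>R (G t + f))"
      using F[OF t] by (metis (no_types, lifting) eq_iff_diff_eq_0 has_integral_unique scaleR_zero_right)
  qed (fact G1 Gc)+
qed

text \<open>
  By \<open>Euler_Lagrange_integrated\<close> the tangent is continuously differentiable, with derivative
  \<open>\<rho>Y/2\<close> for \<open>Y = G + f\<close>. As \<open>\<tau>\<close> has unit length, \<open>Y\<close> is orthogonal to it, \<open>Y = 2\<kappa>\<i>\<tau>\<close>, and \<open>\<kappa>\<close> is a continuous
  function that agrees with the curvature almost everywhere. Differentiating \<open>\<langle>\<i>\<tau>,Y\<rangle> = 2\<kappa>\<close> and \<open>\<langle>\<tau>,Y\<rangle> = 0\<close>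
  gives the second and the third equation.
\<close>

lemma elastica_equations:
  assumes elastica: "closed_elastica \<gamma>"
  obtains \<kappa> :: "real \<Rightarrow> real" and c :: complex where
    "\<And>t. t \<in> {0..1} \<Longrightarrow> (\<tau> has_vector_derivative ((\<rho> t * \<kappa> t) *\<^sub>R (\<i> * \<tau> t))) (at t within {0..1})"
    "\<And>t. t \<in> {0..1} \<Longrightarrow> (\<kappa> has_vector_derivative (\<rho> t * (((\<i> * \<tau> t) \<bullet> c) / 2))) (at t within {0..1})"
    "\<And>t. t \<in> {0..1} \<Longrightarrow> (\<kappa> t)\<^sup>2 = \<Lambda> + \<tau> t \<bullet> c"
    "\<kappa> 1 = \<kappa> 0"
    "integral {0..1} (\<lambda>t. \<rho> t * (\<kappa> t)\<^sup>2) = elastic_energy \<gamma>"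
proof -
  obtain c f G where
    G: "\<And>t. t \<in> {0..1} \<Longrightarrow> G t = integral {0..t} (\<lambda>t. (\<rho> t * (\<Lambda> - 3 * (k t)\<^sup>2)) *\<^sub>R \<tau> t + \<rho> t *\<^sub>R c)"
    and G1: "G 1 = 0" and Gc: "continuous_on {0..1} G"
    and T: "\<And>t. t \<in> {0..1} \<Longrightarrow> \<tau> t - \<tau> 0 = integral {0..t} (\<lambda>t. (\<rho> t / 2) *\<^sub>R (G t + f))"
    by (rule Euler_Lagrange_integrated[OF elastica]) (rule that)
  have G0: "G 0 = 0" using G[of 0] by simp
  define Y where "Y t = G t + f" for t
  have Yc: "continuous_on {0..1} Y" unfolding Y_def by (intro continuous_intros Gc)
  define \<kappa> where "\<kappa> t = ((\<i> * \<tau> t) \<bullet> Y t) / 2" for t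
  have \<kappa>c: "continuous_on {0..1} \<kappa>" unfolding \<kappa>_def by (intro continuous_intros Yc) auto
  have bot: "at t within {0..1} \<noteq> bot" if "t \<in> {0..1}" for t :: real
    using that by (simp add: trivial_limit_within islimpt_Icc)
  have der_unique: "d1 = d2" if "t \<in> {0..1}" "(\<psi> has_vector_derivative d1) (at t within {0..1})"
    "(\<psi> has_vector_derivative d2) (at t within {0..1})" for t :: real and \<psi> :: "real \<Rightarrow> 'b::real_normed_vector" and d1 d2
    using vector_derivative_unique_within[OF bot[OF that(1)] that(2,3)] .
  have T': "(\<tau> has_vector_derivative (\<rho> t / 2) *\<^sub>R Y t) (at t within {0..1})" if t: "t \<in> {0..1}" for t
  proof (rule derivative_of_indefinite_integral[of \<tau> "\<tau> 0", OF _ _ t])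
    fix t :: real assume "t \<in> {0..1}"
    from T[OF this] show "\<tau> t = \<tau> 0 + integral {0..t} (\<lambda>t. (\<rho> t / 2) *\<^sub>R Y t)"
      unfolding Y_def by (simp add: diff_eq_eq add.commute)
  qed (intro continuous_intros Yc, simp)
  have inner_der: "((\<lambda>s. u s \<bullet> w s) has_vector_derivative (u t \<bullet> w' + u' \<bullet> w t)) (at t within {0..1})"
    if "(u has_vector_derivative u') (at t within {0..1})" "(w has_vector_derivative w') (at t within {0..1})"
    for u w :: "real \<Rightarrow> complex" and u' w' t
    by (rule bounded_bilinear.has_vector_derivative[OF bounded_bilinear_inner that])
  have \<tau>\<tau>: "\<tau> t \<bullet> \<tau> t = 1" for t using norm_\<tau>[of t] by (simp add: dot_square_norm)
  have orth: "\<tau> t \<bullet> Y t = 0" if t: "t \<in> {0..1}" for t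
  proof -
    have "((\<lambda>s. \<tau> s \<bullet> \<tau> s) has_vector_derivative (\<tau> t \<bullet> ((\<rho> t / 2) *\<^sub>R Y t) + ((\<rho> t / 2) *\<^sub>R Y t) \<bullet> \<tau> t)) (at t within {0..1})"
      by (intro inner_der T' t)
    then have "\<tau> t \<bullet> ((\<rho> t / 2) *\<^sub>R Y t) + ((\<rho> t / 2) *\<^sub>R Y t) \<bullet> \<tau> t = 0"
      using der_unique[OF t _ has_vector_derivative_const[of 1]] by (simp add: \<tau>\<tau>)
    then show ?thesis using \<rho>_pos[of t] by (simp add: inner_commute)
  qed
  have Y: "Y t = (2 * \<kappa> t) *\<^sub>R (\<i> * \<tau> t)" if t: "t \<in> {0..1}" for t
  proof -
    have "(Re (\<tau> t))\<^sup>2 + (Im (\<tau> t))\<^sup>2 = 1" using norm_\<tau>[of t] by (simp add: cmod_def)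
    moreover have "Re (\<tau> t) * Re (Y t) + Im (\<tau> t) * Im (Y t) = 0" using orth[OF t] by (simp add: inner_complex_def)
    ultimately show ?thesis
      unfolding \<kappa>_def complex_eq_iff by (simp add: inner_complex_def power2_eq_square) algebra
  qed
  have T2: "(\<tau> has_vector_derivative ((\<rho> t * \<kappa> t) *\<^sub>R (\<i> * \<tau> t))) (at t within {0..1})" if t: "t \<in> {0..1}" for t
    using T'[OF t] by (simp add: Y[OF t])
  have k_eq: "k t = \<kappa> t" if t: "t \<in> {0..1}" "t \<notin> rough" for t
  proof -
    have "(\<rho> t * k t) *\<^sub>R (\<i> * \<tau> t) = (\<rho> t * \<kappa> t) *\<^sub>R (\<i> * \<tau> t)"
      by (rule der_unique[OF t(1) has_vector_derivative_at_within[OF \<tau>_deriv_smooth_point[OF t(2)]] T2[OF t(1)]])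
    moreover have "\<tau> t \<noteq> 0" using norm_\<tau>[of t] by auto
    ultimately show ?thesis using \<rho>_pos[of t] by simp
  qed
  have Y': "(Y has_vector_derivative ((\<rho> t * (\<Lambda> - 3 * (\<kappa> t)\<^sup>2)) *\<^sub>R \<tau> t + \<rho> t *\<^sub>R c)) (at t within {0..1})"
    if t: "t \<in> {0..1}" for t
  proof (rule derivative_of_indefinite_integral[of Y f, OF _ _ t])
    fix t :: real assume t: "t \<in> {0..1}"
    have "integral {0..t} (\<lambda>t. (\<rho> t * (\<Lambda> - 3 * (k t)\<^sup>2)) *\<^sub>R \<tau> t + \<rho> t *\<^sub>R c)
      = integral {0..t} (\<lambda>t. (\<rho> t * (\<Lambda> - 3 * (\<kappa> t)\<^sup>2)) *\<^sub>R \<tau> t + \<rho> t *\<^sub>R c)"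
      by (rule integral_spike[OF negligible_rough]) (use t k_eq in auto)
    then show "Y t = f + integral {0..t} (\<lambda>t. (\<rho> t * (\<Lambda> - 3 * (\<kappa> t)\<^sup>2)) *\<^sub>R \<tau> t + \<rho> t *\<^sub>R c)"
      by (simp add: Y_def G[OF t])
  qed (intro continuous_intros \<kappa>c)
  have N': "((\<lambda>s. \<i> * \<tau> s) has_vector_derivative (\<i> * ((\<rho> t * \<kappa> t) *\<^sub>R (\<i> * \<tau> t)))) (at t within {0..1})"
    if t: "t \<in> {0..1}" for t
    by (intro has_vector_derivative_mult_right T2 t)
  show thesis
  proof (rule that[of \<kappa> c])
    fix t :: real assume t: "t \<in> {0..1}"
    show "(\<tau> has_vector_derivative ((\<rho> t * \<kappa> t) *\<^sub>R (\<i> * \<tau> t))) (at t within {0..1})" by (rule T2[OF t])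
    have "((\<lambda>s. (\<i> * \<tau> s) \<bullet> Y s) has_vector_derivative
      ((\<i> * \<tau> t) \<bullet> ((\<rho> t * (\<Lambda> - 3 * (\<kappa> t)\<^sup>2)) *\<^sub>R \<tau> t + \<rho> t *\<^sub>R c) + (\<i> * ((\<rho> t * \<kappa> t) *\<^sub>R (\<i> * \<tau> t))) \<bullet> Y t)) (at t within {0..1})"
      by (intro inner_der N' Y' t)
    moreover have "(\<i> * \<tau> t) \<bullet> ((\<rho> t * (\<Lambda> - 3 * (\<kappa> t)\<^sup>2)) *\<^sub>R \<tau> t + \<rho> t *\<^sub>R c) + (\<i> * ((\<rho> t * \<kappa> t) *\<^sub>R (\<i> * \<tau> t))) \<bullet> Y t
      = \<rho> t * ((\<i> * \<tau> t) \<bullet> c)"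
    proof -
      have "\<i> * ((\<rho> t * \<kappa> t) *\<^sub>R (\<i> * \<tau> t)) = (- \<rho> t * \<kappa> t) *\<^sub>R \<tau> t"
        by (simp add: complex_eq_iff)
      moreover have "(\<i> * \<tau> t) \<bullet> \<tau> t = 0" by (simp add: inner_complex_def)
      ultimately show ?thesis using orth[OF t] by (simp add: inner_add_right)
    qed
    ultimately have "((\<lambda>s. (\<i> * \<tau> s) \<bullet> Y s) has_vector_derivative \<rho> t * ((\<i> * \<tau> t) \<bullet> c)) (at t within {0..1})" by simp
    from has_vector_derivative_mult_right[OF this, of "1/2"]
    show "(\<kappa> has_vector_derivative (\<rho> t * (((\<i> * \<tau> t) \<bullet> c) / 2))) (at t within {0..1})"
      by (simp add: \<kappa>_def[abs_def])
    have "((\<lambda>s. \<tau> s \<bullet> Y s) has_vector_derivative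
      (\<tau> t \<bullet> ((\<rho> t * (\<Lambda> - 3 * (\<kappa> t)\<^sup>2)) *\<^sub>R \<tau> t + \<rho> t *\<^sub>R c) + ((\<rho> t * \<kappa> t) *\<^sub>R (\<i> * \<tau> t)) \<bullet> Y t)) (at t within {0..1})"
      by (intro inner_der T2 Y' t)
    moreover have "((\<lambda>s. \<tau> s \<bullet> Y s) has_vector_derivative 0) (at t within {0..1})"
      by (rule has_vector_derivative_transform[OF t _ has_vector_derivative_const[of 0]]) (simp add: orth)
    ultimately have "\<tau> t \<bullet> ((\<rho> t * (\<Lambda> - 3 * (\<kappa> t)\<^sup>2)) *\<^sub>R \<tau> t + \<rho> t *\<^sub>R c) + ((\<rho> t * \<kappa> t) *\<^sub>R (\<i> * \<tau> t)) \<bullet> Y t = 0"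
      by (rule der_unique[OF t])
    moreover have "(\<i> * \<tau> t) \<bullet> Y t = 2 * \<kappa> t" by (simp add: \<kappa>_def)
    ultimately have "\<rho> t * ((\<Lambda> - 3 * (\<kappa> t)\<^sup>2) + \<tau> t \<bullet> c + 2 * (\<kappa> t)\<^sup>2) = 0"
      by (simp add: inner_add_right \<tau>\<tau> power2_eq_square algebra_simps)
    then show "(\<kappa> t)\<^sup>2 = \<Lambda> + \<tau> t \<bullet> c" using \<rho>_pos[of t] by simp
  next
    show "\<kappa> 1 = \<kappa> 0" using \<tau>_periodic[of 0] G0 G1 by (simp add: \<kappa>_def Y_def)
    show "integral {0..1} (\<lambda>t. \<rho> t * (\<kappa> t)\<^sup>2) = elastic_energy \<gamma>"
      unfolding energy_eq by (rule integral_spike[OF negligible_rough]) (use k_eq in auto)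
  qed
qed

end

section \<open>Elasticae without inflection points\<close>

text \<open>
  The vector \<open>c\<close> is conserved: its components along \<open>\<tau>\<close> and \<open>\<i>\<tau>\<close> are \<open>\<kappa>\<^sup>2 - \<Lambda>\<close> and twice the derivative
  of \<open>\<kappa>\<close> with respect to arclength. The latter derivative is called \<open>\<mu>\<close> below.
\<close>

locale elastica = regular_curve +
  fixes \<kappa> :: "real \<Rightarrow> real" and c :: complex
  assumes \<tau>_ode: "\<And>t. t \<in> {0..1} \<Longrightarrow>
      (\<tau> has_vector_derivative ((\<rho> t * \<kappa> t) *\<^sub>R (\<i> * \<tau> t))) (at t within {0..1})"
    and \<kappa>_ode': "\<And>t. t \<in> {0..1} \<Longrightarrow>
      (\<kappa> has_vector_derivative (\<rho> t * (((\<i> * \<tau> t) \<bullet> c) / 2))) (at t within {0..1})"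
    and first_integral: "\<And>t. t \<in> {0..1} \<Longrightarrow> (\<kappa> t)\<^sup>2 = \<Lambda> + \<tau> t \<bullet> c"
    and \<kappa>_closed: "\<kappa> 1 = \<kappa> 0"
    and energy_integral: "integral {0..1} (\<lambda>t. \<rho> t * (\<kappa> t)\<^sup>2) = elastic_energy \<gamma>"
begin

definition \<mu> :: "real \<Rightarrow> real" where "\<mu> t = ((\<i> * \<tau> t) \<bullet> c) / 2"
definition s :: "real \<Rightarrow> real" where "s t = integral {0..t} \<rho>"

lemma \<kappa>_ode: "t \<in> {0..1} \<Longrightarrow> (\<kappa> has_real_derivative (\<rho> t * \<mu> t)) (at t within {0..1})"
  using \<kappa>_ode' by (simp add: \<mu>_def has_real_derivative_iff_has_vector_derivative)

lemma \<kappa>_continuous: "continuous_on {0..1} \<kappa>"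
  by (rule DERIV_continuous_on[OF \<kappa>_ode])

lemma \<mu>_continuous: "continuous_on {0..1} \<mu>"
  unfolding \<mu>_def by (intro continuous_intros) auto

lemma \<mu>_ode:
  assumes t: "t \<in> {0..1}"
  shows "(\<mu> has_real_derivative (- (\<rho> t * \<kappa> t * ((\<kappa> t)\<^sup>2 - \<Lambda>)) / 2)) (at t within {0..1})"
proof -
  have e: "\<i> * ((\<rho> t * \<kappa> t) *\<^sub>R (\<i> * \<tau> t)) = (- \<rho> t * \<kappa> t) *\<^sub>R \<tau> t"
    by (simp add: complex_eq_iff)
  have "((\<lambda>t. \<i> * \<tau> t) has_vector_derivative \<i> * ((\<rho> t * \<kappa> t) *\<^sub>R (\<i> * \<tau> t))) (at t within {0..1})"
    by (intro has_vector_derivative_mult_right \<tau>_ode t)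
  from bounded_linear.has_vector_derivative[OF bounded_linear_inner_left this[unfolded e], of c]
  have "((\<lambda>t. (\<i> * \<tau> t) \<bullet> c) has_real_derivative - \<rho> t * \<kappa> t * (\<tau> t \<bullet> c)) (at t within {0..1})"
    by (simp add: has_real_derivative_iff_has_vector_derivative)
  from DERIV_cdivide[OF this, of 2] show ?thesis
    using first_integral[OF t] by (simp add: \<mu>_def[abs_def] mult.assoc)
qed

lemma \<mu>_closed: "\<mu> 1 = \<mu> 0" using \<tau>_periodic[of 0] by (simp add: \<mu>_def)

lemma energy_circle:
  assumes "t \<in> {0..1}"
  shows "4 * (\<mu> t)\<^sup>2 + ((\<kappa> t)\<^sup>2 - \<Lambda>)\<^sup>2 = (norm c)\<^sup>2"
proof -
  have "(Re (\<tau> t))\<^sup>2 + (Im (\<tau> t))\<^sup>2 = 1" using norm_\<tau>[of t] by (simp add: cmod_def)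
  then show ?thesis
    unfolding first_integral[OF assms] \<mu>_def cmod_power2
    by (simp add: inner_complex_def power2_eq_square) algebra
qed

text \<open>
  This is the equation \<open>E = \<Lambda>L\<close>. It expresses that the curve closes up in the direction of \<open>c\<close>.
\<close>

lemma mean_zero: "((\<lambda>t. \<rho> t * ((\<kappa> t)\<^sup>2 - \<Lambda>)) has_integral 0) {0..1}"
proof -
  have "(\<lambda>t. \<rho> t * (\<kappa> t)\<^sup>2) integrable_on {0..1}" "\<rho> integrable_on {0..1}"
    by (intro integrable_continuous_real continuous_intros \<kappa>_continuous)+
  then have "((\<lambda>t. \<rho> t * (\<kappa> t)\<^sup>2 - \<rho> t * \<Lambda>) has_integral (elastic_energy \<gamma> - len * \<Lambda>)) {0..1}"
    unfolding energy_integral[symmetric] len_eq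
    by (intro has_integral_diff has_integral_mult_left integrable_integral)
  then show ?thesis using len_pos by (simp add: \<Lambda>_def algebra_simps)
qed

lemma s_ode: "t \<in> {0..1} \<Longrightarrow> (s has_real_derivative \<rho> t) (at t within {0..1})"
  unfolding s_def has_real_derivative_iff_has_vector_derivative
  by (intro integral_has_vector_derivative \<rho>_continuous)

lemma s_continuous: "continuous_on {0..1} s"
  by (rule DERIV_continuous_on[OF s_ode])

lemma s_strict_mono: "strict_mono_on {0..1} s"
  by (rule strict_mono_on_if_derivative_pos[OF s_ode \<rho>_pos])

lemma s0: "s 0 = 0" and s1: "s 1 = len" by (simp_all add: s_def len_eq)

text \<open>
  The function \<open>f = \<mu>/\<kappa>\<close> satisfies the Riccati equation \<open>df/ds = (\<Lambda> - \<kappa>\<^sup>2)/2 - f\<^sup>2\<close>. Over a period, the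
  left-hand side and \<open>\<Lambda> - \<kappa>\<^sup>2\<close> integrate to 0, hence so does \<open>f\<^sup>2\<close>.
\<close>

lemma curvature_constant:
  assumes nz: "\<And>t. t \<in> {0..1} \<Longrightarrow> \<kappa> t \<noteq> 0" and t: "t \<in> {0..1}"
  shows "\<kappa> t = \<kappa> 0"
proof -
  define f where "f t = \<mu> t / \<kappa> t" for t
  have fc: "continuous_on {0..1} f" unfolding f_def by (intro continuous_intros \<mu>_continuous \<kappa>_continuous) (use nz in auto)
  have f': "(f has_real_derivative (- (\<rho> t * ((\<kappa> t)\<^sup>2 - \<Lambda>)) / 2 - \<rho> t * (f t)\<^sup>2)) (at t within {0..1})"
    if t: "t \<in> {0..1}" for t
    using DERIV_divide[OF \<mu>_ode[OF t] \<kappa>_ode[OF t] nz[OF t]] unfolding f_def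
    by (rule DERIV_cong) (use nz[OF t] in \<open>simp add: field_simps power2_eq_square\<close>)
  have "((\<lambda>t. - (\<rho> t * ((\<kappa> t)\<^sup>2 - \<Lambda>)) / 2 - \<rho> t * (f t)\<^sup>2) has_integral (f 1 - f 0)) {0..1}"
    by (rule fundamental_theorem_of_calculus) (use f' in \<open>auto simp: has_real_derivative_iff_has_vector_derivative\<close>)
  moreover have "((\<lambda>t. - (\<rho> t * ((\<kappa> t)\<^sup>2 - \<Lambda>)) / 2) has_integral (- 0 / 2)) {0..1}"
    by (intro has_integral_divide has_integral_neg mean_zero)
  ultimately have "((\<lambda>t. - (\<rho> t * ((\<kappa> t)\<^sup>2 - \<Lambda>)) / 2 - (- (\<rho> t * ((\<kappa> t)\<^sup>2 - \<Lambda>)) / 2 - \<rho> t * (f t)\<^sup>2))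
      has_integral (- 0 / 2 - (f 1 - f 0))) {0..1}" by (rule has_integral_diff[rotated])
  then have int: "((\<lambda>t. \<rho> t * (f t)\<^sup>2) has_integral 0) {0..1}"
    by (simp add: f_def \<mu>_closed \<kappa>_closed)
  have "f t = 0" if t: "t \<in> {0..1}" for t
  proof -
    have "\<rho> t * (f t)\<^sup>2 = 0"
    proof (rule has_integral_0_cbox_imp_0[of 0 1 "\<lambda>t. \<rho> t * (f t)\<^sup>2"])
      show "continuous_on (cbox 0 1) (\<lambda>t. \<rho> t * (f t)\<^sup>2)" using fc by (auto intro!: continuous_intros)
      show "0 \<le> \<rho> x * (f x)\<^sup>2" for x using \<rho>_pos[of x] by simp
    qed (use int t in auto)
    then show ?thesis using \<rho>_pos[of t] by simp
  qed
  then have "\<mu> t = 0" if "t \<in> {0..1}" for t using that nz[OF that] by (auto simp: f_def)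
  then have "(\<kappa> has_vector_derivative 0) (at t within {0..1})" if "t \<in> {0..1}" for t
    using \<kappa>_ode[OF that] that by (simp add: has_real_derivative_iff_has_vector_derivative)
  from constant_on_unit_interval[OF this t] show ?thesis .
qed

text \<open>
  With constant curvature, \<open>\<gamma> + \<i>\<tau>/\<kappa>\<close> is a constant, the center, and \<open>\<tau>\<close> turns at a constant rate.
  If it turns only once, then equal points have equal tangents and thus equal parameters, in
  contradiction to the self-intersection.
\<close>

lemma circle:
  assumes nz: "\<And>t. t \<in> {0..1} \<Longrightarrow> \<kappa> t \<noteq> 0" and si: "self_intersecting \<gamma>"
  shows "multiple_cover \<gamma>"
proof -
  define \<kappa>0 where "\<kappa>0 = \<kappa> 0"
  have \<kappa>: "\<kappa> t = \<kappa>0" if "t \<in> {0..1}" for t unfolding \<kappa>0_def by (rule curvature_constant[OF nz that])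
  have nz0: "\<kappa>0 \<noteq> 0" using nz[of 0] by (simp add: \<kappa>0_def)
  have \<tau>: "\<tau> t = cis (\<kappa>0 * s t) * \<tau> 0" if t: "t \<in> {0..1}" for t
  proof -
    have "cis (- \<kappa>0 * s t) * \<tau> t = cis (- \<kappa>0 * s 0) * \<tau> 0"
    proof (rule constant_on_unit_interval[OF _ t])
      fix t :: real assume t: "t \<in> {0..1}"
      have "((\<lambda>t. - \<kappa>0 * s t) has_real_derivative - \<kappa>0 * \<rho> t) (at t within {0..1})"
        by (rule DERIV_cmult[OF s_ode[OF t]])
      then have "((\<lambda>t. cis (- \<kappa>0 * s t)) has_vector_derivative (- \<kappa>0 * \<rho> t) *\<^sub>R (\<i> * cis (- \<kappa>0 * s t))) (at t within {0..1})"
        by (rule has_vector_derivative_cis)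
      from has_vector_derivative_mult[OF this \<tau>_ode[OF t]]
      show "((\<lambda>t. cis (- \<kappa>0 * s t) * \<tau> t) has_vector_derivative 0) (at t within {0..1})"
        by (simp add: \<kappa>[OF t] scaleR_conv_of_real algebra_simps)
    qed
    then have "cis (\<kappa>0 * s t) * (cis (- \<kappa>0 * s t) * \<tau> t) = cis (\<kappa>0 * s t) * \<tau> 0" by (simp add: s0)
    then show ?thesis by (simp add: mult.assoc[symmetric] cis_mult)
  qed
  define z0 where "z0 = \<gamma> 0 + (\<i> / \<kappa>0) * \<tau> 0"
  have \<gamma>: "\<gamma> t = z0 - (\<i> / \<kappa>0) * \<tau> t" if t: "t \<in> {0..1}" for t
  proof -
    have "\<gamma> t + (\<i> / \<kappa>0) * \<tau> t = \<gamma> 0 + (\<i> / \<kappa>0) * \<tau> 0"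
    proof (rule constant_on_unit_interval[OF _ t])
      fix t :: real assume t: "t \<in> {0..1}"
      from has_vector_derivative_add[OF has_vector_derivative_at_within[OF v_deriv] has_vector_derivative_mult_right[OF \<tau>_ode[OF t], of "\<i> / \<kappa>0"]]
      show "((\<lambda>t. \<gamma> t + (\<i> / \<kappa>0) * \<tau> t) has_vector_derivative 0) (at t within {0..1})"
        using nz0 by (simp add: v_eq \<kappa>[OF t] scaleR_conv_of_real algebra_simps)
    qed
    then show ?thesis by (simp add: z0_def algebra_simps)
  qed
  have \<tau>nz: "\<tau> 0 \<noteq> 0" using norm_\<tau>[of 0] by auto
  have "cis (\<kappa>0 * len) = 1"
    using \<tau>[of 1] \<tau>_periodic[of 0] \<tau>nz by (simp add: s1)
  then obtain j :: int where j: "\<kappa>0 * len = 2 * pi * of_int j"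
    by (auto simp: complex_eq_iff cos_one_2pi_int mult.commute)
  define m where "m = nat \<bar>j\<bar>"
  have m: "\<bar>\<kappa>0\<bar> * len = 2 * pi * real m"
  proof -
    have "\<bar>\<kappa>0\<bar> * len = \<bar>\<kappa>0 * len\<bar>" using len_pos by (simp add: abs_mult)
    then show ?thesis using j by (simp add: m_def abs_mult)
  qed
  have m0: "m \<noteq> 0" using m nz0 len_pos by (cases "m = 0") auto
  have m1: "m \<noteq> 1"
  proof
    assume "m = 1"
    obtain x y where xy: "x \<in> {0..<1}" "y \<in> {0..<1}" "x < y" "\<gamma> x = \<gamma> y"
      using si unfolding self_intersecting_def by (metis linorder_neqE_linordered_idom)
    then have "cis (\<kappa>0 * s x) = cis (\<kappa>0 * s y)"
      using \<gamma>[of x] \<gamma>[of y] \<tau>[of x] \<tau>[of y] nz0 \<tau>nz by simp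
    then have "cis (\<kappa>0 * s y - \<kappa>0 * s x) = 1" by (simp add: cis_divide[symmetric])
    then obtain i :: int where i: "\<kappa>0 * s y - \<kappa>0 * s x = 2 * pi * of_int i"
      by (auto simp: complex_eq_iff cos_one_2pi_int mult.commute)
    have lt: "s 0 \<le> s x" "s x < s y" "s y < s 1"
      using xy strict_mono_onD[OF s_strict_mono, of x y] strict_mono_onD[OF s_strict_mono, of y 1]
        strict_mono_onD[OF s_strict_mono, of 0 x] by (auto simp: le_less)
    have "2 * pi * \<bar>of_int i\<bar> = \<bar>\<kappa>0\<bar> * (s y - s x)"
    proof -
      have "\<bar>\<kappa>0 * (s y - s x)\<bar> = \<bar>2 * pi * of_int i\<bar>" using i by (simp add: algebra_simps)
      then show ?thesis using lt by (simp add: abs_mult)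
    qed
    moreover have "0 < \<bar>\<kappa>0\<bar> * (s y - s x)" using lt nz0 by simp
    moreover have "\<bar>\<kappa>0\<bar> * (s y - s x) < \<bar>\<kappa>0\<bar> * len"
      using lt nz0 by (intro mult_strict_left_mono) (auto simp: s0 s1)
    ultimately have "0 < \<bar>real_of_int i\<bar>" "2 * pi * \<bar>of_int i\<bar> < 2 * pi * 1"
      using m \<open>m = 1\<close> by (auto simp: zero_less_mult_iff)
    then have "0 < \<bar>real_of_int i\<bar>" "\<bar>real_of_int i\<bar> < 1"
      by (simp_all only: mult_less_cancel_left_pos pi_gt_zero zero_less_numeral mult_pos_pos)
    then have "of_int 0 < real_of_int \<bar>i\<bar>" "real_of_int \<bar>i\<bar> < of_int 1" by simp_all
    then show False by (simp only: of_int_less_iff)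
  qed
  define \<sigma> where "\<sigma> = 2 * pi * sgn \<kappa>0"
  have \<sigma>: "\<sigma> \<noteq> 0" using nz0 by (simp add: \<sigma>_def sgn_if)
  define \<beta> where "\<beta> u = z0 - (\<i> / \<kappa>0) * (cis (\<sigma> * u) * \<tau> 0)" for u
  have cd: "((\<lambda>u. cis (\<sigma> * u)) has_vector_derivative \<sigma> *\<^sub>R (\<i> * cis (\<sigma> * u))) (at u)" for u
    by (rule has_vector_derivative_cis) (auto intro!: derivative_eq_intros)
  have "closed_regular_curve \<beta>"
  proof (rule closed_regular_curve_if_C2[where w = "\<lambda>u. (\<sigma> * \<tau> 0 / \<kappa>0) * cis (\<sigma> * u)"
         and a = "\<lambda>u. (\<sigma> * \<tau> 0 / \<kappa>0) * (\<sigma> *\<^sub>R (\<i> * cis (\<sigma> * u)))"])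
    show "(\<beta> has_vector_derivative (\<sigma> * \<tau> 0 / \<kappa>0) * cis (\<sigma> * u)) (at u)" for u
      unfolding \<beta>_def
      using has_vector_derivative_diff[OF has_vector_derivative_const[of z0] 
        has_vector_derivative_mult_right[OF has_vector_derivative_mult_left[OF cd]], of "\<i> / \<kappa>0" "\<tau> 0" u]
      by (simp add: scaleR_conv_of_real mult_ac)
    show "\<beta> (u + 1) = \<beta> u" for u
      by (simp add: \<beta>_def distrib_left cis_mult[symmetric] \<sigma>_def sgn_if complex_eq_iff)
    show "((\<lambda>u. (\<sigma> * \<tau> 0 / \<kappa>0) * cis (\<sigma> * u)) has_vector_derivative
        (\<sigma> * \<tau> 0 / \<kappa>0) * (\<sigma> *\<^sub>R (\<i> * cis (\<sigma> * u)))) (at u)" for u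
      by (intro has_vector_derivative_mult_right cd)
    show "continuous_on UNIV (\<lambda>u. (\<sigma> * \<tau> 0 / \<kappa>0) * (\<sigma> *\<^sub>R (\<i> * cis (\<sigma> * u))))"
      by (intro continuous_intros)
  qed (use \<sigma> \<tau>nz nz0 in auto)
  then show ?thesis
  proof (rule multiple_coverI[where m = m and f = "\<lambda>t. \<bar>\<kappa>0\<bar> * s t / (2 * pi)"])
    show "strict_mono_on {0..1} (\<lambda>t. \<bar>\<kappa>0\<bar> * s t / (2 * pi))"
      using s_strict_mono nz0 unfolding strict_mono_on_def by (auto simp: divide_strict_right_mono)
    show "\<bar>\<kappa>0\<bar> * s 1 / (2 * pi) = \<bar>\<kappa>0\<bar> * s 0 / (2 * pi) + real m"
      using m by (simp add: s0 s1)
    show "\<gamma> t = \<beta> (\<bar>\<kappa>0\<bar> * s t / (2 * pi))" if "t \<in> {0..1}" for t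
      unfolding \<gamma>[OF that] \<tau>[OF that] \<beta>_def \<sigma>_def by (simp add: sgn_if abs_if)
  qed (use m0 m1 periodic in \<open>auto intro!: continuous_intros s_continuous\<close>)
qed

end

section \<open>Elasticae with inflection points\<close>

text \<open>
  The modulus \<open>x\<close> is the square of the usual one, the cosine replaces the usual sine, and the integrals
  extend over a full period. Hence \<open>ellK\<close> and \<open>ellE\<close> are four times the complete elliptic integrals
  of the first and second kind.
\<close>

definition delta :: "real \<Rightarrow> real \<Rightarrow> real" where
  "delta x \<theta> = sqrt (1 - x * (cos \<theta>)\<^sup>2)"

definition ellK :: "real \<Rightarrow> real" where "ellK x = integral {0..2*pi} (\<lambda>\<theta>. 1 / delta x \<theta>)"
definition ellE :: "real \<Rightarrow> real" where "ellE x = integral {0..2*pi} (delta x)"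

lemma delta_arg_pos:
  fixes x \<theta> :: real
  assumes "0 \<le> x" "x < 1" shows "1 - x * (cos \<theta>)\<^sup>2 > 0"
proof -
  have "x * (cos \<theta>)\<^sup>2 \<le> x * 1" using assms by (intro mult_left_mono) (auto simp: abs_square_le_1)
  then show ?thesis using assms by simp
qed

lemma delta_pos: "0 \<le> x \<Longrightarrow> x < 1 \<Longrightarrow> delta x \<theta> > 0"
  using delta_arg_pos by (simp add: delta_def)

lemma delta_square: "0 \<le> x \<Longrightarrow> x < 1 \<Longrightarrow> (delta x \<theta>)\<^sup>2 = 1 - x * (cos \<theta>)\<^sup>2"
  using delta_arg_pos[of x \<theta>] by (simp add: delta_def)

lemma delta_continuous [continuous_intros]: "continuous_on S (delta x)"
  unfolding delta_def by (intro continuous_intros)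

lemma delta_periodic: "delta x (\<theta> + 2 * pi) = delta x \<theta>" by (simp add: delta_def)

lemma delta_deriv:
  assumes "0 \<le> x" "x < 1"
  shows "(delta x has_real_derivative (x * cos \<theta> * sin \<theta> / delta x \<theta>)) (at \<theta>)"
  unfolding delta_def using delta_arg_pos[OF assms, of \<theta>]
  by (auto intro!: derivative_eq_intros simp: field_simps power2_eq_square)

lemma antiderivative_shift:
  fixes H g :: "real \<Rightarrow> 'a::euclidean_space"
  assumes H: "\<And>t. (H has_vector_derivative g t) (at t)" and per: "\<And>t. g (t + 2 * pi) = g t"
  shows "H (t + 2 * pi * real n) = H t + real n *\<^sub>R integral {0..2*pi} g"
proof -
  have d: "((\<lambda>t. H (t + 2 * pi) - H t) has_vector_derivative 0) (at t)" for t
  proof -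
    have "((\<lambda>t. t + 2 * pi) has_vector_derivative 1) (at t)"
      by (auto intro!: derivative_eq_intros)
    from vector_diff_chain_at[OF this] H[of "t + 2 * pi"]
    have "((\<lambda>t. H (t + 2 * pi)) has_vector_derivative g t) (at t)" by (simp add: o_def per)
    from has_vector_derivative_diff[OF this H[of t]] show ?thesis by simp
  qed
  have "(g has_integral (H (2 * pi) - H 0)) {0..2*pi}"
    by (rule fundamental_theorem_of_calculus) (auto intro: has_vector_derivative_at_within[OF H])
  then have 1: "H (2 * pi) - H 0 = integral {0..2*pi} g" by (simp add: integral_unique)
  obtain z where z: "\<And>t. H (t + 2 * pi) - H t = z"
    using has_vector_derivative_zero_constant[of UNIV "\<lambda>t. H (t + 2 * pi) - H t"] d by auto
  have step: "H (t + 2 * pi) = H t + integral {0..2*pi} g" for t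
    using z[of t] z[of 0] 1 by (simp add: algebra_simps)
  show ?thesis
  proof (induction n)
    case (Suc n)
    have "H (t + 2 * pi * real (Suc n)) = H (t + 2 * pi * real n + 2 * pi)" by (simp add: algebra_simps)
    then show ?case using Suc step[of "t + 2 * pi * real n"] by (simp add: algebra_simps)
  qed simp
qed

context elastica
begin

text \<open>
  The inequality \<open>\<Lambda> \<le> |c|\<close> holds by \<open>energy_circle\<close> at the zero. In case of equality, \<open>\<mu>\<^sup>2 \<le> \<Lambda>\<kappa>\<^sup>2\<close>, so the
  derivative of \<open>\<kappa>\<^sup>2\<close> is bounded by a multiple of \<open>\<kappa>\<^sup>2\<close>. By Gronwall's argument the zero then spreads to the
  whole period, and a curve of zero curvature is straight and does not close up.
\<close>

lemma zero_of_curvature: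
  assumes t0: "t0 \<in> {0..1}" "\<kappa> t0 = 0" and "\<Lambda> \<ge> 0"
  shows "\<Lambda> < norm c"
proof (rule ccontr)
  assume "\<not> \<Lambda> < norm c"
  have "4 * (\<mu> t0)\<^sup>2 + \<Lambda>\<^sup>2 = (norm c)\<^sup>2" using energy_circle[OF t0(1)] t0(2) by simp
  then have "\<Lambda>\<^sup>2 \<le> (norm c)\<^sup>2" using zero_le_power2[of "\<mu> t0"] by linarith
  then have "\<Lambda> \<le> norm c" by (rule power2_le_imp_le) simp
  then have eq: "norm c = \<Lambda>" using \<open>\<not> \<Lambda> < norm c\<close> by simp
  have \<mu>\<kappa>: "(\<mu> t)\<^sup>2 \<le> \<Lambda> * (\<kappa> t)\<^sup>2" if "t \<in> {0..1}" for t
  proof -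
    have "4 * (\<mu> t)\<^sup>2 = 2 * \<Lambda> * (\<kappa> t)\<^sup>2 - ((\<kappa> t)\<^sup>2)\<^sup>2"
      using energy_circle[OF that] unfolding eq by (simp add: power2_diff algebra_simps)
    also have "\<dots> \<le> 4 * (\<Lambda> * (\<kappa> t)\<^sup>2)"
      using mult_nonneg_nonneg[OF \<open>\<Lambda> \<ge> 0\<close> zero_le_power2[of "\<kappa> t"]] zero_le_power2[of "(\<kappa> t)\<^sup>2"] by linarith
    finally show ?thesis by simp
  qed
  obtain B where B: "\<And>t. t \<in> {0..1} \<Longrightarrow> \<rho> t \<le> B"
    using continuous_attains_sup[OF compact_Icc _ \<rho>_continuous, of 0 1] by force
  have Bpos: "B > 0" using B[of 0] \<rho>_pos[of 0] by simp
  define K where "K = B * (1 + \<Lambda>)"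
  have bound: "2 * \<bar>\<kappa> t * (\<rho> t * \<mu> t)\<bar> \<le> K * (\<kappa> t)\<^sup>2" if t: "t \<in> {0..1}" for t
  proof -
    have "0 \<le> (\<bar>\<kappa> t\<bar> - \<bar>\<mu> t\<bar>)\<^sup>2" by simp
    then have "2 * \<bar>\<kappa> t * \<mu> t\<bar> \<le> (\<kappa> t)\<^sup>2 + (\<mu> t)\<^sup>2" by (simp add: power2_diff abs_mult)
    also have "\<dots> \<le> (1 + \<Lambda>) * (\<kappa> t)\<^sup>2" using \<mu>\<kappa>[OF t] by (simp add: algebra_simps)
    finally have "\<rho> t * (2 * \<bar>\<kappa> t * \<mu> t\<bar>) \<le> B * ((1 + \<Lambda>) * (\<kappa> t)\<^sup>2)"
      by (rule mult_mono[rotated]) (use B[OF t] Bpos in auto)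
    then show ?thesis using \<rho>_pos[of t] by (simp add: K_def abs_mult mult_ac)
  qed
  have d: "((\<lambda>t. (\<kappa> t)\<^sup>2 * exp (e * t)) has_real_derivative
     (2 * (\<kappa> t * (\<rho> t * \<mu> t)) + e * (\<kappa> t)\<^sup>2) * exp (e * t)) (at t within {0..1})" if "t \<in> {0..1}" for e t
    by (auto intro!: derivative_eq_intros \<kappa>_ode[OF that] simp: algebra_simps power2_eq_square)
  have 0: "\<kappa> t = 0" if t: "t \<in> {0..1}" for t
  proof (cases "t0 \<le> t")
    case True
    have "(\<kappa> t)\<^sup>2 * exp (- K * t) \<le> (\<kappa> t0)\<^sup>2 * exp (- K * t0)"
    proof (rule DERIV_nonpos_imp_decreasing_open[OF True])
      fix x assume x: "t0 < x" "x < t"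
      then have x': "x \<in> {0..1}" "0 < x" "x < 1" using t t0 by auto
      have "2 * (\<kappa> x * (\<rho> x * \<mu> x)) + (- K) * (\<kappa> x)\<^sup>2 \<le> 0" using bound[OF x'(1)] by (simp add: abs_le_iff)
      then have "(2 * (\<kappa> x * (\<rho> x * \<mu> x)) + (- K) * (\<kappa> x)\<^sup>2) * exp (- K * x) \<le> 0"
        by (simp add: mult_nonpos_nonneg)
      then show "\<exists>y. ((\<lambda>t. (\<kappa> t)\<^sup>2 * exp (- K * t)) has_real_derivative y) (at x) \<and> y \<le> 0"
        using d[OF x'(1), of "- K"] x' by (auto simp: at_within_Icc_at)
    qed (use t t0 in \<open>auto intro!: continuous_intros continuous_on_subset[OF \<kappa>_continuous]\<close>)
    then show ?thesis using t0(2) by (simp add: mult_le_0_iff)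
  next
    case False
    then have le: "t \<le> t0" by simp
    have "(\<kappa> t)\<^sup>2 * exp (K * t) \<le> (\<kappa> t0)\<^sup>2 * exp (K * t0)"
    proof (rule DERIV_nonneg_imp_increasing_open[OF le])
      fix x assume x: "t < x" "x < t0"
      then have x': "x \<in> {0..1}" "0 < x" "x < 1" using t t0 by auto
      have "2 * (\<kappa> x * (\<rho> x * \<mu> x)) + K * (\<kappa> x)\<^sup>2 \<ge> 0" using bound[OF x'(1)] by (simp add: abs_le_iff)
      then have "(2 * (\<kappa> x * (\<rho> x * \<mu> x)) + K * (\<kappa> x)\<^sup>2) * exp (K * x) \<ge> 0" by simp
      then show "\<exists>y. ((\<lambda>t. (\<kappa> t)\<^sup>2 * exp (K * t)) has_real_derivative y) (at x) \<and> y \<ge> 0"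
        using d[OF x'(1), of K] x' by (auto simp: at_within_Icc_at)
    qed (use t t0 in \<open>auto intro!: continuous_intros continuous_on_subset[OF \<kappa>_continuous]\<close>)
    then show ?thesis using t0(2) by (simp add: mult_le_0_iff)
  qed
  have \<tau>: "\<tau> t = \<tau> 0" if t: "t \<in> {0..1}" for t
    by (rule constant_on_unit_interval[OF _ t]) (metis \<tau>_ode 0 mult_zero_right scaleR_zero_left)
  have "(v has_integral (\<gamma> 1 - \<gamma> 0)) {0..1}"
    by (rule fundamental_theorem_of_calculus) (auto intro: has_vector_derivative_at_within[OF v_deriv])
  then have "(v has_integral 0) {0..1}" using periodic[of 0] by simp
  moreover have "(v has_integral len *\<^sub>R \<tau> 0) {0..1}"
  proof -
    have "((\<lambda>t. \<rho> t *\<^sub>R \<tau> 0) has_integral len *\<^sub>R \<tau> 0) {0..1}"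
      unfolding len_eq by (intro has_integral_scaleR_left integrable_integral integrable_continuous_real \<rho>_continuous)
    then show ?thesis
    proof (rule has_integral_eq[rotated])
      show "\<rho> t *\<^sub>R \<tau> 0 = v t" if "t \<in> {0..1}" for t
        using \<tau>[OF that] v_eq[of t] by (simp add: scaleR_conv_of_real)
    qed
  qed
  ultimately have "len *\<^sub>R \<tau> 0 = 0" by (rule has_integral_unique[symmetric])
  then show False using len_pos norm_\<tau>[of 0] by auto
qed

text \<open>
  By \<open>energy_circle\<close>, the pair of \<open>2\<mu>/(MR)\<close> and \<open>\<kappa>/M\<close>, with \<open>M\<^sup>2 = |c| + \<Lambda>\<close> and \<open>R\<^sup>2 = \<kappa>\<^sup>2 + |c| - \<Lambda>\<close>, lies on
  the unit circle, and its angle \<open>\<Phi>\<close> increases at the rate \<open>R/2 = w delta x \<Phi>\<close> per arclength. Because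
  \<open>\<kappa>\<close> and \<open>\<mu>\<close> are periodic, \<open>\<Phi>\<close> gains \<open>2\<pi>n\<close> over a period of the curve. Since \<open>\<kappa>\<close>, \<open>\<mu>\<close> and therefore \<open>\<tau>\<close>
  are functions of \<open>\<Phi>\<close>, the curve is a smooth curve \<open>B\<close> evaluated at \<open>\<Phi>\<close>. The closing condition makes
  \<open>B\<close> periodic, so that \<open>\<gamma>\<close> covers it \<open>n\<close> times and \<open>n = 1\<close>.
\<close>

lemma wavelike:
  assumes t0: "t0 \<in> {0..1}" "\<kappa> t0 = 0" and nonneg: "\<Lambda> \<ge> 0" and simple: "\<not> multiple_cover \<gamma>"
  obtains x where "1/2 \<le> x" "x < 1" "2 * ellE x = ellK x" "\<Lambda> * len\<^sup>2 = 2 * (2 * x - 1) * (ellK x)\<^sup>2"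
proof -
  define C where "C = norm c"
  have \<Lambda>C: "\<Lambda> < C" unfolding C_def by (rule zero_of_curvature[OF t0 nonneg])
  have C: "C > 0" using \<Lambda>C nonneg by simp
  define x where "x = (\<Lambda> + C) / (2 * C)"
  have x: "1/2 \<le> x" "x < 1" "0 \<le> x" using \<Lambda>C nonneg C by (auto simp: x_def field_simps)
  define M where "M = sqrt (\<Lambda> + C)"
  have M: "M > 0" "M\<^sup>2 = \<Lambda> + C" "M\<^sup>2 = 2 * C * x" using nonneg C by (auto simp: M_def x_def field_simps)
  define w where "w = sqrt (C / 2)"
  have w: "w > 0" "w\<^sup>2 = C / 2" using C by (auto simp: w_def)
  define R where "R t = sqrt ((\<kappa> t)\<^sup>2 + (C - \<Lambda>))" for t
  have Rarg: "(\<kappa> t)\<^sup>2 + (C - \<Lambda>) > 0" for t using \<Lambda>C zero_le_power2[of "\<kappa> t"] by linarith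
  have R: "R t > 0" "(R t)\<^sup>2 = (\<kappa> t)\<^sup>2 + (C - \<Lambda>)" for t using Rarg[of t] by (auto simp: R_def)
  have Rc: "continuous_on {0..1} R" unfolding R_def by (intro continuous_intros \<kappa>_continuous)
  have \<mu>2: "4 * (\<mu> t)\<^sup>2 = (M\<^sup>2 - (\<kappa> t)\<^sup>2) * (R t)\<^sup>2" if "t \<in> {0..1}" for t
    using energy_circle[OF that, folded C_def] unfolding R M(2) by (simp add: power2_eq_square algebra_simps)
  define u where "u t = complex_of_real (2 * \<mu> t / (M * R t)) + \<i> * complex_of_real (\<kappa> t / M)" for t
  have R': "(R has_real_derivative (\<kappa> t * (\<rho> t * \<mu> t) / R t)) (at t within {0..1})" if t: "t \<in> {0..1}" for t
    unfolding R_def using Rarg[of t]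
    by (auto intro!: derivative_eq_intros \<kappa>_ode[OF t] simp: field_simps)
  have p': "((\<lambda>t. 2 * \<mu> t / (M * R t)) has_real_derivative - (\<rho> t * R t / 2) * (\<kappa> t / M)) (at t within {0..1})"
    if t: "t \<in> {0..1}" for t
  proof -
    have nz: "M * R t \<noteq> 0" using M R(1)[of t] by simp
    have "((\<lambda>t. 2 * \<mu> t / (M * R t)) has_real_derivative
       ((2 * (- (\<rho> t * \<kappa> t * ((\<kappa> t)\<^sup>2 - \<Lambda>)) / 2)) * (M * R t) - (2 * \<mu> t) * (M * (\<kappa> t * (\<rho> t * \<mu> t) / R t))) / ((M * R t) * (M * R t))) (at t within {0..1})"
      by (intro DERIV_divide DERIV_cmult \<mu>_ode R' t nz)
    also have "((2 * (- (\<rho> t * \<kappa> t * ((\<kappa> t)\<^sup>2 - \<Lambda>)) / 2)) * (M * R t) - (2 * \<mu> t) * (M * (\<kappa> t * (\<rho> t * \<mu> t) / R t))) / ((M * R t) * (M * R t))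
       = - (\<rho> t * \<kappa> t / (M * R t ^ 3)) * (((\<kappa> t)\<^sup>2 - \<Lambda>) * (R t)\<^sup>2 + 4 * (\<mu> t)\<^sup>2 / 2)"
      using M R(1)[of t] by (simp add: field_simps power2_eq_square power3_eq_cube)
    also have "((\<kappa> t)\<^sup>2 - \<Lambda>) * (R t)\<^sup>2 + 4 * (\<mu> t)\<^sup>2 / 2 = (R t)\<^sup>2 * (R t)\<^sup>2 / 2"
      unfolding \<mu>2[OF t] by (simp add: R(2) M(2) field_simps)
    also have "- (\<rho> t * \<kappa> t / (M * R t ^ 3)) * ((R t)\<^sup>2 * (R t)\<^sup>2 / 2) = - (\<rho> t * R t / 2) * (\<kappa> t / M)"
      using M R(1)[of t] by (simp add: field_simps power2_eq_square power3_eq_cube)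
    finally show ?thesis .
  qed
  have q': "((\<lambda>t. \<kappa> t / M) has_real_derivative (\<rho> t * R t / 2) * (2 * \<mu> t / (M * R t))) (at t within {0..1})"
    if t: "t \<in> {0..1}" for t
    using DERIV_cdivide[OF \<kappa>_ode[OF t], of M] R(1)[of t] by (simp add: field_simps)
  have u': "(u has_vector_derivative (\<rho> t * R t / 2) *\<^sub>R (\<i> * u t)) (at t within {0..1})" if t: "t \<in> {0..1}" for t
  proof -
    have "(u has_vector_derivative (of_real (- (\<rho> t * R t / 2) * (\<kappa> t / M)) + \<i> * of_real ((\<rho> t * R t / 2) * (2 * \<mu> t / (M * R t))))) (at t within {0..1})"
      unfolding u_def using p'[OF t] q'[OF t]
      by (intro has_vector_derivative_add has_vector_derivative_mult_right has_vector_derivative_of_real)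
        (simp_all add: has_real_derivative_iff_has_vector_derivative)
    then show ?thesis by (rule has_vector_derivative_eq_rhs) (simp add: u_def complex_eq_iff)
  qed
  have nu: "norm (u t) = 1" if t: "t \<in> {0..1}" for t
  proof -
    have "(2 * \<mu> t / (M * R t))\<^sup>2 + (\<kappa> t / M)\<^sup>2 = 1"
      using M(1) R(1)[of t] by (simp add: power_divide power_mult_distrib \<mu>2[OF t] field_simps)
    then show ?thesis by (simp add: u_def cmod_def)
  qed
  define \<Phi>0 where "\<Phi>0 = Arg (u 0)"
  have u0: "cis \<Phi>0 = u 0"
  proof -
    have n: "norm (u 0) = 1" by (rule nu) simp
    then have "u 0 \<noteq> 0" by auto
    from cis_Arg[OF this] n show ?thesis by (simp add: \<Phi>0_def sgn_eq)
  qed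
  define \<Phi> where "\<Phi> t = \<Phi>0 + integral {0..t} (\<lambda>t. \<rho> t * R t / 2)" for t
  have \<Phi>': "(\<Phi> has_real_derivative \<rho> t * R t / 2) (at t within {0..1})" if t: "t \<in> {0..1}" for t
    unfolding has_real_derivative_iff_has_vector_derivative
    by (rule derivative_of_indefinite_integral[of \<Phi> \<Phi>0, OF _ _ t])
      (auto simp: \<Phi>_def intro!: continuous_intros Rc)
  have u: "u t = cis (\<Phi> t)" if t: "t \<in> {0..1}" for t
  proof -
    have "cis (- \<Phi> t) * u t = cis (- \<Phi> 0) * u 0"
    proof (rule constant_on_unit_interval[OF _ t])
      fix t :: real assume t: "t \<in> {0..1}"
      from has_vector_derivative_mult[OF has_vector_derivative_cis[OF DERIV_minus[OF \<Phi>'[OF t]]] u'[OF t]]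
      show "((\<lambda>t. cis (- \<Phi> t) * u t) has_vector_derivative 0) (at t within {0..1})"
        by (simp add: scaleR_conv_of_real algebra_simps)
    qed
    also have "cis (- \<Phi> 0) * u 0 = 1" by (simp add: \<Phi>_def u0[symmetric] cis_mult)
    finally have "cis (\<Phi> t) * (cis (- \<Phi> t) * u t) = cis (\<Phi> t)" by simp
    then show ?thesis by (simp add: mult.assoc[symmetric] cis_mult)
  qed
  have \<kappa>: "\<kappa> t = M * sin (\<Phi> t)" and \<mu>: "2 * \<mu> t = M * R t * cos (\<Phi> t)" if t: "t \<in> {0..1}" for t
  proof -
    have "Im (u t) = sin (\<Phi> t)" "Re (u t) = cos (\<Phi> t)" by (simp_all add: u[OF t])
    then show "\<kappa> t = M * sin (\<Phi> t)" "2 * \<mu> t = M * R t * cos (\<Phi> t)"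
      using M R(1)[of t] by (auto simp: u_def field_simps)
  qed
  let ?\<Delta> = "delta x"
  have \<Delta>: "?\<Delta> \<theta> > 0" "(?\<Delta> \<theta>)\<^sup>2 = 1 - x * (cos \<theta>)\<^sup>2" for \<theta>
    using delta_pos delta_square x by auto
  have RD: "R t / 2 = w * ?\<Delta> (\<Phi> t)" if t: "t \<in> {0..1}" for t
  proof (rule power2_eq_imp_eq)
    have "(R t)\<^sup>2 = M\<^sup>2 * (1 - (cos (\<Phi> t))\<^sup>2) + C - \<Lambda>"
      unfolding R(2) \<kappa>[OF t] by (simp add: power_mult_distrib sin_squared_eq)
    also have "\<dots> = 2 * C - 2 * C * x * (cos (\<Phi> t))\<^sup>2"
      using M(2) unfolding M(3) by (simp add: algebra_simps)
    finally show "(R t / 2)\<^sup>2 = (w * ?\<Delta> (\<Phi> t))\<^sup>2"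
      by (simp add: power_divide power_mult_distrib w \<Delta> algebra_simps)
  qed (use R(1)[of t] w \<Delta>(1)[of "\<Phi> t"] in auto)
  have \<Phi>'': "(\<Phi> has_real_derivative \<rho> t * (w * ?\<Delta> (\<Phi> t))) (at t within {0..1})" if t: "t \<in> {0..1}" for t
    using \<Phi>'[OF t] RD[OF t] by (simp add: mult.assoc[symmetric])
  have \<Phi>mono: "strict_mono_on {0..1} \<Phi>"
    by (rule strict_mono_on_if_derivative_pos[OF \<Phi>']) (use \<rho>_pos R(1) in auto)
  have \<Phi>c: "continuous_on {0..1} \<Phi>" by (rule DERIV_continuous_on[OF \<Phi>'])
  have "cis (\<Phi> 1) = cis (\<Phi> 0)"
    using u[of 0] u[of 1] by (simp add: u_def \<mu>_closed \<kappa>_closed R_def)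
  then have "cis (\<Phi> 1 - \<Phi> 0) = 1" by (simp add: cis_divide[symmetric])
  then obtain j :: int where j: "\<Phi> 1 - \<Phi> 0 = 2 * pi * of_int j"
    by (auto simp: complex_eq_iff cos_one_2pi_int mult.commute)
  moreover have "\<Phi> 1 - \<Phi> 0 > 0" using strict_mono_onD[OF \<Phi>mono, of 0 1] by simp
  ultimately have "j > 0" by (simp add: zero_less_mult_iff)
  define n where "n = nat j"
  have n: "n \<ge> 1" "\<Phi> 1 = \<Phi>0 + 2 * pi * real n"
    using \<open>j > 0\<close> j by (auto simp: n_def \<Phi>_def)
  have \<Phi>0: "\<Phi> 0 = \<Phi>0" by (simp add: \<Phi>_def)
  \<comment> \<open>Integration over the phase instead of the parameter.\<close>
  have subst: "((\<lambda>t. (\<rho> t * (w * ?\<Delta> (\<Phi> t))) *\<^sub>R g (\<Phi> t)) has_integral real n *\<^sub>R integral {0..2*pi} g) {0..1}"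
    if gc: "continuous_on UNIV g" and gp: "\<And>\<theta>. g (\<theta> + 2 * pi) = g \<theta>" for g :: "real \<Rightarrow> real"
  proof -
    obtain H where H: "\<And>t. (H has_vector_derivative g t) (at t)" using antiderivative_exists[OF gc] by blast
    have "((\<lambda>t. (\<rho> t * (w * ?\<Delta> (\<Phi> t))) *\<^sub>R g (\<Phi> t)) has_integral (H (\<Phi> 1) - H (\<Phi> 0))) {0..1}"
    proof (rule fundamental_theorem_of_calculus)
      fix t :: real assume t: "t \<in> {0..1}"
      have "((H \<circ> \<Phi>) has_vector_derivative (\<rho> t * (w * ?\<Delta> (\<Phi> t))) *\<^sub>R g (\<Phi> t)) (at t within {0..1})"
        by (rule vector_diff_chain_within)
          (use \<Phi>''[OF t] H in \<open>auto simp: has_real_derivative_iff_has_vector_derivative intro: has_vector_derivative_at_within\<close>)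
      then show "((\<lambda>t. H (\<Phi> t)) has_vector_derivative (\<rho> t * (w * ?\<Delta> (\<Phi> t))) *\<^sub>R g (\<Phi> t)) (at t within {0..1})"
        by (simp add: o_def)
    qed simp
    also have "H (\<Phi> 1) - H (\<Phi> 0) = real n *\<^sub>R integral {0..2*pi} g"
      using antiderivative_shift[OF H gp, of \<Phi>0 n] by (simp add: n \<Phi>0)
    finally show ?thesis .
  qed
  have dnz: "?\<Delta> \<theta> \<noteq> 0" for \<theta> using \<Delta>(1)[of \<theta>] by simp
  have lenK: "w * len = real n * ellK x"
  proof -
    have "((\<lambda>t. (\<rho> t * (w * ?\<Delta> (\<Phi> t))) *\<^sub>R (1 / ?\<Delta> (\<Phi> t))) has_integral real n *\<^sub>R ellK x) {0..1}"
      unfolding ellK_def by (rule subst) (use dnz in \<open>auto intro!: continuous_intros simp: delta_periodic\<close>)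
    then have "((\<lambda>t. w * \<rho> t) has_integral real n * ellK x) {0..1}"
      using dnz by (simp add: mult.commute)
    moreover have "((\<lambda>t. w * \<rho> t) has_integral w * len) {0..1}"
      unfolding len_eq by (intro has_integral_mult_right integrable_integral integrable_continuous_real \<rho>_continuous)
    ultimately show ?thesis using has_integral_unique by blast
  qed
  have ints: "(\<lambda>\<theta>. 1 / ?\<Delta> \<theta>) integrable_on {0..2*pi}" "?\<Delta> integrable_on {0..2*pi}"
    using dnz by (auto intro!: integrable_continuous_real continuous_intros)
  have close_int: "((\<lambda>\<theta>. 2 * ?\<Delta> \<theta> - 1 / ?\<Delta> \<theta>) has_integral (2 * ellE x - ellK x)) {0..2*pi}"
    unfolding ellE_def ellK_def by (intro has_integral_diff has_integral_mult_right integrable_integral ints)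
  have \<kappa>\<Lambda>: "(\<kappa> t)\<^sup>2 - \<Lambda> = C * (2 * (?\<Delta> (\<Phi> t))\<^sup>2 - 1)" if t: "t \<in> {0..1}" for t
  proof -
    have "(\<kappa> t)\<^sup>2 = M\<^sup>2 - M\<^sup>2 * (cos (\<Phi> t))\<^sup>2"
      unfolding \<kappa>[OF t] by (simp add: power_mult_distrib sin_squared_eq algebra_simps)
    then have "(\<kappa> t)\<^sup>2 - \<Lambda> = C - 2 * C * x * (cos (\<Phi> t))\<^sup>2"
      using M(2) unfolding M(3) by simp
    then show ?thesis by (simp add: \<Delta> algebra_simps)
  qed
  have close: "2 * ellE x = ellK x"
  proof -
    have "((\<lambda>t. (\<rho> t * (w * ?\<Delta> (\<Phi> t))) *\<^sub>R (2 * ?\<Delta> (\<Phi> t) - 1 / ?\<Delta> (\<Phi> t))) has_integral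
       real n *\<^sub>R integral {0..2*pi} (\<lambda>\<theta>. 2 * ?\<Delta> \<theta> - 1 / ?\<Delta> \<theta>)) {0..1}"
      by (rule subst) (use dnz in \<open>auto intro!: continuous_intros simp: delta_periodic\<close>)
    moreover have "((\<lambda>t. (w / C) * (\<rho> t * ((\<kappa> t)\<^sup>2 - \<Lambda>))) has_integral (w / C) * 0) {0..1}"
      by (rule has_integral_mult_right[OF mean_zero])
    moreover have "(w / C) * (\<rho> t * ((\<kappa> t)\<^sup>2 - \<Lambda>)) = (\<rho> t * (w * ?\<Delta> (\<Phi> t))) *\<^sub>R (2 * ?\<Delta> (\<Phi> t) - 1 / ?\<Delta> (\<Phi> t))"
      if "t \<in> {0..1}" for t
      using dnz[of "\<Phi> t"] C unfolding \<kappa>\<Lambda>[OF that] by (simp add: field_simps power2_eq_square)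
    ultimately have "real n *\<^sub>R integral {0..2*pi} (\<lambda>\<theta>. 2 * ?\<Delta> \<theta> - 1 / ?\<Delta> \<theta>) = (w / C) * 0"
      using has_integral_unique has_integral_eq by (metis (no_types, lifting))
    then show ?thesis using n(1) integral_unique[OF close_int] by simp
  qed
  have "n = 1"
  proof (rule ccontr)
    assume "n \<noteq> 1"
    then have n2: "n \<ge> 2" using n(1) by simp
    \<comment> \<open>\<open>b\<close> is the derivative of the curve with respect to the phase, that is, \<open>\<tau> / (w \<Delta>)\<close>.\<close>
    define b where "b \<theta> = (c / of_real (C\<^sup>2)) * (of_real (C / w * (2 * ?\<Delta> \<theta> - 1 / ?\<Delta> \<theta>)) - \<i> * of_real (2 * M * cos \<theta>))" for \<theta>
    define b' where "b' \<theta> = (c / of_real (C\<^sup>2)) * (of_real (C / w * (2 + 1 / (?\<Delta> \<theta>)\<^sup>2) * (x * cos \<theta> * sin \<theta> / ?\<Delta> \<theta>)) + \<i> * of_real (2 * M * sin \<theta>))" for \<theta>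
    have cnz: "c \<noteq> 0" using C by (auto simp: C_def)
    have bd: "(b has_vector_derivative b' \<theta>) (at \<theta>)" for \<theta>
    proof -
      have 1: "((\<lambda>\<theta>. C / w * (2 * ?\<Delta> \<theta> - 1 / ?\<Delta> \<theta>)) has_real_derivative
         C / w * (2 + 1 / (?\<Delta> \<theta>)\<^sup>2) * (x * cos \<theta> * sin \<theta> / ?\<Delta> \<theta>)) (at \<theta>)"
        unfolding mult.assoc
        using dnz[of \<theta>] delta_deriv[OF x(3,2), of \<theta>]
        by (intro DERIV_cmult) (auto intro!: derivative_eq_intros simp: field_simps power2_eq_square)
      have 2: "((\<lambda>\<theta>. 2 * M * cos \<theta>) has_real_derivative - (2 * M * sin \<theta>)) (at \<theta>)"
        by (auto intro!: derivative_eq_intros)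
      have "((\<lambda>\<theta>. (c / of_real (C\<^sup>2)) * (of_real (C / w * (2 * ?\<Delta> \<theta> - 1 / ?\<Delta> \<theta>)) - \<i> * of_real (2 * M * cos \<theta>))) has_vector_derivative
         (c / of_real (C\<^sup>2)) * (of_real (C / w * (2 + 1 / (?\<Delta> \<theta>)\<^sup>2) * (x * cos \<theta> * sin \<theta> / ?\<Delta> \<theta>)) - \<i> * of_real (- (2 * M * sin \<theta>)))) (at \<theta>)"
        by (intro has_vector_derivative_mult_right has_vector_derivative_diff has_vector_derivative_of_real 1 2)
      then show ?thesis by (simp add: b_def[abs_def] b'_def)
    qed
    have bc: "continuous_on S b" for S
      using bd by (meson continuous_at_imp_continuous_on has_vector_derivative_continuous)
    have b'c: "continuous_on UNIV b'"
      unfolding b'_def using dnz C by (intro continuous_intros) auto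
    have bper: "b (\<theta> + 2 * pi) = b \<theta>" for \<theta> by (simp add: b_def delta_periodic)
    have bnz: "b \<theta> \<noteq> 0" for \<theta>
    proof
      assume "b \<theta> = 0"
      then have "of_real (C / w * (2 * ?\<Delta> \<theta> - 1 / ?\<Delta> \<theta>)) - \<i> * of_real (2 * M * cos \<theta>) = (0::complex)"
        using cnz C by (simp add: b_def)
      then have "2 * ?\<Delta> \<theta> - 1 / ?\<Delta> \<theta> = 0" "cos \<theta> = 0"
        using C w M by (simp_all add: complex_eq_iff)
      then show False using \<Delta>(2)[of \<theta>] dnz[of \<theta>] by (simp add: field_simps power2_eq_square)
    qed
    have b0: "(b has_integral 0) {0..2*pi}"
    proof -
      have "((\<lambda>\<theta>. 2 * M * cos \<theta>) has_integral (2 * M * sin (2 * pi) - 2 * M * sin 0)) {0..2*pi}"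
        by (rule fundamental_theorem_of_calculus)
          (auto intro!: derivative_eq_intros simp: has_real_derivative_iff_has_vector_derivative[symmetric])
      then have "((\<lambda>\<theta>. 2 * M * cos \<theta>) has_integral 0) {0..2*pi}" by simp
      from has_integral_linear[OF this bounded_linear_of_real]
      have 1: "((\<lambda>\<theta>. complex_of_real (2 * M * cos \<theta>)) has_integral 0) {0..2*pi}" by (simp add: o_def)
      have "((\<lambda>\<theta>. C / w * (2 * ?\<Delta> \<theta> - 1 / ?\<Delta> \<theta>)) has_integral 0) {0..2*pi}"
        using has_integral_mult_right[OF close_int, of "C / w"] close by simp
      from has_integral_linear[OF this bounded_linear_of_real]
      have 2: "((\<lambda>\<theta>. complex_of_real (C / w * (2 * ?\<Delta> \<theta> - 1 / ?\<Delta> \<theta>))) has_integral 0) {0..2*pi}"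
        by (simp only: o_def of_real_0)
      have "(b has_integral ((c / of_real (C\<^sup>2)) * (0 - \<i> * 0))) {0..2*pi}"
        unfolding b_def by (intro has_integral_mult_right has_integral_diff 1 2)
      then show ?thesis by simp
    qed
    obtain B1 where B1: "\<And>t. (B1 has_vector_derivative b t) (at t)" using antiderivative_exists[OF bc] by blast
    define B where "B \<theta> = B1 \<theta> + (\<gamma> 0 - B1 \<Phi>0)" for \<theta>
    have B: "(B has_vector_derivative b t) (at t)" for t
      unfolding B_def using has_vector_derivative_add[OF B1 has_vector_derivative_const] by simp
    have Bper: "B (\<theta> + 2 * pi) = B \<theta>" for \<theta>
      using antiderivative_shift[OF B bper, of \<theta> 1] integral_unique[OF b0] by simp
    have \<tau>b: "\<tau> t = (w * ?\<Delta> (\<Phi> t)) *\<^sub>R b (\<Phi> t)" if t: "t \<in> {0..1}" for t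
    proof -
      have "of_real ((\<kappa> t)\<^sup>2 - \<Lambda>) - \<i> * of_real (2 * \<mu> t) = cnj c * \<tau> t"
        using first_integral[OF t] by (simp add: \<mu>_def inner_complex_def complex_eq_iff field_simps)
      then have "c * (of_real ((\<kappa> t)\<^sup>2 - \<Lambda>) - \<i> * of_real (2 * \<mu> t)) = of_real (C\<^sup>2) * \<tau> t"
        by (simp only: C_def complex_norm_square mult.assoc)
      then have "\<tau> t = (c / of_real (C\<^sup>2)) * (of_real ((\<kappa> t)\<^sup>2 - \<Lambda>) - \<i> * of_real (2 * \<mu> t))"
        using C by (simp add: field_simps)
      also have "of_real ((\<kappa> t)\<^sup>2 - \<Lambda>) - \<i> * of_real (2 * \<mu> t)
         = of_real (w * ?\<Delta> (\<Phi> t)) * (of_real (C / w * (2 * ?\<Delta> (\<Phi> t) - 1 / ?\<Delta> (\<Phi> t))) - \<i> * complex_of_real (2 * M * cos (\<Phi> t)))"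
      proof -
        have "(\<kappa> t)\<^sup>2 - \<Lambda> = (w * ?\<Delta> (\<Phi> t)) * (C / w * (2 * ?\<Delta> (\<Phi> t) - 1 / ?\<Delta> (\<Phi> t)))"
          unfolding \<kappa>\<Lambda>[OF t] using w dnz[of "\<Phi> t"] by (simp add: field_simps power2_eq_square)
        moreover have "2 * \<mu> t = (w * ?\<Delta> (\<Phi> t)) * (2 * M * cos (\<Phi> t))"
          unfolding \<mu>[OF t] RD[OF t, symmetric] by simp
        moreover have "complex_of_real (A * B) - \<i> * of_real (A * D) = of_real A * (of_real B - \<i> * of_real D)"
          for A B D by (simp add: algebra_simps)
        ultimately show ?thesis by (simp only:)
      qed
      finally show ?thesis by (simp add: b_def scaleR_conv_of_real mult_ac)
    qed
    have \<gamma>B: "\<gamma> t = B (\<Phi> t)" if t: "t \<in> {0..1}" for t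
    proof -
      have "\<gamma> t - B (\<Phi> t) = \<gamma> 0 - B (\<Phi> 0)"
      proof (rule constant_on_unit_interval[OF _ t])
        fix t :: real assume t: "t \<in> {0..1}"
        have "((B \<circ> \<Phi>) has_vector_derivative (\<rho> t * (w * ?\<Delta> (\<Phi> t))) *\<^sub>R b (\<Phi> t)) (at t within {0..1})"
          by (rule vector_diff_chain_within)
            (use \<Phi>''[OF t] B in \<open>auto simp: has_real_derivative_iff_has_vector_derivative intro: has_vector_derivative_at_within\<close>)
        from has_vector_derivative_diff[OF has_vector_derivative_at_within[OF v_deriv] this]
        show "((\<lambda>t. \<gamma> t - B (\<Phi> t)) has_vector_derivative 0) (at t within {0..1})"
          using \<tau>b[OF t] by (simp add: o_def v_eq scaleR_conv_of_real mult.assoc)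
      qed
      then show ?thesis by (simp add: \<Phi>0 B_def)
    qed
    define \<beta> where "\<beta> u = B (\<Phi>0 + 2 * pi * u)" for u
    have lin: "((\<lambda>u. \<Phi>0 + 2 * pi * u) has_vector_derivative 2 * pi) (at u)" for u
      unfolding has_real_derivative_iff_has_vector_derivative[symmetric]
      by (auto intro!: derivative_eq_intros)
    have "closed_regular_curve \<beta>"
    proof (rule closed_regular_curve_if_C2[where w = "\<lambda>u. (2 * pi) *\<^sub>R b (\<Phi>0 + 2 * pi * u)"
           and a = "\<lambda>u. (2 * pi) *\<^sub>R ((2 * pi) *\<^sub>R b' (\<Phi>0 + 2 * pi * u))"])
      show "(\<beta> has_vector_derivative (2 * pi) *\<^sub>R b (\<Phi>0 + 2 * pi * u)) (at u)" for u
        using vector_diff_chain_at[OF lin B] by (simp add: o_def \<beta>_def[abs_def])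
      show "((\<lambda>u. (2 * pi) *\<^sub>R b (\<Phi>0 + 2 * pi * u)) has_vector_derivative (2 * pi) *\<^sub>R ((2 * pi) *\<^sub>R b' (\<Phi>0 + 2 * pi * u))) (at u)" for u
        using bounded_linear.has_vector_derivative[OF bounded_linear_scaleR_right[of "2 * pi"] vector_diff_chain_at[OF lin bd]]
        by (simp only: o_def)
      show "continuous_on UNIV (\<lambda>u. (2 * pi) *\<^sub>R ((2 * pi) *\<^sub>R b' (\<Phi>0 + 2 * pi * u)))"
        by (intro continuous_intros continuous_on_compose2[OF b'c]) auto
      show "\<beta> (u + 1) = \<beta> u" for u
        using Bper[of "\<Phi>0 + 2 * pi * u"] by (simp add: \<beta>_def algebra_simps)
    qed (use bnz in auto)
    then have "multiple_cover \<gamma>"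
    proof (rule multiple_coverI[where m = n and f = "\<lambda>t. (\<Phi> t - \<Phi>0) / (2 * pi)"])
      show "strict_mono_on {0..1} (\<lambda>t. (\<Phi> t - \<Phi>0) / (2 * pi))"
        using \<Phi>mono unfolding strict_mono_on_def by (auto simp: divide_strict_right_mono)
      show "\<gamma> t = \<beta> ((\<Phi> t - \<Phi>0) / (2 * pi))" if "t \<in> {0..1}" for t
        by (simp add: \<gamma>B[OF that] \<beta>_def)
    qed (use n2 n(2) \<Phi>0 periodic in \<open>auto intro!: continuous_intros \<Phi>c\<close>)
    with simple show False by contradiction
  qed
  then have "w * len = ellK x" using lenK by simp
  then have "C / 2 * len\<^sup>2 = (ellK x)\<^sup>2" using w(2) by (metis power_mult_distrib)
  moreover have "\<Lambda> = C * (2 * x - 1)" using M by (simp add: algebra_simps)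
  moreover have "C * (2 * x - 1) * len\<^sup>2 = 2 * (2 * x - 1) * (C / 2 * len\<^sup>2)" by simp
  ultimately have "\<Lambda> * len\<^sup>2 = 2 * (2 * x - 1) * (ellK x)\<^sup>2" by (simp only:)
  with that x close show thesis by blast
qed

end

section \<open>Numerical evaluation of the elliptic integrals\<close>

lemma ellK_mono:
  assumes "0 \<le> x" "x \<le> y" "y < 1"
  shows "ellK x \<le> ellK y"
  unfolding ellK_def
proof (rule integral_le)
  have nz: "delta x \<theta> \<noteq> 0" "delta y \<theta> \<noteq> 0" for \<theta>
    using delta_pos[of x \<theta>] delta_pos[of y \<theta>] assms by auto
  show "(\<lambda>\<theta>. 1 / delta x \<theta>) integrable_on {0..2*pi}" "(\<lambda>\<theta>. 1 / delta y \<theta>) integrable_on {0..2*pi}"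
    using nz by (auto intro!: integrable_continuous_real continuous_intros)
  fix \<theta> :: real
  have "delta y \<theta> \<le> delta x \<theta>" unfolding delta_def using assms by (simp add: mult_right_mono)
  then show "1 / delta x \<theta> \<le> 1 / delta y \<theta>"
    using delta_pos[of y \<theta>] assms by (intro divide_left_mono mult_pos_pos delta_pos) auto
qed

lemma ellE_antimono:
  assumes "x \<le> y" shows "ellE y \<le> ellE x"
  unfolding ellE_def
  by (intro integral_le integrable_continuous_real delta_continuous)
    (use assms in \<open>simp add: delta_def mult_right_mono\<close>)

lemma abs_gbinomial_le_1:
  fixes p :: real
  assumes "-1 \<le> p" "p \<le> 1"
  shows "\<bar>p gchoose n\<bar> \<le> 1"
proof (induction n)
  case (Suc n)
  have "\<bar>(p - real n) / (real n + 1)\<bar> \<le> 1" using assms by (simp add: abs_le_iff)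
  then have "\<bar>p gchoose n\<bar> * \<bar>(p - real n) / (real n + 1)\<bar> \<le> 1 * 1"
    using Suc by (intro mult_mono) auto
  moreover have "p gchoose Suc n = (p gchoose n) * ((p - real n) / (real n + 1))"
    using gbinomial_mult_1[of p n] by (simp add: field_simps)
  ultimately show ?case by (simp add: abs_mult)
qed simp

lemma binomial_series_remainder:
  fixes p y r :: real
  assumes p: "-1 \<le> p" "p \<le> 1" and y: "\<bar>y\<bar> \<le> r" and r: "r < 1"
  shows "\<bar>(1 + y) powr p - (\<Sum>i<n. (p gchoose i) * y ^ i)\<bar> \<le> r ^ n / (1 - r)"
proof -
  let ?f = "\<lambda>i. (p gchoose i) * y ^ i"
  have "?f sums (1 + y) powr p" by (rule gen_binomial_real) (use y r in auto)
  then have "(\<lambda>i. ?f (i + n)) sums ((1 + y) powr p - (\<Sum>i<n. ?f i))" by (rule sums_split_initial_segment)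
  moreover have g: "(\<lambda>i. r ^ n * r ^ i) sums (r ^ n * (1 / (1 - r)))"
    by (intro sums_mult geometric_sums) (use y r in auto)
  moreover have "norm (?f (i + n)) \<le> r ^ n * r ^ i" for i
  proof -
    have "\<bar>p gchoose (i + n)\<bar> * \<bar>y\<bar> ^ (i + n) \<le> 1 * r ^ (i + n)"
      using y by (intro mult_mono abs_gbinomial_le_1 p power_mono) auto
    then show ?thesis by (simp add: abs_mult power_abs power_add mult_ac)
  qed
  ultimately have "norm ((1 + y) powr p - (\<Sum>i<n. ?f i)) \<le> r ^ n * (1 / (1 - r))"
    by (metis (no_types, lifting) norm_suminf_le sums_iff sums_summable)
  then show ?thesis by simp
qed

text \<open>
  The derivative of \<open>sin 2\<theta> cos\<^sup>n\<^sup>+\<^sup>1 2\<theta>\<close> yields Wallis' recursion from \<open>n\<close> to \<open>n + 2\<close>.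
\<close>

lemma cos_power_integrals:
  "((\<lambda>\<theta>. cos (2 * \<theta>) ^ (2 * j)) has_integral (2 * pi * (\<Prod>i<j. (2 * real i + 1) / (2 * real i + 2)))) {0..2*pi}" (is ?A)
  "((\<lambda>\<theta>. cos (2 * \<theta>) ^ (2 * j + 1)) has_integral 0) {0..2*pi}" (is ?B)
proof -
  have rec: "((\<lambda>\<theta>. cos (2 * \<theta>) ^ (n + 2)) has_integral ((real n + 1) / (real n + 2) * I)) {0..2*pi}"
    if I: "((\<lambda>\<theta>. cos (2 * \<theta>) ^ n) has_integral I) {0..2*pi}" for n and I :: real
  proof -
    let ?F = "\<lambda>\<theta>::real. sin (2 * \<theta>) * cos (2 * \<theta>) ^ (n + 1) / (2 * (real n + 2))"
    let ?f = "\<lambda>\<theta>::real. cos (2 * \<theta>) ^ (n + 2) - (real n + 1) / (real n + 2) * cos (2 * \<theta>) ^ n"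
    have "(?F has_real_derivative ?f \<theta>) (at \<theta> within {0..2*pi})" for \<theta>
    proof -
      have "(?F has_real_derivative ((2 * cos (2 * \<theta>)) * cos (2 * \<theta>) ^ (n + 1)
          + ((real n + 1) * cos (2 * \<theta>) ^ n * (- 2 * sin (2 * \<theta>))) * sin (2 * \<theta>)) / (2 * (real n + 2))) (at \<theta> within {0..2*pi})"
      proof (rule DERIV_cdivide, rule has_field_derivative_at_within)
        have 1: "((\<lambda>\<theta>. sin (2 * \<theta>)) has_real_derivative 2 * cos (2 * \<theta>)) (at \<theta>)"
          "((\<lambda>\<theta>. cos (2 * \<theta>)) has_real_derivative - 2 * sin (2 * \<theta>)) (at \<theta>)"
          by (auto intro!: derivative_eq_intros)
        from DERIV_mult[OF 1(1) DERIV_power[OF 1(2), of "n + 1"]]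
        show "((\<lambda>\<theta>. sin (2 * \<theta>) * cos (2 * \<theta>) ^ (n + 1)) has_real_derivative
          (2 * cos (2 * \<theta>)) * cos (2 * \<theta>) ^ (n + 1)
          + ((real n + 1) * cos (2 * \<theta>) ^ n * (- 2 * sin (2 * \<theta>))) * sin (2 * \<theta>)) (at \<theta>)"
          by (rule DERIV_cong) (simp add: algebra_simps)
      qed
      also have "((2 * cos (2 * \<theta>)) * cos (2 * \<theta>) ^ (n + 1)
          + ((real n + 1) * cos (2 * \<theta>) ^ n * (- 2 * sin (2 * \<theta>))) * sin (2 * \<theta>))
         = 2 * cos (2 * \<theta>) ^ n * ((cos (2 * \<theta>))\<^sup>2 - (real n + 1) * (sin (2 * \<theta>))\<^sup>2)"
        by (simp add: power2_eq_square algebra_simps)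
      also have "\<dots> / (2 * (real n + 2)) = ?f \<theta>"
        unfolding sin_squared_eq by (simp add: field_simps power2_eq_square)
      finally show ?thesis .
    qed
    then have "(?f has_integral (?F (2 * pi) - ?F 0)) {0..2*pi}"
      by (intro fundamental_theorem_of_calculus) (auto simp: has_real_derivative_iff_has_vector_derivative)
    moreover have "?F (2 * pi) - ?F 0 = 0" using sin_npi[of 4] by (simp add: mult.commute)
    ultimately have "(?f has_integral 0) {0..2*pi}" by simp
    from has_integral_add[OF this has_integral_mult_right[OF I, of "(real n + 1) / (real n + 2)"]]
    show ?thesis by simp
  qed
  show ?A
  proof (induction j)
    case 0
    then show ?case using has_integral_const_real[of "1::real" 0 "2 * pi"] by simp
  next
    case (Suc j)
    from rec[OF Suc] show ?case by (simp add: mult_ac)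
  qed
  show ?B
  proof (induction j)
    case 0
    have "((\<lambda>\<theta>. cos (2 * \<theta>)) has_integral (sin (2 * (2 * pi)) / 2 - sin (2 * 0) / 2)) {0..2*pi}"
      by (rule fundamental_theorem_of_calculus)
        (auto intro!: derivative_eq_intros simp: has_real_derivative_iff_has_vector_derivative[symmetric])
    then show ?case using sin_npi[of 4] by (simp add: mult.commute)
  next
    case (Suc j)
    from rec[OF Suc] show ?case by simp
  qed
qed

text \<open>
  A partial sum of the mean value of \<open>(1 - r cos 2\<theta>)\<^sup>p\<close> over a period, as a power series in \<open>z = r\<^sup>2\<close>: the
  odd powers of the cosine have mean value zero.
\<close>

definition even_binomial_sum :: "real \<Rightarrow> real \<Rightarrow> nat \<Rightarrow> real" where
  "even_binomial_sum p z n = (\<Sum>j<n. (p gchoose (2 * j)) * (\<Prod>i<j. (2 * real i + 1) / (2 * real i + 2)) * z ^ j)"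

text \<open>
  The same sum in Horner form, where each factor is the quotient of consecutive coefficients. Rewriting
  evaluates it without binomial coefficients.
\<close>

fun nested_sum :: "real \<Rightarrow> real \<Rightarrow> nat \<Rightarrow> nat \<Rightarrow> real" where
  "nested_sum p z j 0 = 0"
| "nested_sum p z j (Suc n) = 1 + z * (p - 2 * real j) * (p - 2 * real j - 1) / (4 * (real j + 1)\<^sup>2) * nested_sum p z (Suc j) n"

lemma even_binomial_sum_eq_nested_sum: "even_binomial_sum p z n = nested_sum p z 0 n"
proof -
  define q where "q j = (p gchoose (2 * j)) * (\<Prod>i<j. (2 * real i + 1) / (2 * real i + 2)) * z ^ j" for j
  have q: "q (Suc j) = q j * (z * (p - 2 * real j) * (p - 2 * real j - 1) / (4 * (real j + 1)\<^sup>2))" for j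
  proof -
    have s: "p gchoose Suc n = (p gchoose n) * ((p - real n) / (real n + 1))" for n
      using gbinomial_mult_1[of p n] by (simp add: field_simps)
    have "p gchoose (2 * Suc j) = (p gchoose (2 * j)) * ((p - 2 * real j) / (2 * real j + 1)) * ((p - 2 * real j - 1) / (2 * real j + 2))"
      using s[of "2 * j"] s[of "Suc (2 * j)"] by (simp add: algebra_simps)
    then have "q (Suc j) = q j * (z * (p - 2 * real j) * (p - 2 * real j - 1)
        * ((2 * real j + 1) / ((2 * real j + 1) * (2 * real j + 2) * (2 * real j + 2))))"
      by (simp add: q_def mult_ac)
    also have "(2 * real j + 1) / ((2 * real j + 1) * (2 * real j + 2) * (2 * real j + 2)) = 1 / (4 * (real j + 1)\<^sup>2)"
    proof -
      have "A / (A * B * B) = 1 / (B * B)" if "A > 0" for A B :: real using that by simp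
      moreover have "4 * (real j + 1)\<^sup>2 = (2 * real j + 2) * (2 * real j + 2)"
        by (simp add: power2_eq_square algebra_simps)
      ultimately show ?thesis by simp
    qed
    finally show ?thesis by simp
  qed
  have "(\<Sum>i<n. q (j + i)) = q j * nested_sum p z j n" for j
  proof (induction n arbitrary: j)
    case (Suc n)
    have "(\<Sum>i<Suc n. q (j + i)) = q j + (\<Sum>i<n. q (Suc j + i))"
      by (subst sum.lessThan_Suc_shift) simp
    also have "\<dots> = q j + q (Suc j) * nested_sum p z (Suc j) n" by (simp only: Suc)
    finally show ?case by (simp add: q distrib_left mult.assoc)
  qed simp
  from this[of 0] show ?thesis by (simp add: even_binomial_sum_def q_def)
qed

lemma integral_powr_approx:
  assumes p: "-1 \<le> p" "p \<le> 1" and r: "0 < r" "r < 1"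
  shows "\<bar>integral {0..2*pi} (\<lambda>\<theta>. (1 - r * cos (2 * \<theta>)) powr p) - 2 * pi * even_binomial_sum p (r\<^sup>2) n\<bar>
     \<le> 2 * pi * (r ^ (2 * n) / (1 - r))"
proof -
  let ?S = "\<lambda>\<theta>. \<Sum>i<2 * n. (p gchoose i) * (- r * cos (2 * \<theta>)) ^ i"
  define J where "J i = (if even i then 2 * pi * (\<Prod>k<i div 2. (2 * real k + 1) / (2 * real k + 2)) else 0)" for i :: nat
  have J: "((\<lambda>\<theta>. cos (2 * \<theta>) ^ i) has_integral J i) {0..2*pi}" for i
  proof (cases "even i")
    case True
    then show ?thesis using cos_power_integrals(1)[of "i div 2"] by (simp add: J_def)
  next
    case False
    then have "i = 2 * (i div 2) + 1" by presburger
    then show ?thesis using cos_power_integrals(2)[of "i div 2"] False by (simp add: J_def)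
  qed
  have "(?S has_integral (\<Sum>i<2 * n. (p gchoose i) * (- r) ^ i * J i)) {0..2*pi}"
    unfolding power_mult_distrib mult.assoc[symmetric]
    by (intro has_integral_sum has_integral_mult_right J) auto
  moreover have "(\<Sum>i<2 * n. (p gchoose i) * (- r) ^ i * J i) = 2 * pi * even_binomial_sum p (r\<^sup>2) n"
  proof (induction n)
    case (Suc n)
    have "2 * Suc n = Suc (Suc (2 * n))" by simp
    then show ?case using Suc unfolding even_binomial_sum_def
      by (simp add: J_def power_mult[symmetric] algebra_simps)
  qed (simp add: even_binomial_sum_def)
  ultimately have S: "(?S has_integral 2 * pi * even_binomial_sum p (r\<^sup>2) n) {0..2*pi}" by simp
  have y: "\<bar>- r * cos (2 * \<theta>)\<bar> \<le> r" for \<theta>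
    using r mult_left_mono[OF abs_cos_le_one[of "2 * \<theta>"], of r] by (simp add: abs_mult)
  have pos: "1 - r * cos (2 * \<theta>) > 0" for \<theta> using abs_le_D2[OF y[of \<theta>]] r by linarith
  have P: "(\<lambda>\<theta>. (1 - r * cos (2 * \<theta>)) powr p) integrable_on {0..2*pi}"
    using pos by (intro integrable_continuous_real continuous_intros) (metis less_irrefl)
  have "integral {0..2*pi} (\<lambda>\<theta>. (1 - r * cos (2 * \<theta>)) powr p) - 2 * pi * even_binomial_sum p (r\<^sup>2) n
     = integral {0..2*pi} (\<lambda>\<theta>. (1 - r * cos (2 * \<theta>)) powr p - ?S \<theta>)"
    using P S by (simp add: integral_diff has_integral_integrable integral_unique)
  also have "norm \<dots> \<le> integral {0..2*pi} (\<lambda>\<theta>. r ^ (2 * n) / (1 - r))"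
  proof (rule integral_norm_bound_integral)
    fix \<theta> :: real
    show "norm ((1 - r * cos (2 * \<theta>)) powr p - ?S \<theta>) \<le> r ^ (2 * n) / (1 - r)"
      using binomial_series_remainder[OF p y[of \<theta>] r(2), of "2 * n"] by simp
  qed (use P S has_integral_integrable in \<open>auto intro!: integrable_diff\<close>)
  finally show ?thesis by (simp add: mult_ac)
qed

text \<open>
  For \<open>x = 2r/(1+r)\<close> the double angle formula gives \<open>1 - x cos\<^sup>2 \<theta> = (1 - r cos 2\<theta>)/(1+r)\<close>. The passage
  from \<open>x\<close> to \<open>r\<^sup>2\<close> accelerates the convergence: near the root, \<open>x\<close> is 0.83 and \<open>r\<^sup>2\<close> is 0.50.
\<close>

lemma elliptic_integrals_approx:
  assumes r: "0 < r" "r < 1" and x: "x = 2 * r / (1 + r)"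
  shows "\<bar>ellK x - sqrt (1 + r) * (2 * pi * even_binomial_sum (-1/2) (r\<^sup>2) n)\<bar> \<le> sqrt (1 + r) * (2 * pi * (r ^ (2 * n) / (1 - r)))"
    and "\<bar>ellE x - 2 * pi * even_binomial_sum (1/2) (r\<^sup>2) n / sqrt (1 + r)\<bar> \<le> 2 * pi * (r ^ (2 * n) / (1 - r)) / sqrt (1 + r)"
proof -
  have d: "delta x \<theta> = sqrt (1 - r * cos (2 * \<theta>)) / sqrt (1 + r)" for \<theta>
  proof -
    have "1 - x * (cos \<theta>)\<^sup>2 = (1 - r * cos (2 * \<theta>)) / (1 + r)"
      using r unfolding x cos_double_cos by (simp add: field_simps)
    then show ?thesis by (simp add: delta_def real_sqrt_divide)
  qed
  have pos: "1 - r * cos (2 * \<theta>) > 0" for \<theta>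
  proof -
    have "r * cos (2 * \<theta>) \<le> r * 1" using r by (intro mult_left_mono) auto
    then show ?thesis using r by linarith
  qed
  have K: "ellK x = sqrt (1 + r) * integral {0..2*pi} (\<lambda>\<theta>. (1 - r * cos (2 * \<theta>)) powr (-1/2))"
    unfolding ellK_def integral_mult_right[symmetric] d
  proof (intro integral_cong)
    fix \<theta>
    have "(1 - r * cos (2 * \<theta>)) powr (-1/2) = 1 / sqrt (1 - r * cos (2 * \<theta>))"
      using pos[of \<theta>] powr_minus[of "1 - r * cos (2 * \<theta>)" "1/2"] by (simp add: powr_half_sqrt inverse_eq_divide)
    then show "1 / (sqrt (1 - r * cos (2 * \<theta>)) / sqrt (1 + r)) = sqrt (1 + r) * (1 - r * cos (2 * \<theta>)) powr (-1/2)"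
      by simp
  qed
  have E: "ellE x = integral {0..2*pi} (\<lambda>\<theta>. (1 - r * cos (2 * \<theta>)) powr (1/2)) / sqrt (1 + r)"
    unfolding ellE_def integral_divide[symmetric] d[abs_def]
    using pos by (intro integral_cong) (simp add: powr_half_sqrt less_imp_le)
  have s: "sqrt (1 + r) > 0" using r by simp
  show "\<bar>ellK x - sqrt (1 + r) * (2 * pi * even_binomial_sum (-1/2) (r\<^sup>2) n)\<bar> \<le> sqrt (1 + r) * (2 * pi * (r ^ (2 * n) / (1 - r)))"
    unfolding K right_diff_distrib[symmetric] abs_mult abs_of_pos[OF s]
    by (rule mult_left_mono[OF integral_powr_approx]) (use r s in auto)
  show "\<bar>ellE x - 2 * pi * even_binomial_sum (1/2) (r\<^sup>2) n / sqrt (1 + r)\<bar> \<le> 2 * pi * (r ^ (2 * n) / (1 - r)) / sqrt (1 + r)"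
    unfolding E diff_divide_distrib[symmetric] abs_divide abs_of_pos[OF s]
    by (rule divide_right_mono[OF integral_powr_approx]) (use r s in auto)
qed

text \<open>
  The two values of \<open>r\<close> enclose the root 0.703744064\<open>\<dots>\<close> of \<open>2 E = K\<close> closely enough for the energy
  to be determined up to 0.00005. They are chosen with small denominators, which keeps the exact
  rational arithmetic short.
\<close>

lemma nested_sum_values:
  "\<bar>nested_sum (-1/2) ((658/935)\<^sup>2) 0 24 - 1.132041197\<bar> \<le> 1 / 10 ^ 9"
  "\<bar>nested_sum (1/2) ((658/935)\<^sup>2) 0 24 - 0.964354678\<bar> \<le> 1 / 10 ^ 9"
  "\<bar>nested_sum (-1/2) ((639/908)\<^sup>2) 0 24 - 1.132041848\<bar> \<le> 1 / 10 ^ 9"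
  "\<bar>nested_sum (1/2) ((639/908)\<^sup>2) 0 24 - 0.964354538\<bar> \<le> 1 / 10 ^ 9"
  by (simp_all add: numeral_eq_Suc)

text \<open>
  Here \<open>\<delta>\<close> bounds the truncation error of the binomial series, and \<open>K\<close>, \<open>E\<close> approximate the truncated
  series up to \<open>\<epsilon>\<close>. In terms of the series the factors \<open>1 + r\<close> of \<open>ellK\<^sup>2\<close> and of \<open>2x - 1 = (3r - 1)/(1+r)\<close>
  cancel.
\<close>

lemma elliptic_bounds:
  assumes r: "1/3 < r" "r < 1" and x: "x = 2 * r / (1 + r)"
    and \<delta>: "r ^ (2 * n) / (1 - r) \<le> \<delta>"
    and K: "\<bar>even_binomial_sum (-1/2) (r\<^sup>2) n - K\<bar> \<le> \<epsilon>" and E: "\<bar>even_binomial_sum (1/2) (r\<^sup>2) n - E\<bar> \<le> \<epsilon>"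
    and Kpos: "K - \<epsilon> - \<delta> \<ge> 0"
  shows "2 * ellE x - ellK x \<ge> 2 * pi / sqrt (1 + r) * (2 * (E - \<epsilon> - \<delta>) - (1 + r) * (K + \<epsilon> + \<delta>))"
    and "2 * ellE x - ellK x \<le> 2 * pi / sqrt (1 + r) * (2 * (E + \<epsilon> + \<delta>) - (1 + r) * (K - \<epsilon> - \<delta>))"
    and "8 * (2 * x - 1) * (ellK x)\<^sup>2 \<ge> 32 * pi\<^sup>2 * (K - \<epsilon> - \<delta>)\<^sup>2 * (3 * r - 1)"
    and "8 * (2 * x - 1) * (ellK x)\<^sup>2 \<le> 32 * pi\<^sup>2 * (K + \<epsilon> + \<delta>)\<^sup>2 * (3 * r - 1)"
proof -
  define q where "q = sqrt (1 + r)"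
  have q: "q > 0" "q\<^sup>2 = 1 + r" using r by (auto simp: q_def)
  define A where "A = ellK x / (2 * pi * q)"
  define B where "B = ellE x * q / (2 * pi)"
  have r0: "0 < r" using r by simp
  note ap = elliptic_integrals_approx[OF r0 r(2) x, of n, folded q_def]
  have "\<bar>ellK x / (2 * pi * q) - even_binomial_sum (-1/2) (r\<^sup>2) n\<bar> \<le> r ^ (2 * n) / (1 - r)"
  proof -
    have "ellK x / (2 * pi * q) - even_binomial_sum (-1/2) (r\<^sup>2) n = (ellK x - q * (2 * pi * even_binomial_sum (-1/2) (r\<^sup>2) n)) / (2 * pi * q)"
      using q by (simp add: field_simps)
    then show ?thesis using ap(1) q by (simp add: abs_divide pos_divide_le_eq abs_mult mult_ac)
  qed
  then have A: "K - \<epsilon> - \<delta> \<le> A" "A \<le> K + \<epsilon> + \<delta>" using \<delta> K by (auto simp: A_def abs_le_iff)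
  have "\<bar>ellE x * q / (2 * pi) - even_binomial_sum (1/2) (r\<^sup>2) n\<bar> \<le> r ^ (2 * n) / (1 - r)"
  proof -
    have "ellE x * q / (2 * pi) - even_binomial_sum (1/2) (r\<^sup>2) n = (ellE x - 2 * pi * even_binomial_sum (1/2) (r\<^sup>2) n / q) * (q / (2 * pi))"
      using q by (simp add: field_simps)
    also have "\<bar>\<dots>\<bar> \<le> (2 * pi * (r ^ (2 * n) / (1 - r)) / q) * (q / (2 * pi))"
      unfolding abs_mult using ap(2) q by (intro mult_mono) auto
    finally show ?thesis using q by simp
  qed
  then have B: "E - \<epsilon> - \<delta> \<le> B" "B \<le> E + \<epsilon> + \<delta>" using \<delta> E by (auto simp: B_def abs_le_iff)
  have KA: "ellK x = 2 * pi * q * A" and EB: "ellE x = 2 * pi / q * B" using q by (simp_all add: A_def B_def)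
  have D: "2 * ellE x - ellK x = 2 * pi / q * (2 * B - (1 + r) * A)"
    unfolding KA EB q(2)[symmetric] using q(1) by (simp add: field_simps power2_eq_square)
  have f: "2 * pi / q \<ge> 0" using q by simp
  have a: "(1 + r) * A \<le> (1 + r) * (K + \<epsilon> + \<delta>)" "(1 + r) * (K - \<epsilon> - \<delta>) \<le> (1 + r) * A"
    using A r0 by (auto intro!: mult_left_mono)
  have b: "2 * (E - \<epsilon> - \<delta>) \<le> 2 * B" "2 * B \<le> 2 * (E + \<epsilon> + \<delta>)" using B by auto
  show "2 * ellE x - ellK x \<ge> 2 * pi / sqrt (1 + r) * (2 * (E - \<epsilon> - \<delta>) - (1 + r) * (K + \<epsilon> + \<delta>))"
    unfolding D q_def[symmetric] by (rule mult_left_mono[OF diff_mono[OF b(1) a(1)] f])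
  show "2 * ellE x - ellK x \<le> 2 * pi / sqrt (1 + r) * (2 * (E + \<epsilon> + \<delta>) - (1 + r) * (K - \<epsilon> - \<delta>))"
    unfolding D q_def[symmetric] by (rule mult_left_mono[OF diff_mono[OF b(2) a(2)] f])
  have "2 * x - 1 = (3 * r - 1) / q\<^sup>2" unfolding x q(2) using r0 by (simp add: field_simps)
  then have F: "8 * (2 * x - 1) * (ellK x)\<^sup>2 = 32 * pi\<^sup>2 * A\<^sup>2 * (3 * r - 1)"
    unfolding KA using q(1) by (simp add: power_mult_distrib)
  have "(K - \<epsilon> - \<delta>)\<^sup>2 \<le> A\<^sup>2" "A\<^sup>2 \<le> (K + \<epsilon> + \<delta>)\<^sup>2" using A Kpos by (auto intro: power_mono)
  then show "8 * (2 * x - 1) * (ellK x)\<^sup>2 \<ge> 32 * pi\<^sup>2 * (K - \<epsilon> - \<delta>)\<^sup>2 * (3 * r - 1)"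
    "8 * (2 * x - 1) * (ellK x)\<^sup>2 \<le> 32 * pi\<^sup>2 * (K + \<epsilon> + \<delta>)\<^sup>2 * (3 * r - 1)"
    unfolding F using r by (auto intro!: mult_right_mono mult_left_mono)
qed

text \<open>
  The numbers \<open>a\<close> and \<open>b\<close> are \<open>2r/(1+r)\<close> for \<open>r = 658/935\<close> and \<open>r = 639/908\<close>. Since \<open>2 ellE - ellK\<close> is
  positive at \<open>a\<close>, negative at \<open>b\<close> and antitone, \<open>x\<close> lies between them; then \<open>(2x - 1) ellK\<^sup>2\<close>, which is
  monotone, lies between its values there. The truncation error after 24 terms is below \<open>1.7 \<sqdot> 10\<^sup>-\<^sup>7\<close>.
\<close>

lemma wavelike_value:
  assumes x: "1/2 \<le> x" "x < 1" and root: "2 * ellE x = ellK x"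
  shows "(21.20745)\<^sup>2 \<le> 8 * (2 * x - 1) * (ellK x)\<^sup>2" "8 * (2 * x - 1) * (ellK x)\<^sup>2 \<le> (21.20755)\<^sup>2"
proof -
  define a b :: real where "a = 1316 / 1593" and "b = 1278 / 1547"
  have p: "(3.141592653)\<^sup>2 \<le> pi\<^sup>2" "pi\<^sup>2 \<le> (3.141592654)\<^sup>2"
    using pi_approx by (auto intro!: power_mono)
  note ba = elliptic_bounds[of "658/935" a 24 "17 / 10 ^ 8" "1.132041197" "1 / 10 ^ 9" "0.964354678", unfolded even_binomial_sum_eq_nested_sum]
  note bb = elliptic_bounds[of "639/908" b 24 "17 / 10 ^ 8" "1.132041848" "1 / 10 ^ 9" "0.964354538", unfolded even_binomial_sum_eq_nested_sum]
  have "0 < 2 * pi / sqrt (1 + 658/935) * (2 * (0.964354678 - 1 / 10 ^ 9 - 17 / 10 ^ 8) - (1 + 658/935) * (1.132041197 + 1 / 10 ^ 9 + 17 / 10 ^ 8))"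
    by (rule mult_pos_pos) simp_all
  also have "\<dots> \<le> 2 * ellE a - ellK a"
    by (rule ba(1)[OF _ _ _ _ nested_sum_values(1,2)]) (simp_all add: a_def power_divide)
  finally have Da: "0 < 2 * ellE a - ellK a" .
  have "2 * ellE b - ellK b \<le> 2 * pi / sqrt (1 + 639/908) * (2 * (0.964354538 + 1 / 10 ^ 9 + 17 / 10 ^ 8) - (1 + 639/908) * (1.132041848 - 1 / 10 ^ 9 - 17 / 10 ^ 8))"
    by (rule bb(2)[OF _ _ _ _ nested_sum_values(3,4)]) (simp_all add: b_def power_divide)
  also have "\<dots> < 0"
    by (rule mult_pos_neg) simp_all
  finally have Db: "2 * ellE b - ellK b < 0" .
  have ax: "a < x"
  proof (rule ccontr)
    assume "\<not> a < x"
    then have "ellK x \<le> ellK a" "ellE a \<le> ellE x"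
      using x by (auto intro!: ellK_mono ellE_antimono simp: a_def)
    then show False using Da root by simp
  qed
  have xb: "x < b"
  proof (rule ccontr)
    assume "\<not> x < b"
    then have "ellK b \<le> ellK x" "ellE x \<le> ellE b"
      using x by (auto intro!: ellK_mono ellE_antimono simp: b_def)
    then show False using Db root by simp
  qed
  have Knonneg: "0 \<le> ellK y" if "0 \<le> y" "y < 1" for y
    unfolding ellK_def by (rule integral_nonneg)
      (use delta_pos[OF that] in \<open>auto intro!: integrable_continuous_real continuous_intros simp: less_imp_le less_imp_neq[symmetric]\<close>)
  have mono: "8 * (2 * y - 1) * (ellK y)\<^sup>2 \<le> 8 * (2 * z - 1) * (ellK z)\<^sup>2" if "1/2 \<le> y" "y \<le> z" "z < 1" for y z
    using that by (intro mult_mono power_mono ellK_mono Knonneg) auto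
  have "(21.20745)\<^sup>2 \<le> 32 * (3.141592653)\<^sup>2 * (1.132041197 - 1 / 10 ^ 9 - 17 / 10 ^ 8)\<^sup>2 * (3 * (658/935) - 1 :: real)"
    by (simp add: power2_eq_square)
  also have "\<dots> \<le> 32 * pi\<^sup>2 * (1.132041197 - 1 / 10 ^ 9 - 17 / 10 ^ 8)\<^sup>2 * (3 * (658/935) - 1)"
    by (intro mult_right_mono mult_left_mono p) auto
  also have "\<dots> \<le> 8 * (2 * a - 1) * (ellK a)\<^sup>2"
    by (rule ba(3)[OF _ _ _ _ nested_sum_values(1,2)]) (simp_all add: a_def power_divide)
  also have "\<dots> \<le> 8 * (2 * x - 1) * (ellK x)\<^sup>2"
    using ax x by (intro mono) (auto simp: a_def)
  finally show "(21.20745)\<^sup>2 \<le> 8 * (2 * x - 1) * (ellK x)\<^sup>2" .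
  have "8 * (2 * x - 1) * (ellK x)\<^sup>2 \<le> 8 * (2 * b - 1) * (ellK b)\<^sup>2"
    using xb x by (intro mono) (auto simp: b_def)
  also have "\<dots> \<le> 32 * pi\<^sup>2 * (1.132041848 + 1 / 10 ^ 9 + 17 / 10 ^ 8)\<^sup>2 * (3 * (639/908) - 1)"
    by (rule bb(4)[OF _ _ _ _ nested_sum_values(3,4)]) (simp_all add: b_def power_divide)
  also have "\<dots> \<le> 32 * (3.141592654)\<^sup>2 * (1.132041848 + 1 / 10 ^ 9 + 17 / 10 ^ 8)\<^sup>2 * (3 * (639/908) - 1)"
    by (intro mult_right_mono mult_left_mono p) auto
  also have "\<dots> \<le> (21.20755)\<^sup>2"
    by (simp add: power2_eq_square)
  finally show "8 * (2 * x - 1) * (ellK x)\<^sup>2 \<le> (21.20755)\<^sup>2" .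
qed

section \<open>The optimal rescaling\<close>

lemma
  assumes "closed_regular_curve \<gamma>" and "c > 0"
  shows elastic_energy_dilate: "elastic_energy (dilate c \<gamma>) = elastic_energy \<gamma> / c"
    and curve_length_dilate: "curve_length (dilate c \<gamma>) = c * curve_length \<gamma>"
proof -
  interpret regular_curve \<gamma> by unfold_locales fact
  have vel: "velocity (dilate c \<gamma>) t = c *\<^sub>R v t" for t
    unfolding dilate_def
    by (intro vector_derivative_at bounded_linear.has_vector_derivative[OF bounded_linear_scaleR_right v_deriv])
  have acc: "vector_derivative (\<lambda>t. c *\<^sub>R v t) (at t) = c *\<^sub>R a t" if "t \<notin> rough" for t
    by (intro vector_derivative_at bounded_linear.has_vector_derivative[OF bounded_linear_scaleR_right a_deriv] that)
  have "elastic_energy (dilate c \<gamma>) = integral {0..1} (\<lambda>t. (\<rho> t * (k t)\<^sup>2) / c)"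
    unfolding elastic_energy_def
  proof (rule integral_spike[OF negligible_rough])
    fix t assume "t \<in> {0..1} - rough"
    then have t: "t \<notin> rough" by simp
    have "curvature (dilate c \<gamma>) t = Im (cnj (c *\<^sub>R v t) * (c *\<^sub>R a t)) / norm (c *\<^sub>R v t) ^ 3"
      by (simp only: curvature_def vel acc[OF t])
    also have "\<dots> = (Im (cnj (v t) * a t) / norm (v t) ^ 3) / c"
      using \<open>c > 0\<close> v_nonzero[of t] by (simp add: field_simps power3_eq_cube)
    also have "\<dots> = k t / c" by (simp add: k_def curvature_def v_def a_def)
    finally show "(\<rho> t * (k t)\<^sup>2) / c = (curvature (dilate c \<gamma>) t)\<^sup>2 * norm (velocity (dilate c \<gamma>) t)"
      unfolding vel using \<open>c > 0\<close> by (simp add: \<rho>_def power2_eq_square)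
  qed
  then show "elastic_energy (dilate c \<gamma>) = elastic_energy \<gamma> / c"
    unfolding energy_eq by simp
  show "curve_length (dilate c \<gamma>) = c * curve_length \<gamma>"
    unfolding curve_length_def vel using \<open>c > 0\<close> by (simp add: v_def)
qed

text \<open>
  The function \<open>E/c + cL\<close> of \<open>c\<close> is minimal at \<open>d = \<surd>(E/L)\<close>, and its excess over the minimal value \<open>2dL\<close>
  is \<open>L (d - c)\<^sup>2 / c\<close>.
\<close>

lemma optimal_rescaling_energy:
  assumes \<gamma>: "closed_regular_curve \<gamma>" and opt: "optimal_rescaling \<gamma> \<Gamma>" and E: "elastic_energy \<gamma> > 0"
  shows "penalized_energy \<Gamma> > 0" "(penalized_energy \<Gamma>)\<^sup>2 = 4 * elastic_energy \<gamma> * curve_length \<gamma>"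
proof -
  interpret regular_curve \<gamma> by unfold_locales fact
  let ?E = "elastic_energy \<gamma>" and ?L = "curve_length \<gamma>"
  have L: "?L > 0" using len_pos by (simp add: len_def)
  have pe: "penalized_energy (dilate d \<gamma>) = ?E / d + d * ?L" if "d > 0" for d
    unfolding penalized_energy_def elastic_energy_dilate[OF \<gamma> that] curve_length_dilate[OF \<gamma> that] ..
  obtain c where c: "c > 0" "\<Gamma> = dilate c \<gamma>"
    "\<And>d. d > 0 \<Longrightarrow> penalized_energy (dilate c \<gamma>) \<le> penalized_energy (dilate d \<gamma>)"
    using opt unfolding optimal_rescaling_def by blast
  define d where "d = sqrt (?E / ?L)"
  have d: "d > 0" "d\<^sup>2 = ?E / ?L" using E L by (auto simp: d_def)
  have Ed: "?E = d\<^sup>2 * ?L" using d L by simp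
  have "?E / d = d * ?L" using d(1) by (subst Ed) (simp add: power2_eq_square)
  then have "?E / d + d * ?L = 2 * d * ?L" by simp
  then have le: "?E / c + c * ?L \<le> 2 * d * ?L" using c(3)[OF d(1)] pe[OF c(1)] pe[OF d(1)] by simp
  have "?E / c + c * ?L - 2 * d * ?L = ?L / c * (d - c)\<^sup>2"
    unfolding Ed using c(1) by (simp add: field_simps power2_eq_square)
  moreover have "?L / c * (d - c)\<^sup>2 \<ge> 0" using L c(1) by simp
  ultimately have eq: "penalized_energy \<Gamma> = 2 * d * ?L" using le pe[OF c(1)] c(2) by simp
  then show "penalized_energy \<Gamma> > 0" using d L by simp
  have "(2 * d * ?L)\<^sup>2 = 4 * (d\<^sup>2 * ?L) * ?L" by (simp add: power2_eq_square)
  then show "(penalized_energy \<Gamma>)\<^sup>2 = 4 * ?E * ?L" unfolding eq Ed[symmetric] .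
qed

theorem proposition6p4:
  fixes \<gamma> \<F> :: "real \<Rightarrow> complex"
  assumes "figure_eight \<gamma>"
    and "optimal_rescaling \<gamma> \<F>"
  shows "\<bar>penalized_energy \<F> - 21.2075\<bar> \<le> 0.00005"
proof -
  have el: "closed_elastica \<gamma>" and si: "self_intersecting \<gamma>" and simple: "\<not> multiple_cover \<gamma>"
    using assms(1) by (auto simp: figure_eight_def)
  have reg: "closed_regular_curve \<gamma>" using el by (simp add: closed_elastica_def)
  interpret regular_curve \<gamma> by unfold_locales fact
  obtain \<kappa> c where "elastica \<gamma> \<kappa> c"
  proof (rule elastica_equations[OF el])
    fix \<kappa> c
    assume *: "\<And>t. t \<in> {0..1} \<Longrightarrow> (\<tau> has_vector_derivative ((\<rho> t * \<kappa> t) *\<^sub>R (\<i> * \<tau> t))) (at t within {0..1})"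
    "\<And>t. t \<in> {0..1} \<Longrightarrow> (\<kappa> has_vector_derivative (\<rho> t * (((\<i> * \<tau> t) \<bullet> c) / 2))) (at t within {0..1})"
    "\<And>t. t \<in> {0..1} \<Longrightarrow> (\<kappa> t)\<^sup>2 = \<Lambda> + \<tau> t \<bullet> c"
    "\<kappa> 1 = \<kappa> 0"
    "integral {0..1} (\<lambda>t. \<rho> t * (\<kappa> t)\<^sup>2) = elastic_energy \<gamma>"
    have "elastica \<gamma> \<kappa> c" by unfold_locales (fact *)+
    then show thesis by (rule that)
  qed
  then interpret elastica \<gamma> \<kappa> c .
  have E0: "elastic_energy \<gamma> \<ge> 0"
    unfolding energy_eq using \<rho>k2_integrable[of 0 1] \<rho>_pos
    by (intro integral_nonneg) (auto simp: absolutely_integrable_on_def less_imp_le)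
  then have \<Lambda>0: "\<Lambda> \<ge> 0" using len_pos by (simp add: \<Lambda>_def)
  obtain t0 where t0: "t0 \<in> {0..1}" "\<kappa> t0 = 0" using circle[OF _ si] simple by blast
  obtain x where x: "1/2 \<le> x" "x < 1" "2 * ellE x = ellK x" "\<Lambda> * len\<^sup>2 = 2 * (2 * x - 1) * (ellK x)\<^sup>2"
    by (rule wavelike[OF t0 \<Lambda>0 simple])
  have EL: "elastic_energy \<gamma> * curve_length \<gamma> = \<Lambda> * len\<^sup>2"
    using len_pos by (simp add: \<Lambda>_def power2_eq_square len_def)
  note bounds = wavelike_value[OF x(1,2,3)]
  \<comment> \<open>The numerical bound excludes \<open>x = 1/2\<close>, which would mean zero energy.\<close>
  have "0 < (21.20745 :: real)\<^sup>2" by simp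
  also have "\<dots> \<le> 4 * (2 * (2 * x - 1) * (ellK x)\<^sup>2)" 
  proof -
    have "4 * (2 * (2 * x - 1) * (ellK x)\<^sup>2) = 8 * (2 * x - 1) * (ellK x)\<^sup>2" by simp
    then show ?thesis using bounds(1) by (simp only:)
  qed
  finally have "0 < 4 * (2 * (2 * x - 1) * (ellK x)\<^sup>2)" .
  from zero_less_mult_pos[OF this] have "0 < elastic_energy \<gamma> * curve_length \<gamma>"
    unfolding EL x(4) by (simp only: zero_less_numeral)
  then have "elastic_energy \<gamma> > 0" using E0 by (auto simp: less_le)
  note F = optimal_rescaling_energy[OF reg assms(2) this]
  have F2: "(penalized_energy \<F>)\<^sup>2 = 8 * (2 * x - 1) * (ellK x)\<^sup>2"
  proof -
    have "(penalized_energy \<F>)\<^sup>2 = 4 * (elastic_energy \<gamma> * curve_length \<gamma>)" using F(2) by simp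
    also have "\<dots> = 8 * (2 * x - 1) * (ellK x)\<^sup>2" unfolding EL x(4) by simp
    finally show ?thesis .
  qed
  have "21.20745 \<le> penalized_energy \<F>"
    by (rule power2_le_imp_le) (use bounds(1) F in \<open>auto simp: F2\<close>)
  moreover have "penalized_energy \<F> \<le> 21.20755"
    by (rule power2_le_imp_le) (use bounds(2) in \<open>auto simp: F2\<close>)
  ultimately show ?thesis unfolding abs_le_iff by (intro conjI) simp_all
qed

end
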